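(* Let $\mathcal T=(\mathcal V,\mathcal E)$ be a locally finite tree without leaves and without isolated points in its boundary, rooted at $v_0\in\mathcal V$ and endowed with a plane order. Let $\mathcal D$ be a finite set and let $\ell:\mathcal V\setminus\{v_0\}\to\mathcal D$ be a labelling compatible with the plane order. Assume in addition that for every $\delta\in\mathcal D$ the tree $\mathcal T$ is spanned by $\ell^{-1}(\delta)$, i.e. $\mathcal T$ is the smallest subtree of $\mathcal T$ containing $\ell^{-1}(\delta)$. Then the set $V_\ell$ of almost automorphisms of $\mathcal T$ admitting a label-preserving representative is a subgroup of $\operatorname{AAut}(\mathcal T)$. Moreover, there exist a diconnected and non-circular finite oriented graph $\mathfrak g$ and a clopen subset $Y\subset\mathcal G_{\mathfrak g}^{(0)}$ such that $V_\ell\cong\mathcal F(\mathcal G_{\mathfrak g}|_Y)$.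
   Context: Almost automorphisms: the children of a vertex $v$ of the rooted tree $\mathcal T$ are its neighbours farther from $v_0$, and $\mathcal T_v$ is the subtree of all vertices $w$ such that $v$ lies on the geodesic from $v_0$ to $w$. The boundary $\partial\mathcal T$ is the set of infinite geodesics starting at $v_0$, with basis of topology the sets $\partial\mathcal T_v$ of those passing through $v$. A finite subtree $T\subset\mathcal T$ is complete if it contains $v_0$ and, for every vertex of $T$ that is not a leaf, all its children lie in $T$; here a leaf of $T$ is a vertex with no child in $T$ and $\mathcal LT$ is the set of leaves. Put $\mathcal T\setminus T:=\bigsqcup_{v\in\mathcal LT}\mathcal T_v$. An honest almost automorphism is a forest isomorphism $\varphi:\mathcal T\setminus T_1\to\mathcal T\setminus T_2$ with $T_1,T_2$ finite complete subtrees. Two honest almost automorphisms with domains $\mathcal T\setminus T_1$, $\mathcal T\setminus T_1'$ are equivalent if they agree on $\mathcal T\setminus T$ for some finite complete subtree $T\supset T_1\cup T_1'$. The equivalence classes (almost automorphisms) form a group $\operatorname{AAut}(\mathcal T)$ by composing representatives with matching image and domain. Plane order and labelling: a plane order is a choice, for each vertex $v$, of a total order $<_v$ on the children of $v$. A labelling is a map $\ell:\mathcal V\setminus\{v_0\}\to\mathcal D$ to a finite set. It is compatible with the plane order if whenever $\ell(v)=\ell(w)$, the vertices $v$ and $w$ have the same number $k$ of children, and writing the children in increasing order as $v_1<\dots<v_k$ and $w_1<\dots<w_k$ one has $\ell(v_i)=\ell(w_i)$ for all $i$. An honest almost automorphism $\varphi:\mathcal T\setminus T_1\to\mathcal T\setminus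 T_2$ is label-preserving if (i) for every vertex $v$ of $\mathcal T\setminus T_1$ it maps the children of $v$ to the children of $\varphi(v)$ in an order-preserving way, and (ii) $\ell(v)=\ell(\varphi(v))$ for all $v\in\mathcal LT_1$ (void if $T_1=T_2=\{v_0\}$). Shift groupoid: an oriented graph $\mathfrak g=(\mathfrak v,\mathfrak e)$ (multiple edges and loops allowed) has adjacency matrix $M_{\mathfrak g}(v,w)=$ number of oriented edges from $v$ to $w$. Diconnected and non-circular means: $M_{\mathfrak g}$ is irreducible (for all $v,w$ there is $n$ with $M_{\mathfrak g}^n(v,w)\ne0$) and is not a permutation matrix. $X_{\mathfrak g}$ is the space of infinite oriented paths $(e_k)_{k\in\mathbb N}$ in $\mathfrak g$ (a closed subspace of $\mathfrak e^{\mathbb N}$), with shift $\sigma(e)_k=e_{k+1}$. The groupoid $\mathcal G_{\mathfrak g}$ has object space $\mathcal G_{\mathfrak g}^{(0)}=X_{\mathfrak g}$ and morphism space $\mathcal G_{\mathfrak g}^{(1)}=\{(x,n-m,y)\in X_{\mathfrak g}\times\mathbb Z\times X_{\mathfrak g}\mid n,m\ge0,\ \sigma^n(x)=\sigma^m(y)\}$, with topology generated by the sets $\{(x,n-m,y)\mid x\in U,\,y\in V,\,\sigma^n(x)=\sigma^m(y)\}$ for $U,V\subset X_{\mathfrak g}$ clopen and $n,m\geq 0$; source and range are $s(x,k,y)=y$, $r(x,k,y)=x$; the product is $(x,k,y)(y,k',z)=(x,k+k',z)$ and the inverse $(x,k,y)^{-1}=(y,-k,x)$. For $Y\subset\mathcal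 G^{(0)}$ clopen, the reduction $\mathcal G|_Y$ has object space $Y$ and morphisms $\{g\in\mathcal G^{(1)}\mid s(g),r(g)\in Y\}$, with subspace topologies. For an étale groupoid $\mathcal G$, a bisection is a clopen subset $U\subset\mathcal G^{(1)}$ such that $s|_U$ and $r|_U$ are homeomorphisms $U\to\mathcal G^{(0)}$; the topological full group is $\mathcal F(\mathcal G)=\{r\circ(s|_U)^{-1}\mid U\text{ a bisection}\}\le\operatorname{Homeo}(\mathcal G^{(0)})$. *)

theory Defs
  imports
    "HOL-Analysis.Function_Topology"
    "HOL-Algebra.Bij"
    "HOL-Algebra.Coset"
    "HOL-Combinatorics.Permutations"
    "Graph_Theory.Digraph"
begin

section \<open>Rooted trees\<close>

record 'v rooted_graph =
  rverts :: "'v set"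
  redges :: "'v set set"
  rroot :: 'v

definition walk :: "'v set \<Rightarrow> 'v set set \<Rightarrow> 'v list \<Rightarrow> bool" where
  "walk V E p \<longleftrightarrow> p \<noteq> [] \<and> set p \<subseteq> V \<and> successively (\<lambda>u v. {u, v} \<in> E) p"

definition simple_cycle :: "'v set \<Rightarrow> 'v set set \<Rightarrow> 'v list \<Rightarrow> bool" where
  "simple_cycle V E c \<longleftrightarrow> walk V E c \<and> distinct c \<and> 3 \<le> length c \<and> {last c, hd c} \<in> E"

definition is_tree :: "'v set \<Rightarrow> 'v set set \<Rightarrow> bool" where
  "is_tree V E \<longleftrightarrow>
     V \<noteq> {} \<and>
     (\<forall>e\<in>E. \<exists>u\<in>V. \<exists>v\<in>V. u \<noteq> v \<and> e = {u, v}) \<and>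
     (\<forall>u\<in>V. \<forall>v\<in>V. \<exists>p. walk V E p \<and> hd p = u \<and> last p = v) \<and>
     (\<nexists>c. simple_cycle V E c)"

definition rooted_tree :: "'v rooted_graph \<Rightarrow> bool" where
  "rooted_tree T \<longleftrightarrow> is_tree (rverts T) (redges T) \<and> rroot T \<in> rverts T"

definition locally_finite :: "'v rooted_graph \<Rightarrow> bool" where
  "locally_finite T \<longleftrightarrow> (\<forall>v\<in>rverts T. finite {w. {v, w} \<in> redges T})"

text \<open>A subtree of a tree contains every edge joining two of its vertices, so subtrees are
  represented by their vertex sets.\<close>

definition subtree :: "'v rooted_graph \<Rightarrow> 'v set \<Rightarrow> bool" where
  "subtree T S \<longleftrightarrow> S \<subseteq> rverts T \<and> is_tree S {e \<in> redges T. e \<subseteq> S}"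

definition spanned_by :: "'v rooted_graph \<Rightarrow> 'v set \<Rightarrow> bool" where
  "spanned_by T A \<longleftrightarrow>
     A \<subseteq> rverts T \<and> (\<forall>S. subtree T S \<and> A \<subseteq> S \<longrightarrow> rverts T \<subseteq> S)"

definition gdist :: "'v rooted_graph \<Rightarrow> 'v \<Rightarrow> 'v \<Rightarrow> nat" where
  "gdist T u v =
     (LEAST n. \<exists>p. walk (rverts T) (redges T) p \<and> hd p = u \<and> last p = v \<and> length p = Suc n)"

definition geodesic :: "'v rooted_graph \<Rightarrow> 'v list \<Rightarrow> bool" where
  "geodesic T p \<longleftrightarrow>
     walk (rverts T) (redges T) p \<and> length p = Suc (gdist T (hd p) (last p))"

definition children :: "'v rooted_graph \<Rightarrow> 'v \<Rightarrow> 'v set" where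
  "children T v =
     {w. {v, w} \<in> redges T \<and> gdist T (rroot T) v < gdist T (rroot T) w}"

definition subtree_at :: "'v rooted_graph \<Rightarrow> 'v \<Rightarrow> 'v set" where
  "subtree_at T v = {w. \<exists>p. geodesic T p \<and> hd p = rroot T \<and> last p = w \<and> v \<in> set p}"

definition leaves :: "'v rooted_graph \<Rightarrow> 'v set \<Rightarrow> 'v set" where
  "leaves T S = {v \<in> S. children T v \<inter> S = {}}"


section \<open>The boundary\<close>

definition boundary :: "'v rooted_graph \<Rightarrow> (nat \<Rightarrow> 'v) set" where
  "boundary T =
     {r. r 0 = rroot T \<and> (\<forall>m n. m \<le> n \<longrightarrow> geodesic T (map r [m..<Suc n]))}"

definition boundary_at :: "'v rooted_graph \<Rightarrow> 'v \<Rightarrow> (nat \<Rightarrow> 'v) set" where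
  "boundary_at T v = {r \<in> boundary T. v \<in> range r}"

definition boundary_topology :: "'v rooted_graph \<Rightarrow> (nat \<Rightarrow> 'v) topology" where
  "boundary_topology T = topology_generated_by (boundary_at T ` rverts T)"

definition no_isolated_points :: "'a topology \<Rightarrow> bool" where
  "no_isolated_points X \<longleftrightarrow> (\<forall>x\<in>topspace X. \<not> openin X {x})"


section \<open>Almost automorphisms\<close>

definition complete_subtree :: "'v rooted_graph \<Rightarrow> 'v set \<Rightarrow> bool" where
  "complete_subtree T S \<longleftrightarrow>
     finite S \<and> subtree T S \<and> rroot T \<in> S \<and> (\<forall>v\<in>S - leaves T S. children T v \<subseteq> S)"

text \<open>The forest obtained by removing \<open>S\<close> still contains the leaves of \<open>S\<close>,
  as the roots of its components.\<close>

definition forest_verts :: "'v rooted_graph \<Rightarrow> 'v set \<Rightarrow> 'v set" where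
  "forest_verts T S = (\<Union>v\<in>leaves T S. subtree_at T v)"

definition forest_edges :: "'v rooted_graph \<Rightarrow> 'v set \<Rightarrow> 'v set set" where
  "forest_edges T S = (\<Union>v\<in>leaves T S. {e \<in> redges T. e \<subseteq> subtree_at T v})"

definition forest_iso :: "'v rooted_graph \<Rightarrow> 'v set \<Rightarrow> ('v \<Rightarrow> 'v) \<Rightarrow> 'v set \<Rightarrow> bool" where
  "forest_iso T S \<phi> S' \<longleftrightarrow>
     bij_betw \<phi> (forest_verts T S) (forest_verts T S') \<and>
     (\<forall>x\<in>forest_verts T S. \<forall>y\<in>forest_verts T S.
        {x, y} \<in> forest_edges T S \<longleftrightarrow> {\<phi> x, \<phi> y} \<in> forest_edges T S')"

text \<open>The triple \<open>(S, \<phi>, S')\<close> stands for the forest isomorphism \<open>\<phi>\<close> from the complement of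
  \<open>S\<close> to the complement of \<open>S'\<close>; extensionality makes \<open>\<phi>\<close> a function on its domain only.\<close>

type_synonym 'v honest_aut = "'v set \<times> ('v \<Rightarrow> 'v) \<times> 'v set"

definition honest_auts :: "'v rooted_graph \<Rightarrow> 'v honest_aut set" where
  "honest_auts T =
     {(S, \<phi>, S'). complete_subtree T S \<and> complete_subtree T S' \<and>
        \<phi> \<in> extensional (forest_verts T S) \<and> forest_iso T S \<phi> S'}"

definition aaut_equiv :: "'v rooted_graph \<Rightarrow> 'v honest_aut rel" where
  "aaut_equiv T =
     {((S, \<phi>, S'), (R, \<psi>, R')).
        (S, \<phi>, S') \<in> honest_auts T \<and> (R, \<psi>, R') \<in> honest_auts T \<and>
        (\<exists>Q. complete_subtree T Q \<and> S \<union> R \<subseteq> Q \<and> (\<forall>x\<in>forest_verts T Q. \<phi> x = \<psi> x))}"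

text \<open>The product of \<open>A\<close> and \<open>B\<close> is \<open>A\<close> after \<open>B\<close>. All pairs of representatives for which the
  image of the inner one is the domain of the outer one yield the same class, so the union below
  is that class.\<close>

definition AAut :: "'v rooted_graph \<Rightarrow> 'v honest_aut set monoid" where
  "AAut T =
     \<lparr>carrier = honest_auts T // aaut_equiv T,
      monoid.mult = (\<lambda>A B. \<Union> {aaut_equiv T `` {(R, compose (forest_verts T R) \<phi> \<psi>, S')} | R S S' \<phi> \<psi>.
                 (S, \<phi>, S') \<in> A \<and> (R, \<psi>, S) \<in> B}),
      monoid.one = aaut_equiv T `` {({rroot T}, \<lambda>x\<in>forest_verts T {rroot T}. x, {rroot T})}\<rparr>"


section \<open>Plane orders and labellings\<close>

definition plane_order :: "'v rooted_graph \<Rightarrow> ('v \<Rightarrow> 'v rel) \<Rightarrow> bool" where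
  "plane_order T lt \<longleftrightarrow>
     (\<forall>v\<in>rverts T. lt v \<subseteq> children T v \<times> children T v \<and>
        strict_linear_order_on (children T v) (lt v))"

definition increasing_children ::
  "'v rooted_graph \<Rightarrow> ('v \<Rightarrow> 'v rel) \<Rightarrow> 'v \<Rightarrow> 'v list \<Rightarrow> bool" where
  "increasing_children T lt v vs \<longleftrightarrow>
     set vs = children T v \<and> sorted_wrt (\<lambda>a b. (a, b) \<in> lt v) vs"

text \<open>A labelling is a function on all of \<open>'v\<close> whose values at the root and outside the tree are
  never used.\<close>

definition labelling :: "'v rooted_graph \<Rightarrow> 'd set \<Rightarrow> ('v \<Rightarrow> 'd) \<Rightarrow> bool" where
  "labelling T D l \<longleftrightarrow> finite D \<and> l \<in> rverts T - {rroot T} \<rightarrow> D"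

definition label_class :: "'v rooted_graph \<Rightarrow> ('v \<Rightarrow> 'd) \<Rightarrow> 'd \<Rightarrow> 'v set" where
  "label_class T l d = {v \<in> rverts T - {rroot T}. l v = d}"

definition compatible_labelling ::
  "'v rooted_graph \<Rightarrow> ('v \<Rightarrow> 'v rel) \<Rightarrow> ('v \<Rightarrow> 'd) \<Rightarrow> bool" where
  "compatible_labelling T lt l \<longleftrightarrow>
     (\<forall>v\<in>rverts T - {rroot T}. \<forall>w\<in>rverts T - {rroot T}. l v = l w \<longrightarrow>
        (\<exists>vs ws. increasing_children T lt v vs \<and> increasing_children T lt w ws \<and>
           length vs = length ws \<and> (\<forall>i<length vs. l (vs ! i) = l (ws ! i))))"

text \<open>The root carries no label, so the equation of labels is only satisfied where both sides
  are labelled.\<close>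

definition label_preserving ::
  "'v rooted_graph \<Rightarrow> ('v \<Rightarrow> 'v rel) \<Rightarrow> ('v \<Rightarrow> 'd) \<Rightarrow> 'v honest_aut \<Rightarrow> bool" where
  "label_preserving T lt l = (\<lambda>(S, \<phi>, S').
     (\<forall>v\<in>forest_verts T S. \<phi> ` children T v = children T (\<phi> v) \<and>
        (\<forall>a b. (a, b) \<in> lt v \<longrightarrow> (\<phi> a, \<phi> b) \<in> lt (\<phi> v))) \<and>
     (S = {rroot T} \<and> S' = {rroot T} \<or>
      (\<forall>v\<in>leaves T S. v \<noteq> rroot T \<and> \<phi> v \<noteq> rroot T \<and> l v = l (\<phi> v))))"

definition V_label ::
  "'v rooted_graph \<Rightarrow> ('v \<Rightarrow> 'v rel) \<Rightarrow> ('v \<Rightarrow> 'd) \<Rightarrow> 'v honest_aut set set" where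
  "V_label T lt l = {A \<in> carrier (AAut T). \<exists>x\<in>A. label_preserving T lt l x}"


section \<open>Topological groupoids and topological full groups\<close>

record ('o, 'm) top_groupoid =
  objs :: "'o topology"
  mors :: "'m topology"
  src :: "'m \<Rightarrow> 'o"
  rng :: "'m \<Rightarrow> 'o"
  gmult :: "'m \<Rightarrow> 'm \<Rightarrow> 'm"
  ginv :: "'m \<Rightarrow> 'm"

definition clopenin :: "'a topology \<Rightarrow> 'a set \<Rightarrow> bool" where
  "clopenin X U \<longleftrightarrow> openin X U \<and> closedin X U"

definition reduction :: "('o, 'm) top_groupoid \<Rightarrow> 'o set \<Rightarrow> ('o, 'm) top_groupoid" where
  "reduction G Y = G\<lparr>objs := subtopology (objs G) Y,
     mors := subtopology (mors G) {g. src G g \<in> Y \<and> rng G g \<in> Y}\<rparr>"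

definition bisection :: "('o, 'm) top_groupoid \<Rightarrow> 'm set \<Rightarrow> bool" where
  "bisection G U \<longleftrightarrow> clopenin (mors G) U \<and>
     homeomorphic_map (subtopology (mors G) U) (objs G) (src G) \<and>
     homeomorphic_map (subtopology (mors G) U) (objs G) (rng G)"

definition homeo_group :: "'a topology \<Rightarrow> ('a \<Rightarrow> 'a) monoid" where
  "homeo_group X =
     BijGroup (topspace X)\<lparr>carrier := {f \<in> extensional (topspace X). homeomorphic_map X X f}\<rparr>"

definition topological_full_group :: "('o, 'm) top_groupoid \<Rightarrow> ('o \<Rightarrow> 'o) monoid" where
  "topological_full_group G = homeo_group (objs G)
     \<lparr>carrier := {\<lambda>y\<in>topspace (objs G). rng G (inv_into U (src G) y) | U. bisection G U}\<rparr>"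


section \<open>Shift groupoids of oriented graphs\<close>

definition adj_matrix :: "('a, 'e) pre_digraph \<Rightarrow> 'a \<Rightarrow> 'a \<Rightarrow> nat" where
  "adj_matrix g v w = card {e \<in> arcs g. tail g e = v \<and> head g e = w}"

primrec matrix_pow :: "'a set \<Rightarrow> ('a \<Rightarrow> 'a \<Rightarrow> nat) \<Rightarrow> nat \<Rightarrow> 'a \<Rightarrow> 'a \<Rightarrow> nat" where
  "matrix_pow I M 0 = (\<lambda>v w. if v = w then 1 else 0)"
| "matrix_pow I M (Suc n) = (\<lambda>v w. \<Sum>u\<in>I. M v u * matrix_pow I M n u w)"

definition irreducible_matrix :: "'a set \<Rightarrow> ('a \<Rightarrow> 'a \<Rightarrow> nat) \<Rightarrow> bool" where
  "irreducible_matrix I M \<longleftrightarrow> (\<forall>v\<in>I. \<forall>w\<in>I. \<exists>n. matrix_pow I M n v w \<noteq> 0)"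

definition permutation_matrix :: "'a set \<Rightarrow> ('a \<Rightarrow> 'a \<Rightarrow> nat) \<Rightarrow> bool" where
  "permutation_matrix I M \<longleftrightarrow>
     (\<exists>\<pi>. \<pi> permutes I \<and> (\<forall>v\<in>I. \<forall>w\<in>I. M v w = (if w = \<pi> v then 1 else 0)))"

definition diconnected_noncircular :: "('a, 'e) pre_digraph \<Rightarrow> bool" where
  "diconnected_noncircular g \<longleftrightarrow>
     irreducible_matrix (verts g) (adj_matrix g) \<and> \<not> permutation_matrix (verts g) (adj_matrix g)"

definition path_space :: "('a, 'e) pre_digraph \<Rightarrow> (nat \<Rightarrow> 'e) set" where
  "path_space g = {x. \<forall>k. x k \<in> arcs g \<and> head g (x k) = tail g (x (Suc k))}"

definition path_topology :: "('a, 'e) pre_digraph \<Rightarrow> (nat \<Rightarrow> 'e) topology" where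
  "path_topology g =
     subtopology (product_topology (\<lambda>_. discrete_topology (arcs g)) UNIV) (path_space g)"

definition shift :: "(nat \<Rightarrow> 'e) \<Rightarrow> nat \<Rightarrow> 'e" where
  "shift x = (\<lambda>k. x (Suc k))"

definition shift_basic_set ::
  "(nat \<Rightarrow> 'e) set \<Rightarrow> nat \<Rightarrow> nat \<Rightarrow> (nat \<Rightarrow> 'e) set \<Rightarrow>
     ((nat \<Rightarrow> 'e) \<times> int \<times> (nat \<Rightarrow> 'e)) set" where
  "shift_basic_set U n m V =
     {(x, int n - int m, y) | x y. x \<in> U \<and> y \<in> V \<and> (shift ^^ n) x = (shift ^^ m) y}"

text \<open>The morphism space is the \<^const>\<open>topspace\<close> of \<^const>\<open>mors\<close>: the union of the generating
  sets, where \<open>U\<close> and \<open>V\<close> may be the whole path space.\<close>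

definition shift_groupoid ::
  "('a, 'e) pre_digraph \<Rightarrow> (nat \<Rightarrow> 'e, (nat \<Rightarrow> 'e) \<times> int \<times> (nat \<Rightarrow> 'e)) top_groupoid" where
  "shift_groupoid g =
     \<lparr>objs = path_topology g,
      mors = topology_generated_by {shift_basic_set U n m V | U n m V.
               clopenin (path_topology g) U \<and> clopenin (path_topology g) V},
      src = (\<lambda>(x, k, y). y),
      rng = (\<lambda>(x, k, y). x),
      gmult = (\<lambda>(x, k, y) (y', k', z). (x, k + k', z)),
      ginv = (\<lambda>(x, k, y). (y, - k, x))\<rparr>"

end

theory Submission
  imports Defs "HOL-Library.Countable_Set" "HOL-Library.Nat_Bijection"
begin

text \<open>An almost automorphism acts on the boundary of the tree, and since the boundary has no
  isolated points this action determines it: a branching vertex is the place where two rays split.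
  So \<open>AAut T\<close> is the group of bijections of the boundary that are, near every ray, induced by an
  isomorphism between two rooted subtrees, and \<open>V_label T lt l\<close> is the subgroup of those for which
  these isomorphisms respect labels and the order of children. Conversely a bijection of this kind
  is realized by a forest isomorphism because, by Koenig's lemma, finitely many such subtrees
  exhaust the boundary.

  Take the labels as vertices of a graph, with one edge from \<open>d\<close> for each child of a vertex labelled
  \<open>d\<close>. Recording the edges along a ray identifies the rays below a vertex labelled \<open>d\<close> with the
  paths starting at \<open>d\<close>, and label-preserving isomorphisms of subtrees become replacements of
  prefixes, which are the germs of the shift groupoid. The root has no label; its children are sent
  to pairwise incomparable vertices with the same labels below a single labelled vertex, so that
  the whole boundary becomes a clopen set of paths.\<close>

section \<open>Rooted trees\<close>

text \<open>Two features of the definitions shape the proof. A forest isomorphism is undirected: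
  near the roots of the components nothing prevents it from reversing edges, so its effect on a ray
  is defined through tails only, and vertices are compared only where \<open>pres\<close> holds. And
  a product of classes needs representatives for which the image of the inner one is the domain of
  the outer one, so boundary maps must be realized on prescribed complete subtrees.

  The colouring argument of \<open>local_iso\<close> lets one realization theorem serve both groups:
  a constant colouring for all almost automorphisms, \<open>col\<close> for the label-preserving
  ones.

  The spanning hypothesis enters in the form that every label occurs at or below every vertex other
  than the root. This gives irreducibility and, together with branching, the incomparable vertices
  from which the children of the root get their words.

  On the groupoid side, an isolated eventually periodic path admits prefix replacements of several
  degrees, so the way back from a homeomorphism to a bisection must choose the degree in a locally
  constant manner.\<close>

lemma walk_Cons: "walk V E (x # p) \<longleftrightarrow> x \<in> V \<and> (p = [] \<or> {x, hd p} \<in> E \<and> walk V E p)"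
  by (cases p) (auto simp: walk_def)

lemma walk_rev: "walk V E (rev p) \<longleftrightarrow> walk V E p"
  by (auto simp: walk_def insert_commute)

lemma walk_append:
  assumes "walk V E p" "walk V E q" "{last p, hd q} \<in> E"
  shows "walk V E (p @ q)"
  using assms by (auto simp: walk_def successively_append_iff)

lemma walk_mono: "walk V E p \<Longrightarrow> V \<subseteq> V' \<Longrightarrow> E \<subseteq> E' \<Longrightarrow> walk V' E' p"
  by (auto simp: walk_def elim!: successively_mono)

lemma walk_join:
  assumes "walk V E p" "walk V E q" "last p = hd q"
  shows "walk V E (p @ tl q) \<and> hd (p @ tl q) = hd p \<and> last (p @ tl q) = last q"
proof (cases q)
  case Nil
  then show ?thesis using assms by (auto simp: walk_def)
next
  case (Cons a q')
  then show ?thesis using assms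
    by (cases "q' = []") (auto simp: walk_Cons intro!: walk_append, auto simp: walk_def)
qed

text \<open>Loop erasure from the front: if the new first vertex already occurs in the shortened
  tail, everything before that occurrence is dropped.\<close>

lemma walk_distinct:
  assumes "walk V E p"
  shows "\<exists>q. walk V E q \<and> distinct q \<and> hd q = hd p \<and> last q = last p"
  using assms
proof (induction p)
  case Nil
  then show ?case by (simp add: walk_def)
next
  case (Cons x p)
  show ?case
  proof (cases "p = []")
    case True
    then show ?thesis using Cons.prems by (intro exI[of _ "[x]"]) auto
  next
    case False
    with Cons obtain q where q: "walk V E q" "distinct q" "hd q = hd p" "last q = last p"
      by (auto simp: walk_Cons)
    have qne: "q \<noteq> []" using q by (auto simp: walk_def)
    show ?thesis
    proof (cases "x \<in> set q")
      case True
      then obtain a b where ab: "q = a @ x # b" by (auto simp: in_set_conv_decomp)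
      have "walk V E (x # b)" using q(1) ab by (auto simp: walk_def successively_append_iff)
      then show ?thesis using ab q False by (intro exI[of _ "x # b"]) auto
    next
      case False
      then show ?thesis using q Cons.prems \<open>p \<noteq> []\<close> qne
        by (intro exI[of _ "x # q"]) (auto simp: walk_Cons)
    qed
  qed
qed

locale tree_rooted =
  fixes T :: "'v rooted_graph"
  assumes rooted: "rooted_tree T"
begin

abbreviation "V \<equiv> rverts T"
abbreviation "E \<equiv> redges T"
abbreviation "rt \<equiv> rroot T"
abbreviation "lev v \<equiv> gdist T rt v"
abbreviation "ch \<equiv> children T"
abbreviation "desc \<equiv> subtree_at T"
abbreviation "bd \<equiv> boundary T"

lemma root_in: "rt \<in> V"
  using rooted by (simp add: rooted_tree_def)

lemma edge_form: "e \<in> E \<Longrightarrow> \<exists>u\<in>V. \<exists>v\<in>V. u \<noteq> v \<and> e = {u, v}"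
  using rooted by (simp add: rooted_tree_def is_tree_def)

lemma acyclic: "\<not> simple_cycle V E c"
  using rooted by (simp add: rooted_tree_def is_tree_def)

lemma edge_ends: "{u, v} \<in> E \<Longrightarrow> u \<in> V \<and> v \<in> V \<and> u \<noteq> v"
  using edge_form by (metis doubleton_eq_iff)

lemma walk_ex: "u \<in> V \<Longrightarrow> v \<in> V \<Longrightarrow> \<exists>p. walk V E p \<and> hd p = u \<and> last p = v"
  using rooted unfolding rooted_tree_def is_tree_def by blast

lemma gdist_le:
  assumes "walk V E p" "hd p = u" "last p = v"
  shows "gdist T u v \<le> length p - 1"
  unfolding gdist_def
proof (rule Least_le)
  show "\<exists>q. walk V E q \<and> hd q = u \<and> last q = v \<and> length q = Suc (length p - 1)"
    using assms by (intro exI[of _ p]) (auto simp: walk_def Suc_diff_Suc)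
qed

lemma gdist_walk:
  assumes "u \<in> V" "v \<in> V"
  shows "\<exists>p. walk V E p \<and> hd p = u \<and> last p = v \<and> length p = Suc (gdist T u v)"
proof -
  obtain p where p: "walk V E p" "hd p = u" "last p = v" using walk_ex[OF assms] by blast
  then have "length p = Suc (length p - 1)" by (auto simp: walk_def Suc_diff_Suc)
  with p have "\<exists>n. \<exists>p. walk V E p \<and> hd p = u \<and> last p = v \<and> length p = Suc n" by blast
  from LeastI_ex[OF this] show ?thesis unfolding gdist_def .
qed

lemma lev_root: "lev rt = 0"
  using gdist_le[of "[rt]" rt rt] root_in by (simp add: walk_def)

lemma lev_0_iff: "v \<in> V \<Longrightarrow> lev v = 0 \<longleftrightarrow> v = rt"
  using gdist_walk[OF root_in, of v] lev_root by (auto simp: length_Suc_conv)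

lemma lev_edge:
  assumes "{u, v} \<in> E" shows "lev v \<le> Suc (lev u)"
proof -
  have uv: "u \<in> V" "v \<in> V" using edge_ends[OF assms] by auto
  obtain p where p: "walk V E p" "hd p = rt" "last p = u" "length p = Suc (lev u)"
    using gdist_walk[OF root_in uv(1)] by blast
  have "walk V E (p @ [v])"
    using p uv assms by (intro walk_append) (auto simp: walk_def)
  moreover have "hd (p @ [v]) = rt" using p by (auto simp: walk_def)
  ultimately show ?thesis using gdist_le[of "p @ [v]" rt v] p by simp
qed

lemma ch_iff: "w \<in> ch v \<longleftrightarrow> {v, w} \<in> E \<and> lev v < lev w"
  by (auto simp: children_def)

lemma ch_D:
  assumes "w \<in> ch v" shows "v \<in> V" "w \<in> V" "lev w = Suc (lev v)" "{v, w} \<in> E" "w \<noteq> rt"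
proof -
  show e: "{v, w} \<in> E" using assms by (simp add: ch_iff)
  show "v \<in> V" "w \<in> V" using edge_ends[OF e] by auto
  show l: "lev w = Suc (lev v)" using assms lev_edge[OF e] by (simp add: ch_iff)
  show "w \<noteq> rt" using l lev_root by auto
qed

lemma parent_ex:
  assumes "v \<in> V" "v \<noteq> rt" shows "\<exists>u. v \<in> ch u"
proof -
  obtain p where p: "walk V E p" "hd p = rt" "last p = v" "length p = Suc (lev v)"
    using gdist_walk[OF root_in assms(1)] by blast
  have pne: "p \<noteq> []" using p by (auto simp: walk_def)
  define q where "q = butlast p"
  have pq: "p = q @ [v]" using p pne by (auto simp: q_def)
  have qne: "q \<noteq> []" using p pq assms by auto
  have w: "walk V E q" "{last q, v} \<in> E"
    using p(1) qne unfolding pq by (auto simp: walk_def successively_append_iff)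
  have "lev (last q) \<le> length q - 1" using gdist_le[OF w(1) _ refl] p pq qne by auto
  then have "lev (last q) < lev v" using p(4) pq qne by (cases q) auto
  then show ?thesis using w by (auto simp: ch_iff)
qed

text \<open>Climbing to parents strictly lowers the level, so after \<open>u\<close> itself, which
  differs from \<open>w\<close> by assumption, all vertices met have level below
  \<open>lev w\<close>.\<close>

lemma walk_to_root:
  assumes "w \<in> V"
  shows "u \<in> V \<Longrightarrow> u \<noteq> w \<Longrightarrow> lev u \<le> lev w \<Longrightarrow>
    \<exists>p. walk (V - {w}) E p \<and> hd p = u \<and> last p = rt"
proof (induction "lev u" arbitrary: u rule: less_induct)
  case less
  show ?case
  proof (cases "u = rt")
    case True
    then show ?thesis using less.prems by (intro exI[of _ "[u]"]) (auto simp: walk_def)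
  next
    case False
    then obtain t where t: "u \<in> ch t" using parent_ex less.prems by blast
    note tD = ch_D[OF t]
    then obtain p where p: "walk (V - {w}) E p" "hd p = t" "last p = rt"
      using less.hyps[of t] less.prems by fastforce
    then show ?thesis using less.prems tD
      by (intro exI[of _ "u # p"]) (auto simp: walk_Cons insert_commute, auto simp: walk_def)
  qed
qed

text \<open>Two such neighbours would close a cycle through the root that avoids \<open>w\<close> except at its
  base point.\<close>

lemma lower_neighbour_unique:
  assumes "{u, w} \<in> E" "{u', w} \<in> E" "lev u \<le> lev w" "lev u' \<le> lev w"
  shows "u = u'"
proof (rule ccontr)
  assume ne: "u \<noteq> u'"
  have V: "u \<in> V" "u' \<in> V" "w \<in> V" "u \<noteq> w" "u' \<noteq> w" using edge_ends assms by blast+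
  obtain p where p: "walk (V - {w}) E p" "hd p = u" "last p = rt"
    using walk_to_root V assms by blast
  obtain p' where p': "walk (V - {w}) E p'" "hd p' = u'" "last p' = rt"
    using walk_to_root V assms by blast
  have ne': "p \<noteq> []" "p' \<noteq> []" using p p' by (auto simp: walk_def)
  have "walk (V - {w}) E (p @ tl (rev p')) \<and> hd (p @ tl (rev p')) = hd p \<and>
      last (p @ tl (rev p')) = last (rev p')"
    using p p' ne' by (intro walk_join) (auto simp: walk_rev hd_rev)
  then obtain q where q: "walk (V - {w}) E q" "distinct q" "hd q = u" "last q = u'"
    using walk_distinct[of "V - {w}" E "p @ tl (rev p')"] p p' by (auto simp: last_rev)
  have qne: "q \<noteq> []" using q by (auto simp: walk_def)
  have len: "2 \<le> length q" using q ne qne by (cases q; cases "tl q") auto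
  have "w \<notin> set q" using q by (auto simp: walk_def)
  then have "simple_cycle V E (w # q)"
    using q qne len assms V walk_mono[OF q(1), of V E]
    by (auto simp: simple_cycle_def walk_Cons insert_commute)
  then show False using acyclic by simp
qed

lemma parent_unique: "w \<in> ch u \<Longrightarrow> w \<in> ch u' \<Longrightarrow> u = u'"
  by (rule lower_neighbour_unique[of u w]) (auto simp: ch_iff)

text \<open>An edge between equal levels would give its end \<open>w\<close> two neighbours of no
  greater level, the other end and the parent of \<open>w\<close>.\<close>

lemma edge_iff: "{u, w} \<in> E \<longleftrightarrow> w \<in> ch u \<or> u \<in> ch w"
proof
  assume e: "{u, w} \<in> E"
  show "w \<in> ch u \<or> u \<in> ch w"
  proof (rule ccontr)
    assume "\<not> ?thesis"
    then have eq: "lev u = lev w" using e by (auto simp: ch_iff insert_commute)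
    have V: "u \<in> V" "w \<in> V" "u \<noteq> w" using edge_ends e by blast+
    then have "w \<noteq> rt" using eq lev_0_iff by metis
    then obtain t where t: "w \<in> ch t" using parent_ex V by blast
    have "t = u" using lower_neighbour_unique[of t w u] ch_D[OF t] e eq by auto
    then show False using ch_D[OF t] eq by auto
  qed
qed (auto simp: ch_iff insert_commute)

section \<open>Descendants and their order\<close>

definition childrel :: "('v \<times> 'v) set" where
  "childrel = {(x, y). y \<in> ch x}"

lemma rtrancl_childrel_V: "(v, x) \<in> childrel\<^sup>* \<Longrightarrow> v \<in> V \<Longrightarrow> x \<in> V"
  by (induction rule: rtrancl_induct) (auto simp: childrel_def ch_D)

lemma walk_lev_le:
  assumes "walk V E p"
  shows "i < length p \<Longrightarrow> lev (p ! i) \<le> lev (hd p) + i"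
proof (induction i)
  case 0
  then show ?case by (cases p) auto
next
  case (Suc i)
  then have "{p ! i, p ! Suc i} \<in> E" using assms by (auto simp: walk_def successively_conv_nth)
  then show ?case using lev_edge Suc by fastforce
qed

text \<open>Induction from the far end: the last vertex has level \<open>length p - 1\<close>, and a
  level below the index earlier on could not be made up, since an edge raises the level by at most
  one.\<close>

lemma root_geodesic_nth:
  assumes "geodesic T p" "hd p = rt"
  shows "i < length p \<Longrightarrow> lev (p ! i) = i"
proof (induction "length p - i" arbitrary: i rule: less_induct)
  case less
  have w: "walk V E p" and pne: "p \<noteq> []" and len: "length p = Suc (lev (last p))"
    using assms by (auto simp: geodesic_def walk_def)
  have le: "lev (p ! i) \<le> i" using walk_lev_le[OF w less.prems] assms lev_root by simp
  show ?case
  proof (cases "Suc i = length p")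
    case True
    then show ?thesis using len pne by (metis last_conv_nth diff_Suc_1 nat.inject)
  next
    case False
    then have "lev (p ! Suc i) = Suc i" using less by simp
    moreover have "{p ! i, p ! Suc i} \<in> E"
      using w False less.prems by (auto simp: walk_def successively_conv_nth)
    ultimately show ?thesis using le lev_edge by fastforce
  qed
qed

text \<open>Replaces geodesics by closure under children, which admits induction. On a geodesic from
  the root the level equals the index, so every step goes to a child; conversely a geodesic from the
  root extended by a child stays geodesic.\<close>

lemma desc_iff: "x \<in> desc v \<longleftrightarrow> v \<in> V \<and> (v, x) \<in> childrel\<^sup>*"
proof
  assume "x \<in> desc v"
  then obtain p where p: "geodesic T p" "hd p = rt" "last p = x" "v \<in> set p"
    by (auto simp: subtree_at_def)
  have w: "walk V E p" using p by (auto simp: geodesic_def)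
  obtain i where i: "i < length p" "p ! i = v" using p(4) by (auto simp: in_set_conv_nth)
  have step: "p ! Suc j \<in> ch (p ! j)" if "Suc j < length p" for j
    using w that root_geodesic_nth[OF p(1,2), of j] root_geodesic_nth[OF p(1,2), of "Suc j"]
    by (auto simp: ch_iff walk_def successively_conv_nth)
  have "(v, p ! (i + k)) \<in> childrel\<^sup>*" if "i + k < length p" for k
    using that
  proof (induction k)
    case 0
    then show ?case using i by simp
  next
    case (Suc k)
    then show ?case using step[of "i + k"]
      by (auto intro: rtrancl_into_rtrancl simp: childrel_def)
  qed
  from this[of "length p - 1 - i"] i have "(v, p ! (length p - 1)) \<in> childrel\<^sup>*"
    by simp
  moreover have "p ! (length p - 1) = x" using i p(3) by (cases "p = []") (simp_all add: last_conv_nth)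
  ultimately have "(v, x) \<in> childrel\<^sup>*" by simp
  moreover have "v \<in> V" using w p(4) by (auto simp: walk_def)
  ultimately show "v \<in> V \<and> (v, x) \<in> childrel\<^sup>*" by simp
next
  assume v: "v \<in> V \<and> (v, x) \<in> childrel\<^sup>*"
  then have "(v, x) \<in> childrel\<^sup>*" by simp
  then show "x \<in> desc v"
  proof (induction rule: rtrancl_induct)
    case base
    obtain p where p: "walk V E p" "hd p = rt" "last p = v" "length p = Suc (lev v)"
      using gdist_walk[OF root_in, of v] v by blast
    then show ?case by (auto simp: subtree_at_def geodesic_def walk_def intro!: exI[of _ p])
  next
    case (step y z)
    then obtain p where p: "geodesic T p" "hd p = rt" "last p = y" "v \<in> set p"
      by (auto simp: subtree_at_def)
    have z: "z \<in> ch y" using step by (simp add: childrel_def)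
    note zD = ch_D[OF z]
    have pne: "p \<noteq> []" using p by (auto simp: geodesic_def walk_def)
    have "walk V E (p @ [z])"
      using p zD by (intro walk_append) (auto simp: geodesic_def walk_def)
    then have "geodesic T (p @ [z])" using p zD pne by (auto simp: geodesic_def)
    then show ?case using p pne by (auto simp: subtree_at_def intro!: exI[of _ "p @ [z]"])
  qed
qed

lemma desc_V: "x \<in> desc v \<Longrightarrow> x \<in> V" "x \<in> desc v \<Longrightarrow> v \<in> V"
  by (auto simp: desc_iff rtrancl_childrel_V)

lemma desc_refl: "v \<in> V \<Longrightarrow> v \<in> desc v"
  by (simp add: desc_iff)

lemma desc_child: "x \<in> desc v \<Longrightarrow> y \<in> ch x \<Longrightarrow> y \<in> desc v"
  by (auto simp: desc_iff childrel_def intro: rtrancl_into_rtrancl)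

lemma desc_trans: "x \<in> desc v \<Longrightarrow> y \<in> desc x \<Longrightarrow> y \<in> desc v"
  by (auto simp: desc_iff)

lemma desc_induct [consumes 1, case_names base step]:
  assumes "x \<in> desc v" "P v" "\<And>y z. y \<in> desc v \<Longrightarrow> P y \<Longrightarrow> z \<in> ch y \<Longrightarrow> P z"
  shows "P x"
proof -
  have "(v, x) \<in> childrel\<^sup>*" "v \<in> V" using assms(1) by (auto simp: desc_iff)
  then show ?thesis
  proof (induction rule: rtrancl_induct)
    case (step y z)
    then show ?case using assms(3)[of y z] by (simp add: desc_iff childrel_def)
  qed (use assms in auto)
qed

lemma desc_cases:
  assumes "x \<in> desc v"
  obtains "x = v" | p where "x \<in> ch p" "p \<in> desc v"
  using assms by (auto simp: desc_iff childrel_def elim: rtranclE)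

lemma desc_parent: "x \<in> desc v \<Longrightarrow> x \<noteq> v \<Longrightarrow> x \<in> ch p \<Longrightarrow> p \<in> desc v"
  by (metis desc_cases parent_unique)

lemma desc_lev: "x \<in> desc v \<Longrightarrow> x = v \<or> lev v < lev x"
  by (induction rule: desc_induct) (auto dest: ch_D)

text \<open>Parents are unique, so the converse of \<open>childrel\<close> is single-valued and the
  ancestors of \<open>x\<close> form a chain.\<close>

lemma desc_comparable:
  assumes "x \<in> desc v" "x \<in> desc w" shows "v \<in> desc w \<or> w \<in> desc v"
proof -
  have "single_valued (childrel\<inverse>)"
    by (auto simp: single_valued_def childrel_def parent_unique)
  moreover have "(x, v) \<in> (childrel\<inverse>)\<^sup>*" "(x, w) \<in> (childrel\<inverse>)\<^sup>*"
    using assms by (auto simp: desc_iff rtrancl_converse)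
  ultimately have "(v, w) \<in> (childrel\<inverse>)\<^sup>* \<or> (w, v) \<in> (childrel\<inverse>)\<^sup>*"
    by (rule single_valued_confluent)
  then show ?thesis using assms by (auto simp: desc_iff rtrancl_converse)
qed

lemma desc_root: "v \<in> V \<Longrightarrow> v \<in> desc rt"
proof (induction "lev v" arbitrary: v rule: less_induct)
  case less
  show ?case
  proof (cases "v = rt")
    case True
    then show ?thesis using root_in desc_refl by simp
  next
    case False
    then obtain u where u: "v \<in> ch u" using parent_ex less by blast
    then show ?thesis using less.hyps[of u] ch_D[OF u] desc_child by simp
  qed
qed

section \<open>Complete subtrees and the forests they leave\<close>

lemma parent_closed_subtree:
  assumes "S \<subseteq> V" "rt \<in> S" "\<And>p v. v \<in> S \<Longrightarrow> v \<in> ch p \<Longrightarrow> p \<in> S"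
  shows "subtree T S"
proof -
  define F where "F = {e \<in> E. e \<subseteq> S}"
  have to_root: "\<exists>p. walk S F p \<and> hd p = v \<and> last p = rt" if "v \<in> S" for v
    using that
  proof (induction "lev v" arbitrary: v rule: less_induct)
    case less
    show ?case
    proof (cases "v = rt")
      case True
      then show ?thesis using assms(2) by (intro exI[of _ "[v]"]) (simp add: walk_def)
    next
      case False
      then obtain u where u: "v \<in> ch u" using parent_ex[of v] less.prems assms(1) by auto
      have uS: "u \<in> S" using assms(3)[OF less.prems u] .
      then obtain p where p: "walk S F p" "hd p = u" "last p = rt"
        using less.hyps[of u] ch_D(3)[OF u] by auto
      have "{v, u} \<in> F" using ch_D(4)[OF u] uS less.prems by (simp add: F_def insert_commute)
      moreover have "p \<noteq> []" using p(1) by (simp add: walk_def)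
      ultimately show ?thesis using p less.prems
        by (intro exI[of _ "v # p"]) (simp add: walk_Cons)
    qed
  qed
  have "\<exists>p. walk S F p \<and> hd p = u \<and> last p = v" if uv: "u \<in> S" "v \<in> S" for u v
  proof -
    obtain p where p: "walk S F p" "hd p = u" "last p = rt" using to_root[OF uv(1)] by auto
    obtain q where q: "walk S F q" "hd q = v" "last q = rt" using to_root[OF uv(2)] by auto
    have "q \<noteq> []" using q(1) by (simp add: walk_def)
    then have q': "walk S F (rev q)" "hd (rev q) = rt" "last (rev q) = v"
      using q by (simp_all add: walk_rev hd_rev last_rev)
    show ?thesis using walk_join[OF p(1) q'(1)] p q' by (intro exI[of _ "p @ tl (rev q)"]) simp
  qed
  moreover have "\<nexists>c. simple_cycle S F c"
  proof
    assume "\<exists>c. simple_cycle S F c"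
    then obtain c where c: "simple_cycle S F c" by blast
    have "walk V E c" using c assms(1) walk_mono[of S F c V E] by (auto simp: simple_cycle_def F_def)
    then have "simple_cycle V E c"
      using c by (simp add: simple_cycle_def F_def)
    then show False using acyclic by simp
  qed
  moreover have "\<exists>u\<in>S. \<exists>v\<in>S. u \<noteq> v \<and> e = {u, v}" if e: "e \<in> F" for e
  proof -
    have "e \<in> E" "e \<subseteq> S" using e by (auto simp: F_def)
    moreover from edge_form[OF this(1)] obtain u v where uv: "e = {u, v}" "u \<noteq> v" by blast
    ultimately have "u \<in> S" "v \<in> S" by simp_all
    with uv show ?thesis by blast
  qed
  moreover have "S \<noteq> {}" using assms(2) by auto
  ultimately show ?thesis unfolding subtree_def is_tree_def F_def[symmetric]
    using assms(1) by simp
qed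

text \<open>The only edge leaving \<open>desc v\<close> joins \<open>v\<close> to its parent
  \<open>p\<close>. Without \<open>p\<close>, a path in \<open>S\<close> from \<open>v\<close> is
  trapped below \<open>v\<close> and cannot reach the root.\<close>

lemma subtree_parent_closed:
  assumes "subtree T S" "rt \<in> S" "v \<in> S" "v \<in> ch p"
  shows "p \<in> S"
proof (rule ccontr)
  assume np: "p \<notin> S"
  obtain q where q: "walk S {e \<in> E. e \<subseteq> S} q" "hd q = v" "last q = rt"
    using assms(1,2,3) unfolding subtree_def is_tree_def by blast
  have vV: "v \<in> V" using ch_D[OF assms(4)] by simp
  have "q ! i \<in> desc v" if "i < length q" for i
    using that
  proof (induction i)
    case 0
    then show ?case using q desc_refl[OF vV] by (cases q) auto
  next
    case (Suc i)
    have e: "{q ! i, q ! Suc i} \<in> E" "q ! Suc i \<in> S"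
      using q(1) Suc.prems by (auto simp: walk_def successively_conv_nth)
    have "q ! Suc i \<noteq> p" using np e(2) by auto
    have IH: "q ! i \<in> desc v" using Suc by simp
    show ?case
    proof (cases "q ! Suc i \<in> ch (q ! i)")
      case True
      then show ?thesis using desc_child IH by simp
    next
      case False
      then have c: "q ! i \<in> ch (q ! Suc i)" using e(1) by (simp add: edge_iff)
      then have "q ! i \<noteq> v" using parent_unique[OF c] assms(4) \<open>q ! Suc i \<noteq> p\<close> by blast
      then show ?thesis using desc_parent[OF IH _ c] by simp
    qed
  qed
  from this[of "length q - 1"] q have "rt \<in> desc v"
    by (auto simp: walk_def last_conv_nth)
  then show False using desc_lev[of rt v] lev_root ch_D[OF assms(4)] by auto
qed

text \<open>Connectedness becomes closure under parents, and the condition on leaves becomes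
  all-or-nothing for children; in this local form it can be checked for \<open>cut\<close>.\<close>

lemma complete_subtree_iff:
  "complete_subtree T S \<longleftrightarrow> finite S \<and> S \<subseteq> V \<and> rt \<in> S \<and>
     (\<forall>v\<in>S. \<forall>p. v \<in> ch p \<longrightarrow> p \<in> S) \<and> (\<forall>v\<in>S. ch v \<subseteq> S \<or> ch v \<inter> S = {})"
proof -
  have "(\<forall>v\<in>S - leaves T S. ch v \<subseteq> S) \<longleftrightarrow> (\<forall>v\<in>S. ch v \<subseteq> S \<or> ch v \<inter> S = {})"
    by (auto simp: leaves_def)
  moreover have "subtree T S \<longleftrightarrow> S \<subseteq> V \<and> (\<forall>v\<in>S. \<forall>p. v \<in> ch p \<longrightarrow> p \<in> S)" if rt: "rt \<in> S"
  proof
    assume st: "subtree T S"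
    then show "S \<subseteq> V \<and> (\<forall>v\<in>S. \<forall>p. v \<in> ch p \<longrightarrow> p \<in> S)"
      using subtree_parent_closed[OF st rt] by (simp add: subtree_def)
  qed (use parent_closed_subtree[OF _ rt] in simp)
  ultimately show ?thesis unfolding complete_subtree_def by auto
qed

lemma leaf_D: "v \<in> leaves T S \<Longrightarrow> v \<in> S" by (simp add: leaves_def)

text \<open>From a vertex outside \<open>S\<close>, climbing must enter \<open>S\<close>, which
  contains the root; the vertex of entry has a child outside \<open>S\<close>, so completeness makes
  it a leaf.\<close>

lemma forest_iff:
  assumes "complete_subtree T S"
  shows "x \<in> forest_verts T S \<longleftrightarrow> x \<in> V \<and> (x \<notin> S \<or> x \<in> leaves T S)"
proof
  assume "x \<in> forest_verts T S"
  then obtain v where v: "v \<in> leaves T S" "x \<in> desc v" by (auto simp: forest_verts_def)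
  from v(2) have "x \<notin> S \<or> x \<in> leaves T S"
  proof (induction rule: desc_induct)
    case (step y z)
    then show ?case using assms by (auto simp: complete_subtree_iff leaves_def)
  qed (use v in simp)
  then show "x \<in> V \<and> (x \<notin> S \<or> x \<in> leaves T S)" using desc_V v by blast
next
  assume "x \<in> V \<and> (x \<notin> S \<or> x \<in> leaves T S)"
  then show "x \<in> forest_verts T S"
  proof (induction "lev x" arbitrary: x rule: less_induct)
    case less
    show ?case
    proof (cases "x \<in> leaves T S")
      case True
      then show ?thesis using less desc_refl by (auto simp: forest_verts_def)
    next
      case False
      then have x: "x \<notin> S" "x \<in> V" using less by auto
      then have "x \<noteq> rt" using assms by (auto simp: complete_subtree_iff)
      then obtain p where p: "x \<in> ch p" using parent_ex x by blast
      have "p \<notin> S \<or> p \<in> leaves T S"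
        using assms p x by (auto simp: complete_subtree_iff leaves_def)
      then have "p \<in> forest_verts T S" using less.hyps[of p] ch_D[OF p] by auto
      then show ?thesis using desc_child p by (auto simp: forest_verts_def)
    qed
  qed
qed

lemma forest_V: "x \<in> forest_verts T S \<Longrightarrow> x \<in> V"
  by (auto simp: forest_verts_def desc_V)

lemma forest_child:
  assumes "x \<in> forest_verts T S" "y \<in> ch x"
  shows "y \<in> forest_verts T S"
  using assms desc_child by (auto simp: forest_verts_def)

lemma forest_desc: "x \<in> forest_verts T S \<Longrightarrow> y \<in> desc x \<Longrightarrow> y \<in> forest_verts T S"
  using desc_trans by (auto simp: forest_verts_def)

lemma forest_child_notin:
  assumes "complete_subtree T S" "x \<in> forest_verts T S" "y \<in> ch x"
  shows "y \<notin> S"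
  using assms by (auto simp: forest_iff complete_subtree_iff leaves_def)

lemma forest_parent:
  assumes "complete_subtree T S" "x \<in> forest_verts T S" "x \<notin> S" "x \<in> ch p"
  shows "p \<in> forest_verts T S"
  using assms ch_D[OF assms(4)] by (auto simp: forest_iff complete_subtree_iff leaves_def)

lemma forest_edges_iff:
  assumes "complete_subtree T S" "x \<in> forest_verts T S" "y \<in> forest_verts T S"
  shows "{x, y} \<in> forest_edges T S \<longleftrightarrow> {x, y} \<in> E"
proof
  assume e: "{x, y} \<in> E"
  obtain v w where v: "v \<in> leaves T S" "x \<in> desc v" "w \<in> leaves T S" "y \<in> desc w"
    using assms by (auto simp: forest_verts_def)
  then show "{x, y} \<in> forest_edges T S"
    using e desc_child[OF v(2)] desc_child[OF v(4)] unfolding forest_edges_def edge_iff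
    by (auto simp: edge_iff)
qed (auto simp: forest_edges_def)

text \<open>Two vertices above a common \<open>x\<close> are comparable, and properly below a leaf
  there is no further vertex of \<open>S\<close>.\<close>

lemma leaf_unique:
  assumes "complete_subtree T S" "v \<in> leaves T S" "w \<in> leaves T S" "x \<in> desc v" "x \<in> desc w"
  shows "v = w"
proof -
  have *: "a = b" if "a \<in> leaves T S" "b \<in> leaves T S" "b \<in> desc a" for a b
    using that(3)
  proof (cases rule: desc_cases)
    case (2 p)
    have "p \<in> forest_verts T S" using that 2 by (auto simp: forest_verts_def)
    then show ?thesis using forest_child_notin[OF assms(1) _ 2(1)] that leaf_D by blast
  qed simp
  show ?thesis using desc_comparable[OF assms(4,5)] *[of v w] *[of w v] assms by blast
qed

end

section \<open>Rays and complete subtrees\<close>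

locale leafless_tree = tree_rooted +
  assumes loc_finite: "locally_finite T"
    and leafless: "leaves T (rverts T) = {}"
begin

abbreviation "thr \<equiv> boundary_at T"

lemma ch_nonempty: "v \<in> V \<Longrightarrow> \<exists>w. w \<in> ch v"
  using leafless ch_D(2) by (fastforce simp: leaves_def)

lemma finite_ch: "finite (ch v)"
proof (cases "v \<in> V")
  case True
  then show ?thesis using loc_finite
    by (auto simp: locally_finite_def children_def intro: finite_subset[rotated])
next
  case False
  then have "ch v = {}" using ch_D(1) by blast
  then show ?thesis by simp
qed

text \<open>For the converse, levels along such a sequence equal the indices, and a walk raises the
  level by at most one per step, so no walk from \<open>r m\<close> to \<open>r n\<close> takes
  fewer than \<open>n - m\<close> steps.\<close>

lemma bd_iff: "r \<in> bd \<longleftrightarrow> r 0 = rt \<and> (\<forall>n. r (Suc n) \<in> ch (r n))"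
proof
  assume r: "r \<in> bd"
  have g: "geodesic T (map r [0..<Suc n])" for n using r by (simp add: boundary_def)
  have l: "lev (r n) = n" for n
  proof -
    have "hd (map r [0..<Suc n]) = rt" using r by (simp add: boundary_def upt_conv_Cons del: upt_Suc)
    from root_geodesic_nth[OF g this, of n] show ?thesis by (simp del: upt_Suc)
  qed
  have "{r n, r (Suc n)} \<in> E" for n
  proof -
    have "walk V E (map r [0..<Suc (Suc n)])" using g[of "Suc n"] by (simp add: geodesic_def del: upt_Suc)
    then show ?thesis by (force simp: walk_def successively_conv_nth simp del: upt_Suc)
  qed
  then show "r 0 = rt \<and> (\<forall>n. r (Suc n) \<in> ch (r n))"
    using r l by (auto simp: boundary_def ch_iff)
next
  assume r: "r 0 = rt \<and> (\<forall>n. r (Suc n) \<in> ch (r n))"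
  have l: "lev (r n) = n" for n
  proof (induction n)
    case (Suc n)
    then show ?case using ch_D(3)[of "r (Suc n)" "r n"] r by simp
  qed (simp add: r lev_root)
  have V: "r n \<in> V" for n using r ch_D(1) by blast
  have "geodesic T (map r [m..<Suc n])" if mn: "m \<le> n" for m n
  proof -
    have w: "walk V E (map r [m..<Suc n])"
      using mn r V ch_D(4) by (auto simp: walk_def successively_conv_nth simp del: upt_Suc)
    have hl: "hd (map r [m..<Suc n]) = r m" "last (map r [m..<Suc n]) = r n"
      using mn by (auto simp: last_map hd_map simp del: upt_Suc)
    obtain q where q: "walk V E q" "hd q = r m" "last q = r n" "length q = Suc (gdist T (r m) (r n))"
      using gdist_walk V by blast
    have "n \<le> m + gdist T (r m) (r n)"
      using walk_lev_le[OF q(1), of "length q - 1"] q l by (auto simp: last_conv_nth walk_def)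
    moreover have "gdist T (r m) (r n) \<le> n - m" using gdist_le[OF w hl] mn by simp
    ultimately show ?thesis using w hl mn by (simp add: geodesic_def Suc_diff_le del: upt_Suc)
  qed
  then show "r \<in> bd" using r by (simp add: boundary_def)
qed

lemma bd_0: "r \<in> bd \<Longrightarrow> r 0 = rt" by (simp add: bd_iff)

lemma bd_Suc: "r \<in> bd \<Longrightarrow> r (Suc n) \<in> ch (r n)" by (simp add: bd_iff)

lemma bd_V: "r \<in> bd \<Longrightarrow> r n \<in> V" using bd_Suc ch_D(1) by blast

lemma bd_lev: "r \<in> bd \<Longrightarrow> lev (r n) = n"
proof (induction n)
  case (Suc n)
  then show ?case using ch_D(3)[OF bd_Suc[OF Suc.prems, of n]] by simp
qed (simp add: bd_0 lev_root)

lemma bd_desc: "r \<in> bd \<Longrightarrow> r (n + k) \<in> desc (r n)"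
  by (induction k) (auto simp: desc_refl bd_V intro: desc_child bd_Suc)

lemma bd_desc_le: "r \<in> bd \<Longrightarrow> n \<le> m \<Longrightarrow> r m \<in> desc (r n)"
  using bd_desc[of r n "m - n"] by simp

lemma bd_agree_le: "r \<in> bd \<Longrightarrow> s \<in> bd \<Longrightarrow> r n = s n \<Longrightarrow> m \<le> n \<Longrightarrow> r m = s m"
proof (induction n)
  case (Suc n)
  have "r n = s n" using bd_Suc Suc.prems parent_unique by metis
  then show ?case using Suc by (cases "m = Suc n") auto
qed simp

lemma thr_iff: "r \<in> thr v \<longleftrightarrow> r \<in> bd \<and> r (lev v) = v"
proof
  assume "r \<in> thr v"
  then obtain n where "r \<in> bd" "v = r n" by (auto simp: boundary_at_def)
  then show "r \<in> bd \<and> r (lev v) = v" by (simp add: bd_lev)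
next
  assume "r \<in> bd \<and> r (lev v) = v"
  then show "r \<in> thr v" by (auto simp: boundary_at_def intro: range_eqI[of _ _ "lev v"])
qed

lemma thr_V: "r \<in> thr v \<Longrightarrow> v \<in> V"
  using bd_V[of r "lev v"] by (simp add: thr_iff)

lemma thr_self: "r \<in> bd \<Longrightarrow> r \<in> thr (r n)" by (simp add: thr_iff bd_lev)

lemma thr_desc: "r \<in> thr v \<Longrightarrow> r (lev v + k) \<in> desc v"
  using bd_desc[of r "lev v" k] by (simp add: thr_iff)

lemma bd_through_desc: "r \<in> bd \<Longrightarrow> r n \<in> desc v \<Longrightarrow> r \<in> thr v"
proof (induction n)
  case 0
  then show ?case using desc_lev[of rt v] bd_0 lev_root by (auto simp: thr_iff)
next
  case (Suc n)
  show ?case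
  proof (cases "r (Suc n) = v")
    case True
    then show ?thesis using thr_self[OF Suc.prems(1), of "Suc n"] by simp
  next
    case False
    then show ?thesis using desc_parent[OF Suc.prems(2) False bd_Suc[OF Suc.prems(1)]] Suc by simp
  qed
qed

lemma thr_mono: "x \<in> desc v \<Longrightarrow> thr x \<subseteq> thr v"
  using bd_through_desc by (metis subsetI thr_iff)

text \<open>A descending sequence from \<open>x\<close> is prolonged upwards by parents until it
  starts at the root, by induction on the level of \<open>x\<close>.\<close>

lemma bd_extend:
  assumes "x \<in> V" "c 0 = x" "\<And>k. c (Suc k) \<in> ch (c k)"
  shows "\<exists>r\<in>bd. \<forall>k. r (lev x + k) = c k"
  using assms
proof (induction "lev x" arbitrary: x c)
  case 0
  then have "x = rt" using lev_0_iff by metis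
  then show ?case using 0 by (intro bexI[of _ c]) (auto simp: bd_iff lev_root)
next
  case (Suc n)
  then have "x \<noteq> rt" using lev_root by auto
  then obtain p where p: "x \<in> ch p" using parent_ex Suc by blast
  define d where "d = (\<lambda>k. case k of 0 \<Rightarrow> p | Suc k \<Rightarrow> c k)"
  have "d (Suc k) \<in> ch (d k)" for k using Suc.prems p by (auto simp: d_def split: nat.splits)
  moreover have "lev p = n" "p \<in> V" using ch_D[OF p] Suc by auto
  ultimately obtain r where r: "r \<in> bd" "\<forall>k. r (lev p + k) = d k"
    using Suc.hyps(1)[of p d] by (auto simp: d_def)
  have "r (lev x + k) = c k" for k using r(2) spec[OF r(2), of "Suc k"] ch_D(3)[OF p] by (simp add: d_def)
  then show ?case using r by blast
qed

lemma thr_nonempty: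
  assumes "x \<in> V" shows "\<exists>r. r \<in> thr x"
proof -
  define c where "c = rec_nat x (\<lambda>_ y. SOME z. z \<in> ch y)"
  have c: "c (Suc k) \<in> ch (c k)" "c k \<in> V" for k
  proof -
    show cV: "c k \<in> V" for k
    proof (induction k)
      case (Suc k)
      then show ?case using someI_ex[OF ch_nonempty[OF Suc]] ch_D(2) by (simp add: c_def)
    qed (simp add: c_def assms)
    show "c (Suc k) \<in> ch (c k)" using someI_ex[OF ch_nonempty[OF cV[of k]]] by (simp add: c_def)
  qed
  have "c 0 = x" by (simp add: c_def)
  then obtain r where r: "r \<in> bd" "\<forall>k. r (lev x + k) = c k" using bd_extend[of x c] assms c(1) by blast
  from r(2)[rule_format, of 0] have "r (lev x) = x" using \<open>c 0 = x\<close> by simp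
  then show ?thesis using r by (auto simp: thr_iff)
qed

lemma thr_comparable: "r \<in> thr v \<Longrightarrow> r \<in> thr w \<Longrightarrow> v \<in> desc w \<or> w \<in> desc v"
  using bd_desc_le[of r "lev v" "lev w"] bd_desc_le[of r "lev w" "lev v"]
  by (auto simp: thr_iff) (metis nat_le_linear)

text \<open>If every ray meets \<open>A\<close>, this is finite by Koenig's lemma.\<close>

definition cut :: "'a set \<Rightarrow> 'a set" where
  "cut A = {x \<in> V. \<forall>v\<in>A. x \<in> desc v \<longrightarrow> x = v}"

lemma cut_parent: "x \<in> cut A \<Longrightarrow> x \<in> ch p \<Longrightarrow> p \<in> cut A"
  using ch_D[of x p] desc_child[of p _ x] desc_lev[of p] by (fastforce simp: cut_def)

text \<open>Following vertices with infinitely many cut vertices below them produces a ray lying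
  entirely in the cut. But the ray meets \<open>A\<close>, and its vertices strictly below a member
  of \<open>A\<close> cannot be in the cut.\<close>

lemma finite_cut:
  assumes "\<And>r. r \<in> bd \<Longrightarrow> \<exists>n. r n \<in> A"
  shows "finite (cut A)"
proof (rule ccontr)
  assume inf: "infinite (cut A)"
  define P where "P = (\<lambda>x. x \<in> V \<and> infinite (desc x \<inter> cut A))"
  have P0: "P rt"
  proof -
    have "desc rt \<inter> cut A = cut A" using desc_root by (auto simp: cut_def)
    then show ?thesis using inf root_in by (simp add: P_def)
  qed
  have step: "\<exists>y. P y \<and> y \<in> ch x" if "P x" for x
  proof (rule ccontr)
    assume n: "\<not> ?thesis"
    have "desc x \<inter> cut A \<subseteq> insert x (\<Union>y\<in>ch x. desc y \<inter> cut A)"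
    proof
      fix z assume z: "z \<in> desc x \<inter> cut A"
      then have "z \<in> desc x" by simp
      then have "z = x \<or> (\<exists>y\<in>ch x. z \<in> desc y)"
      proof (induction rule: desc_induct)
        case (step y z)
        then show ?case using desc_child desc_refl ch_D(2) by blast
      qed simp
      then show "z \<in> insert x (\<Union>y\<in>ch x. desc y \<inter> cut A)" using z by blast
    qed
    moreover have "finite (desc y \<inter> cut A)" if "y \<in> ch x" for y
      using n that ch_D(2)[OF that] by (auto simp: P_def)
    ultimately have "finite (desc x \<inter> cut A)"
      using finite_ch[of x] by (meson finite_UN_I finite_insert finite_subset)
    then show False using that by (simp add: P_def)
  qed
  obtain c where c: "c 0 = rt" "\<And>n. P (c n)" "\<And>n. c (Suc n) \<in> ch (c n)"
    using dependent_nat_choice[of "\<lambda>n x. P x \<and> (n = 0 \<longrightarrow> x = rt)" "\<lambda>n x y. y \<in> ch x"] P0 step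
    by (metis nat.distinct(1))
  then have cb: "c \<in> bd" by (simp add: bd_iff)
  have up: "z \<in> cut A \<Longrightarrow> x \<in> cut A" if "z \<in> desc x" for x z
    using that by (induction rule: desc_induct) (auto intro: cut_parent)
  obtain n where n: "c n \<in> A" using assms cb by blast
  have "desc (c (Suc n)) \<inter> cut A \<noteq> {}" using c(2)[of "Suc n"] by (auto simp: P_def)
  then have "c (Suc n) \<in> cut A" using up by blast
  moreover have "c (Suc n) \<in> desc (c n)" using bd_desc_le[OF cb] by simp
  ultimately have "c (Suc n) = c n" using n by (auto simp: cut_def)
  then show False using bd_lev[OF cb] by (metis n_not_Suc_n)
qed

text \<open>A member of \<open>A\<close> above a child of \<open>x\<close> is that child or lies at
  or above \<open>x\<close>, so a vertex of the cut outside \<open>A\<close> keeps all its children,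
  and one in \<open>A\<close> keeps none. The leaves are thus the topmost members of
  \<open>A\<close>.\<close>

lemma cut_complete:
  assumes "\<And>r. r \<in> bd \<Longrightarrow> \<exists>n. r n \<in> A"
  shows "complete_subtree T (cut A)" "leaves T (cut A) = A \<inter> cut A"
proof -
  have c1: "ch x \<subseteq> cut A" if x: "x \<in> cut A" "x \<notin> A" for x
  proof
    fix y assume y: "y \<in> ch x"
    have "y = v" if v: "v \<in> A" "y \<in> desc v" for v
    proof (rule ccontr)
      assume "y \<noteq> v"
      then have "x \<in> desc v" using desc_parent[OF v(2) _ y] by simp
      then show False using x v by (auto simp: cut_def)
    qed
    then show "y \<in> cut A" using ch_D(2)[OF y] by (auto simp: cut_def)
  qed
  have c2: "ch x \<inter> cut A = {}" if "x \<in> A" "x \<in> V" for x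
    using that desc_refl[OF that(2)] desc_child[of x x] ch_D(3)[of _ x] by (fastforce simp: cut_def)
  have rt: "rt \<in> cut A"
    using root_in desc_lev[of rt] lev_root by (fastforce simp: cut_def)
  have V: "cut A \<subseteq> V" by (auto simp: cut_def)
  show "complete_subtree T (cut A)"
    unfolding complete_subtree_iff using finite_cut[OF assms] rt c1 c2 V cut_parent by blast
  show "leaves T (cut A) = A \<inter> cut A"
    unfolding leaves_def using c1 c2 V ch_nonempty by blast
qed

text \<open>Levels grow along a ray, so it leaves the finite set \<open>S\<close>, and a vertex
  outside \<open>S\<close> lies below a leaf.\<close>

lemma bd_meets_leaf:
  assumes "complete_subtree T S" "r \<in> bd"
  shows "\<exists>v\<in>leaves T S. r \<in> thr v"
proof -
  have "inj r" by (metis assms(2) bd_lev injI)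
  then have "\<not> range r \<subseteq> S"
    using assms finite_subset by (metis complete_subtree_iff finite_imageD infinite_UNIV_nat)
  then obtain n where "r n \<notin> S" by blast
  then have "r n \<in> forest_verts T S" using forest_iff[OF assms(1)] bd_V[OF assms(2)] by blast
  then show ?thesis using bd_through_desc[OF assms(2)] by (auto simp: forest_verts_def)
qed

lemma thr_forest: "v \<in> leaves T S \<Longrightarrow> r \<in> thr v \<Longrightarrow> r (lev v + k) \<in> forest_verts T S"
  using thr_desc by (auto simp: forest_verts_def)

end

section \<open>The action of almost automorphisms on the boundary\<close>

context leafless_tree
begin

lemma honest_iff:
  "(S, \<phi>, S') \<in> honest_auts T \<longleftrightarrow> complete_subtree T S \<and> complete_subtree T S' \<and>
     \<phi> \<in> extensional (forest_verts T S) \<and> bij_betw \<phi> (forest_verts T S) (forest_verts T S') \<and>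
     (\<forall>x\<in>forest_verts T S. \<forall>y\<in>forest_verts T S. {x, y} \<in> E \<longleftrightarrow> {\<phi> x, \<phi> y} \<in> E)"
proof -
  have "(\<forall>x\<in>forest_verts T S. \<forall>y\<in>forest_verts T S.
          {x, y} \<in> forest_edges T S \<longleftrightarrow> {\<phi> x, \<phi> y} \<in> forest_edges T S') \<longleftrightarrow>
        (\<forall>x\<in>forest_verts T S. \<forall>y\<in>forest_verts T S. {x, y} \<in> E \<longleftrightarrow> {\<phi> x, \<phi> y} \<in> E)"
    if "complete_subtree T S" "complete_subtree T S'"
      "bij_betw \<phi> (forest_verts T S) (forest_verts T S')"
    using forest_edges_iff[OF that(1)] forest_edges_iff[OF that(2)] bij_betwE[OF that(3)] by simp
  note eq = this
  show ?thesis
  proof (cases "complete_subtree T S \<and> complete_subtree T S' \<and>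
      bij_betw \<phi> (forest_verts T S) (forest_verts T S')")
    case True
    then show ?thesis using eq by (simp add: honest_auts_def forest_iso_def)
  next
    case False
    then show ?thesis by (intro iffI) (simp_all add: honest_auts_def forest_iso_def)
  qed
qed

text \<open>Below such an \<open>x\<close> the map is a map of rooted trees, so it moves rays vertex
  by vertex.\<close>

definition pres :: "'a set \<Rightarrow> ('a \<Rightarrow> 'a) \<Rightarrow> 'a \<Rightarrow> bool" where
  "pres S \<phi> x \<longleftrightarrow> x \<in> forest_verts T S \<and> (\<forall>y\<in>desc x. \<phi> ` ch y = ch (\<phi> y))"

lemma pres_desc: "pres S \<phi> x \<Longrightarrow> y \<in> desc x \<Longrightarrow> pres S \<phi> y"
  unfolding pres_def using forest_desc[of x S y] desc_trans[of y x] by simp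

text \<open>Descent propagates: once the edge into \<open>y\<close> is sent downwards, the only
  upward edge at \<open>\<phi> y\<close> is taken by \<open>\<phi> p\<close>, and injectivity forces
  all other edges at \<open>y\<close> down.\<close>

lemma honest_child_step:
  assumes h: "(S, \<phi>, S') \<in> honest_auts T"
    and p: "p \<in> forest_verts T S" "y \<in> ch p" "\<phi> y \<in> ch (\<phi> p)"
  shows "\<phi> ` ch y = ch (\<phi> y)"
proof -
  let ?F = "forest_verts T S" and ?F' = "forest_verts T S'"
  have bij: "bij_betw \<phi> ?F ?F'" and
    edge: "\<And>x y. x \<in> ?F \<Longrightarrow> y \<in> ?F \<Longrightarrow> {x, y} \<in> E \<longleftrightarrow> {\<phi> x, \<phi> y} \<in> E"
    using h by (auto simp: honest_iff)
  have inj: "\<And>x y. x \<in> ?F \<Longrightarrow> y \<in> ?F \<Longrightarrow> \<phi> x = \<phi> y \<Longrightarrow> x = y"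
    using bij by (meson bij_betw_def inj_onD)
  have yF: "y \<in> ?F" using forest_child p by blast
  show ?thesis
  proof
    show "\<phi> ` ch y \<subseteq> ch (\<phi> y)"
    proof
      fix w assume "w \<in> \<phi> ` ch y"
      then obtain z where z: "z \<in> ch y" "w = \<phi> z" by blast
      have zF: "z \<in> ?F" using forest_child yF z by blast
      have "{\<phi> y, \<phi> z} \<in> E" using edge[OF yF zF] z by (simp add: edge_iff)
      moreover have "\<phi> y \<notin> ch (\<phi> z)"
      proof
        assume "\<phi> y \<in> ch (\<phi> z)"
        then have "\<phi> z = \<phi> p" using parent_unique p(3) by blast
        then have "z = p" using inj zF p by blast
        then show False using ch_D(3)[OF z(1)] ch_D(3)[OF p(2)] by simp
      qed
      ultimately show "w \<in> ch (\<phi> y)" using z by (simp add: edge_iff)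
    qed
    show "ch (\<phi> y) \<subseteq> \<phi> ` ch y"
    proof
      fix w assume w: "w \<in> ch (\<phi> y)"
      have "\<phi> y \<in> ?F'" using bij yF by (rule bij_betw_apply)
      then have "w \<in> ?F'" using forest_child w by blast
      then obtain z where z: "z \<in> ?F" "w = \<phi> z" using bij by (metis bij_betw_imp_surj_on imageE)
      have "{y, z} \<in> E" using edge[OF yF z(1)] z w by (simp add: edge_iff)
      moreover have "y \<notin> ch z"
      proof
        assume "y \<in> ch z"
        then have "z = p" using parent_unique p(2) by blast
        then show False using z w ch_D(3)[OF w] ch_D(3)[OF p(3)] by simp
      qed
      ultimately show "w \<in> \<phi> ` ch y" using z by (simp add: edge_iff)
    qed
  qed
qed

lemma honest_pres_child:
  assumes h: "(S, \<phi>, S') \<in> honest_auts T"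
    and p: "p \<in> forest_verts T S" "y \<in> ch p" "\<phi> y \<in> ch (\<phi> p)"
  shows "pres S \<phi> y"
proof -
  have yF: "y \<in> forest_verts T S" using forest_child p by blast
  have "\<phi> ` ch z = ch (\<phi> z)" if "z \<in> desc y" for z
    using that
  proof (induction rule: desc_induct)
    case base
    show ?case using honest_child_step[OF h p] .
  next
    case (step x z)
    then have "x \<in> forest_verts T S" using forest_desc yF by blast
    then show ?case using honest_child_step[OF h, of x z] step by blast
  qed
  then show ?thesis using yF by (simp add: pres_def)
qed

text \<open>A forest isomorphism need not respect the direction of edges, but the image of a ray is a
  path without backtracking and descends from some point on.\<close>

lemma honest_eventually_pres:
  assumes h: "(S, \<phi>, S') \<in> honest_auts T" and r: "r \<in> bd"
  shows "\<exists>n. pres S \<phi> (r n)"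
proof -
  let ?F = "forest_verts T S"
  have S: "complete_subtree T S" and edge: "\<And>x y. x \<in> ?F \<Longrightarrow> y \<in> ?F \<Longrightarrow> {x, y} \<in> E \<longleftrightarrow> {\<phi> x, \<phi> y} \<in> E"
    using h by (auto simp: honest_iff)
  obtain v where v: "v \<in> leaves T S" "r \<in> thr v" using bd_meets_leaf[OF S r] by blast
  let ?r = "\<lambda>k. r (lev v + k)"
  have rF: "?r k \<in> ?F" for k using thr_forest v by blast
  have step: "?r (Suc k) \<in> ch (?r k)" for k using bd_Suc[OF r] by simp
  have "\<exists>k. \<phi> (?r (Suc k)) \<in> ch (\<phi> (?r k))"
  proof (rule ccontr)
    assume n: "\<not> ?thesis"
    have up: "\<phi> (?r k) \<in> ch (\<phi> (?r (Suc k)))" for k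
      using n edge[OF rF[of k] rF[of "Suc k"]] step[of k] by (auto simp: edge_iff)
    have "lev (\<phi> (?r k)) + k = lev (\<phi> (?r 0))" for k
    proof (induction k)
      case (Suc k)
      then show ?case using ch_D(3)[OF up[of k]] by simp
    qed simp
    from this[of "Suc (lev (\<phi> (?r 0)))"] show False by simp
  qed
  then obtain k where "\<phi> (?r (Suc k)) \<in> ch (\<phi> (?r k))" by blast
  then show ?thesis using honest_pres_child[OF h rF[of k] step[of k]] by blast
qed

text \<open>Possibly only a tail of \<open>r\<close> lies in the forest, and \<open>\<phi>\<close>
  may change levels; hence two independent offsets.\<close>

definition bd_lim :: "'a set \<Rightarrow> ('a \<Rightarrow> 'a) \<Rightarrow> (nat \<Rightarrow> 'a) \<Rightarrow> (nat \<Rightarrow> 'a) \<Rightarrow> bool" where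
  "bd_lim S \<phi> r s \<longleftrightarrow>
     s \<in> bd \<and> (\<exists>n m. \<forall>k. r (n + k) \<in> forest_verts T S \<and> s (m + k) = \<phi> (r (n + k)))"

lemma bd_limI:
  "s \<in> bd \<Longrightarrow> (\<And>k. r (n + k) \<in> forest_verts T S) \<Longrightarrow> (\<And>k. s (m + k) = \<phi> (r (n + k))) \<Longrightarrow> bd_lim S \<phi> r s"
  by (auto simp: bd_lim_def)

definition bmap :: "'a honest_aut \<Rightarrow> (nat \<Rightarrow> 'a) \<Rightarrow> (nat \<Rightarrow> 'a)" where
  "bmap x = (\<lambda>r\<in>bd. THE s. bd_lim (fst x) (fst (snd x)) r s)"

text \<open>The level of a common vertex fixes its index, so the offsets agree, and a vertex of a
  ray determines all earlier ones.\<close>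

lemma bd_eventually_eq:
  assumes "s \<in> bd" "s' \<in> bd" "\<And>k. s (m + k) = s' (m' + k)"
  shows "s = s'"
proof -
  have m: "m = m'" using assms bd_lev[OF assms(1), of m] bd_lev[OF assms(2), of m'] assms(3)[of 0] by simp
  show ?thesis
  proof
    fix i
    have "s (m + i) = s' (m + i)" using assms(3) m by simp
    then show "s i = s' i" using bd_agree_le[OF assms(1,2)] by simp
  qed
qed

lemma bd_lim_unique:
  assumes "bd_lim S \<phi> r s" "bd_lim S \<phi> r s'"
  shows "s = s'"
proof -
  obtain n m where 1: "s \<in> bd" "\<And>k. s (m + k) = \<phi> (r (n + k))" using assms(1) by (auto simp: bd_lim_def)
  obtain n' m' where 2: "s' \<in> bd" "\<And>k. s' (m' + k) = \<phi> (r (n' + k))" using assms(2) by (auto simp: bd_lim_def)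
  have "s ((m + n') + k) = s' ((m' + n) + k)" for k
    using 1(2)[of "n' + k"] 2(2)[of "n + k"] by (simp add: algebra_simps)
  then show ?thesis using bd_eventually_eq 1(1) 2(1) by blast
qed

lemma bmap_eqI: "bd_lim S \<phi> r s \<Longrightarrow> r \<in> bd \<Longrightarrow> bmap (S, \<phi>, S') r = s"
  using bd_lim_unique by (auto simp: bmap_def)

lemma bmap_pres:
  assumes p: "pres S \<phi> x" and r: "r \<in> thr x" and V: "\<phi> x \<in> V"
  shows "bmap (S, \<phi>, S') r \<in> thr (\<phi> x)"
    "bmap (S, \<phi>, S') r (lev (\<phi> x) + k) = \<phi> (r (lev x + k))"
    "bd_lim S \<phi> r (bmap (S, \<phi>, S') r)"
proof -
  have d: "r (lev x + k) \<in> desc x" for k using thr_desc r by blast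
  have "\<phi> (r (lev x + Suc k)) \<in> ch (\<phi> (r (lev x + k)))" for k
    using p d[of k] bd_Suc[of r "lev x + k"] r by (auto simp: pres_def thr_iff)
  moreover have "\<phi> (r (lev x + 0)) = \<phi> x" using r by (simp add: thr_iff)
  ultimately obtain s where s: "s \<in> bd" "\<forall>k. s (lev (\<phi> x) + k) = \<phi> (r (lev x + k))"
    using bd_extend[OF V, of "\<lambda>k. \<phi> (r (lev x + k))"] by blast
  have "r (lev x + k) \<in> forest_verts T S" for k using p d forest_desc by (auto simp: pres_def)
  then have lim: "bd_lim S \<phi> r s" using s by (auto simp: bd_lim_def)
  then have eq: "bmap (S, \<phi>, S') r = s" using bmap_eqI r by (simp add: thr_iff)
  show "bd_lim S \<phi> r (bmap (S, \<phi>, S') r)" using lim eq by simp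
  show "bmap (S, \<phi>, S') r (lev (\<phi> x) + k) = \<phi> (r (lev x + k))" using s eq by simp
  have "s (lev (\<phi> x)) = \<phi> x" using s(2)[rule_format, of 0] r by (simp add: thr_iff)
  then show "bmap (S, \<phi>, S') r \<in> thr (\<phi> x)" using s eq by (simp add: thr_iff)
qed

lemma honest_V:
  assumes "(S, \<phi>, S') \<in> honest_auts T" "x \<in> forest_verts T S"
  shows "\<phi> x \<in> V" "\<phi> x \<in> forest_verts T S'"
  using assms bij_betw_apply[of \<phi> "forest_verts T S" "forest_verts T S'" x] forest_V
  by (auto simp: honest_iff)

lemma bmap_lim:
  assumes h: "(S, \<phi>, S') \<in> honest_auts T" and r: "r \<in> bd"
  shows "bd_lim S \<phi> r (bmap (S, \<phi>, S') r)"
proof -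
  obtain n where n: "pres S \<phi> (r n)" using honest_eventually_pres[OF h r] by blast
  then have "\<phi> (r n) \<in> V" using honest_V(1)[OF h] by (simp add: pres_def)
  from bmap_pres(3)[OF n thr_self[OF r] this] show ?thesis .
qed

lemma bmap_bd: "(S, \<phi>, S') \<in> honest_auts T \<Longrightarrow> r \<in> bd \<Longrightarrow> bmap (S, \<phi>, S') r \<in> bd"
  using bmap_lim by (auto simp: bd_lim_def)

section \<open>Inverses, composites and equivalence of forest isomorphisms\<close>

definition honest_inv :: "'a honest_aut \<Rightarrow> 'a honest_aut" where
  "honest_inv = (\<lambda>(S, \<phi>, S'). (S', restrict (inv_into (forest_verts T S) \<phi>) (forest_verts T S'), S))"

lemma honest_inv:
  assumes h: "(S, \<phi>, S') \<in> honest_auts T"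
  shows "honest_inv (S, \<phi>, S') \<in> honest_auts T"
proof -
  let ?F = "forest_verts T S" and ?F' = "forest_verts T S'"
  let ?g = "restrict (inv_into ?F \<phi>) ?F'"
  have bij: "bij_betw \<phi> ?F ?F'" and
    edge: "\<And>x y. x \<in> ?F \<Longrightarrow> y \<in> ?F \<Longrightarrow> {x, y} \<in> E \<longleftrightarrow> {\<phi> x, \<phi> y} \<in> E"
    using h by (auto simp: honest_iff)
  have "bij_betw (inv_into ?F \<phi>) ?F' ?F" using bij by (rule bij_betw_inv_into)
  then have bg: "bij_betw ?g ?F' ?F" by (simp cong: bij_betw_cong)
  have fg: "\<phi> (?g y) = y" "?g y \<in> ?F" if "y \<in> ?F'" for y
    using that bij bij_betw_apply[OF bg] by (auto simp: bij_betw_inv_into_right)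
  show ?thesis using h bg edge fg
    unfolding honest_inv_def by (auto simp: honest_iff simp del: restrict_apply)
qed

lemma bd_lim_inv:
  assumes h: "(S, \<phi>, S') \<in> honest_auts T" and r: "r \<in> bd" and l: "bd_lim S \<phi> r s"
  shows "bd_lim S' (restrict (inv_into (forest_verts T S) \<phi>) (forest_verts T S')) s r"
proof -
  have bij: "bij_betw \<phi> (forest_verts T S) (forest_verts T S')" using h by (auto simp: honest_iff)
  obtain n m where nm: "\<And>k. r (n + k) \<in> forest_verts T S" "\<And>k. s (m + k) = \<phi> (r (n + k))"
    using l by (auto simp: bd_lim_def)
  have "s (m + k) \<in> forest_verts T S'" for k using nm honest_V(2)[OF h] by simp
  moreover have "inv_into (forest_verts T S) \<phi> (s (m + k)) = r (n + k)" for k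
    using nm bij by (simp add: bij_betw_inv_into_left)
  ultimately show ?thesis using r by (intro bd_limI[where n = m and m = n]) simp_all
qed

lemma bmap_inv:
  assumes h: "(S, \<phi>, S') \<in> honest_auts T" and r: "r \<in> bd"
  shows "bmap (honest_inv (S, \<phi>, S')) (bmap (S, \<phi>, S') r) = r"
  using bmap_eqI[OF bd_lim_inv[OF h r bmap_lim[OF h r]] bmap_bd[OF h r]]
  by (simp add: honest_inv_def)

text \<open>The left inverse law applied to the inverse triple; extensionality of
  \<open>\<phi>\<close> ensures that inverting twice returns the original triple.\<close>

lemma bmap_inv':
  assumes h: "(S, \<phi>, S') \<in> honest_auts T" and r: "r \<in> bd"
  shows "bmap (S, \<phi>, S') (bmap (honest_inv (S, \<phi>, S')) r) = r"
proof -
  let ?g = "restrict (inv_into (forest_verts T S) \<phi>) (forest_verts T S')"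
  have hi: "(S', ?g, S) \<in> honest_auts T" using honest_inv[OF h] by (simp add: honest_inv_def)
  have bij: "bij_betw \<phi> (forest_verts T S) (forest_verts T S')" and ext: "\<phi> \<in> extensional (forest_verts T S)"
    using h by (auto simp: honest_iff)
  have bg: "bij_betw ?g (forest_verts T S') (forest_verts T S)" using hi by (simp add: honest_iff)
  have "restrict (inv_into (forest_verts T S') ?g) (forest_verts T S) = \<phi>"
  proof (rule extensionalityI[OF _ ext])
    fix x assume x: "x \<in> forest_verts T S"
    have "?g (\<phi> x) = x" using x bij honest_V(2)[OF h x] by (simp add: bij_betw_inv_into_left)
    then have "inv_into (forest_verts T S') ?g x = \<phi> x"
      using bij_betw_inv_into_left[OF bg honest_V(2)[OF h x]] by simp
    then show "restrict (inv_into (forest_verts T S') ?g) (forest_verts T S) x = \<phi> x" using x by simp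
  qed simp
  then have "honest_inv (S', ?g, S) = (S, \<phi>, S')" by (simp add: honest_inv_def)
  then show ?thesis using bmap_inv[OF hi r] by (simp add: honest_inv_def)
qed

lemma bmap_bij:
  assumes h: "x \<in> honest_auts T"
  shows "bij_betw (bmap x) bd bd"
proof -
  obtain S \<phi> S' where x: "x = (S, \<phi>, S')" by (cases x) auto
  have hi: "honest_inv x \<in> honest_auts T" using honest_inv h x by blast
  obtain R \<psi> R' where y: "honest_inv x = (R, \<psi>, R')" by (cases "honest_inv x") auto
  have "bmap x r \<in> bd" "bmap (honest_inv x) r \<in> bd"
    "bmap (honest_inv x) (bmap x r) = r" "bmap x (bmap (honest_inv x) r) = r" if "r \<in> bd" for r
    using bmap_bd[of S \<phi> S' r] bmap_bd[of R \<psi> R' r] bmap_inv[of S \<phi> S' r] bmap_inv'[of S \<phi> S' r] h hi that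
    unfolding x y[unfolded x] by simp_all
  then show ?thesis by (intro bij_betw_byWitness[where f' = "bmap (honest_inv x)"]) auto
qed

lemma bmap_ext: "bmap x \<in> extensional bd" by (simp add: bmap_def)

lemma honest_comp:
  assumes "(S, \<phi>, S') \<in> honest_auts T" "(R, \<psi>, S) \<in> honest_auts T"
  shows "(R, compose (forest_verts T R) \<phi> \<psi>, S') \<in> honest_auts T"
proof -
  have "bij_betw (compose (forest_verts T R) \<phi> \<psi>) (forest_verts T R) (forest_verts T S')"
    using assms bij_betw_compose by (auto simp: honest_iff)
  then show ?thesis using assms honest_V(2)[OF assms(2)]
    by (auto simp: honest_iff compose_def)
qed

lemma bmap_comp:
  assumes h: "(S, \<phi>, S') \<in> honest_auts T" "(R, \<psi>, S) \<in> honest_auts T"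
  shows "bmap (R, compose (forest_verts T R) \<phi> \<psi>, S') = compose bd (bmap (S, \<phi>, S')) (bmap (R, \<psi>, S))"
proof (rule extensionalityI[OF bmap_ext])
  fix r assume r: "r \<in> bd"
  define s where "s = bmap (R, \<psi>, S) r"
  define t where "t = bmap (S, \<phi>, S') s"
  have sb: "s \<in> bd" using bmap_bd[OF h(2) r] by (simp add: s_def)
  obtain n m where 1: "\<And>k. r (n + k) \<in> forest_verts T R" "\<And>k. s (m + k) = \<psi> (r (n + k))"
    using bmap_lim[OF h(2) r] by (auto simp: bd_lim_def s_def)
  obtain n' m' where 2: "t \<in> bd" "\<And>k. s (n' + k) \<in> forest_verts T S" "\<And>k. t (m' + k) = \<phi> (s (n' + k))"
    using bmap_lim[OF h(1) sb] by (auto simp: bd_lim_def t_def)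
  \<comment> \<open>Starting \<open>r\<close> at \<open>n + n'\<close> makes its image in
    \<open>s\<close> start at \<open>m + n'\<close>, beyond both \<open>m\<close> and
    \<open>n'\<close>, so both tail descriptions apply.\<close>
  have "r ((n + n') + k) \<in> forest_verts T R" for k
    using 1(1)[of "n' + k"] by (simp add: algebra_simps)
  moreover have "t ((m' + m) + k) = \<phi> (\<psi> (r ((n + n') + k)))" for k
    using 1(2)[of "n' + k"] 2(3)[of "m + k"] by (simp add: algebra_simps)
  ultimately have "bd_lim R (compose (forest_verts T R) \<phi> \<psi>) r t"
    using 2(1) by (intro bd_limI[where n = "n + n'" and m = "m' + m"]) (simp_all add: compose_def)
  then show "bmap (R, compose (forest_verts T R) \<phi> \<psi>, S') r = compose bd (bmap (S, \<phi>, S')) (bmap (R, \<psi>, S)) r"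
    using bmap_eqI r by (simp add: s_def t_def compose_def)
qed simp

lemma complete_root: "complete_subtree T {rt}"
  unfolding complete_subtree_iff using root_in ch_D(5) by fastforce

lemma forest_mono:
  assumes "complete_subtree T S" "complete_subtree T Q" "S \<subseteq> Q"
  shows "forest_verts T Q \<subseteq> forest_verts T S"
proof
  fix x assume "x \<in> forest_verts T Q"
  then have x: "x \<in> V" "x \<notin> Q \<or> ch x \<inter> Q = {}" using assms(2) by (auto simp: forest_iff leaves_def)
  have "x \<notin> S \<or> x \<in> leaves T S" using x(2) assms(3) by (auto simp: leaves_def)
  then show "x \<in> forest_verts T S" using x(1) forest_iff[OF assms(1)] by blast
qed

lemma bmap_cong_equiv:
  assumes "((S, \<phi>, S'), (R, \<psi>, R')) \<in> aaut_equiv T"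
  shows "bmap (S, \<phi>, S') = bmap (R, \<psi>, R')"
proof (rule extensionalityI[OF bmap_ext bmap_ext])
  fix r assume r: "r \<in> bd"
  from assms obtain Q where h: "(S, \<phi>, S') \<in> honest_auts T" "(R, \<psi>, R') \<in> honest_auts T"
    and Q: "complete_subtree T Q" "S \<union> R \<subseteq> Q" "\<And>x. x \<in> forest_verts T Q \<Longrightarrow> \<phi> x = \<psi> x"
    by (auto simp: aaut_equiv_def)
  obtain v where v: "v \<in> leaves T Q" "r \<in> thr v" using bd_meets_leaf[OF Q(1) r] by blast
  obtain n m where nm: "bmap (S, \<phi>, S') r \<in> bd" "\<And>k. bmap (S, \<phi>, S') r (m + k) = \<phi> (r (n + k))"
    using bmap_lim[OF h(1) r] by (auto simp: bd_lim_def)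
  have F: "r (n + (lev v + k)) \<in> forest_verts T Q" for k
    using thr_forest[OF v, of "n + k"] by (simp add: algebra_simps)
  have "complete_subtree T R" using h by (simp add: honest_iff)
  then have F': "r (n + (lev v + k)) \<in> forest_verts T R" for k using F forest_mono[of R Q] Q by blast
  have "bd_lim R \<psi> r (bmap (S, \<phi>, S') r)"
    unfolding bd_lim_def using nm F' Q(3)[OF F]
    by (intro conjI exI[of _ "n + lev v"] exI[of _ "m + lev v"]) (simp_all add: add.assoc)
  then show "bmap (S, \<phi>, S') r = bmap (R, \<psi>, R') r" using bmap_eqI r by simp
qed

text \<open>A vertex of \<open>S\<close> properly below a member of \<open>A\<close> would be a
  child of a forest vertex, and such children lie outside \<open>S\<close>.\<close>

lemma cut_superset:
  assumes S: "complete_subtree T S" and A: "A \<subseteq> forest_verts T S"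
  shows "S \<subseteq> cut A"
proof
  fix x assume x: "x \<in> S"
  have "x = v" if v: "v \<in> A" "x \<in> desc v" for v
    using v(2)
  proof (cases rule: desc_cases)
    case (2 p)
    have "p \<in> forest_verts T S" using forest_desc A v(1) 2 by blast
    then show ?thesis using forest_child_notin[OF S _ 2(1)] x by blast
  qed
  then show "x \<in> cut A" using x S by (auto simp: cut_def complete_subtree_iff)
qed

end

locale branching_tree = leafless_tree +
  assumes no_isolated: "no_isolated_points (boundary_topology T)"
begin

text \<open>Without branching only one ray passes through \<open>x\<close>, so the basic open set
  \<open>thr x\<close> is a singleton and that ray is isolated.\<close>

lemma branch:
  assumes x: "x \<in> V"
  shows "\<exists>b\<in>desc x. \<exists>a\<in>ch b. \<exists>a'\<in>ch b. a \<noteq> a'"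
proof (rule ccontr)
  assume "\<not> ?thesis"
  then have un: "\<And>b a a'. b \<in> desc x \<Longrightarrow> a \<in> ch b \<Longrightarrow> a' \<in> ch b \<Longrightarrow> a = a'" by blast
  obtain r where r: "r \<in> thr x" using thr_nonempty x by blast
  have "s = r" if s: "s \<in> thr x" for s
  proof -
    have "s (lev x + k) = r (lev x + k)" for k
    proof (induction k)
      case 0
      then show ?case using r s by (simp add: thr_iff)
    next
      case (Suc k)
      then show ?case
        using un[OF thr_desc[OF r, of k], of "s (lev x + Suc k)" "r (lev x + Suc k)"]
          bd_Suc[of s "lev x + k"] bd_Suc[of r "lev x + k"] r s by (auto simp: thr_iff)
    qed
    moreover have "s \<in> bd" "r \<in> bd" using r s by (simp_all add: thr_iff)
    ultimately show ?thesis using bd_eventually_eq by blast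
  qed
  then have eq: "thr x = {r}" using r by blast
  have op: "openin (boundary_topology T) (thr x)"
    unfolding boundary_topology_def using x by (auto intro: topology_generated_by_Basis)
  then have "r \<in> topspace (boundary_topology T)" using eq openin_subset by fastforce
  then show False using no_isolated op eq by (simp add: no_isolated_points_def)
qed

text \<open>The map on the boundary determines \<open>\<phi>\<close> at a branching vertex \<open>b\<close>, namely as the
  vertex where the images of two rays splitting at \<open>b\<close> split.\<close>

lemma pres_determined:
  assumes p: "pres S \<phi> x" "pres R \<psi> x" and V: "\<phi> x \<in> V" "\<psi> x \<in> V"
    and inj: "inj_on \<phi> (forest_verts T S)" "inj_on \<psi> (forest_verts T R)"
    and eq: "bmap (S, \<phi>, S') = bmap (R, \<psi>, R')"
  shows "\<phi> x = \<psi> x"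
proof -
  have xV: "x \<in> V" using p(1) forest_V by (auto simp: pres_def)
  obtain b a a' where b: "b \<in> desc x" "a \<in> ch b" "a' \<in> ch b" "a \<noteq> a'" using branch[OF xV] by blast
  obtain r where r: "r \<in> thr a" using thr_nonempty ch_D(2) b by blast
  obtain s where s: "s \<in> thr a'" using thr_nonempty ch_D(2) b by blast
  have aF: "a \<in> desc x" "a' \<in> desc x" using desc_child b by blast+
  have rb: "r \<in> thr b" "s \<in> thr b" "r \<in> thr x" "s \<in> thr x"
    using r s thr_mono desc_child[OF desc_refl b(2)] desc_child[OF desc_refl b(3)] ch_D(1)[OF b(2)] aF by blast+
  let ?F = "bmap (S, \<phi>, S')"
  define j where "j = lev b - lev x"
  have j: "lev b = lev x + j" using desc_lev[OF b(1)] by (auto simp: j_def)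
  have rj: "r (lev x + j) = b" "s (lev x + j) = b" "r (lev x + Suc j) = a" "s (lev x + Suc j) = a'"
    using rb r s ch_D(3)[OF b(2)] ch_D(3)[OF b(3)] j by (auto simp: thr_iff)
  \<comment> \<open>Every \<open>f\<close> inducing the same boundary map puts \<open>f x\<close>
    exactly \<open>j\<close> levels above the last common vertex of the two image rays.\<close>
  have main: "\<exists>m. f x = ?F r m \<and> ?F r (m + j) = ?F s (m + j) \<and> ?F r (Suc (m + j)) \<noteq> ?F s (Suc (m + j))"
    if pf: "pres S0 f x" and Vf: "f x \<in> V" and injf: "inj_on f (forest_verts T S0)" and eqf: "?F = bmap (S0, f, S0')"
    for S0 f S0'
  proof -
    have k: "?F r (lev (f x) + k) = f (r (lev x + k))" "?F s (lev (f x) + k) = f (s (lev x + k))" for k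
      using bmap_pres(2)[OF pf _ Vf] rb eqf by simp_all
    have "a \<in> forest_verts T S0" "a' \<in> forest_verts T S0"
      using forest_desc pf aF by (auto simp: pres_def)
    then have "f a \<noteq> f a'" using injf b(4) by (meson inj_onD)
    moreover have "?F r (lev (f x)) = f x" using k(1)[of 0] rb by (simp add: thr_iff)
    ultimately show ?thesis
      using k(1)[of j] k(2)[of j] k(1)[of "Suc j"] k(2)[of "Suc j"] rj
      by (intro exI[of _ "lev (f x)"]) simp
  qed
  obtain m where m: "\<phi> x = ?F r m" "?F r (m + j) = ?F s (m + j)" "?F r (Suc (m + j)) \<noteq> ?F s (Suc (m + j))"
    using main[OF p(1) V(1) inj(1) refl] by blast
  obtain m' where m': "\<psi> x = ?F r m'" "?F r (m' + j) = ?F s (m' + j)" "?F r (Suc (m' + j)) \<noteq> ?F s (Suc (m' + j))"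
    using main[OF p(2) V(2) inj(2) eq] by blast
  have Fb: "?F r \<in> bd" "?F s \<in> bd" using bmap_pres(1)[OF p(1) _ V(1)] rb by (auto simp: thr_iff)
  \<comment> \<open>Two rays part at one level only, so \<open>m + j = m' + j\<close>.\<close>
  have "m = m'"
    using bd_agree_le[OF Fb, of "m + j" "Suc (m' + j)"] bd_agree_le[OF Fb, of "m' + j" "Suc (m + j)"] m m'
    by (cases m m' rule: linorder_cases) auto
  then show ?thesis using m m' by simp
qed

text \<open>Along every ray both maps descend from some point on. The topmost vertices where both do
  so are the leaves of a complete subtree, and below them \<open>pres_determined\<close> makes the
  two maps equal.\<close>

lemma bmap_eq_equiv:
  assumes h: "(S, \<phi>, S') \<in> honest_auts T" "(R, \<psi>, R') \<in> honest_auts T"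
    and eq: "bmap (S, \<phi>, S') = bmap (R, \<psi>, R')"
  shows "((S, \<phi>, S'), (R, \<psi>, R')) \<in> aaut_equiv T"
proof -
  define A where "A = {x. pres S \<phi> x \<and> pres R \<psi> x}"
  have A: "\<exists>n. r n \<in> A" if r: "r \<in> bd" for r
  proof -
    obtain n m where nm: "pres S \<phi> (r n)" "pres R \<psi> (r m)"
      using honest_eventually_pres h r by meson
    have "r (max n m) \<in> A"
      using pres_desc[OF nm(1)] pres_desc[OF nm(2)] bd_desc_le[OF r] by (simp add: A_def)
    then show ?thesis by blast
  qed
  have CS: "complete_subtree T S" "complete_subtree T R" and
    inj: "inj_on \<phi> (forest_verts T S)" "inj_on \<psi> (forest_verts T R)"
    using h by (auto simp: honest_iff bij_betw_def)
  note Q = cut_complete[of A, OF A]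
  have "A \<subseteq> forest_verts T S" "A \<subseteq> forest_verts T R" by (auto simp: A_def pres_def)
  then have "S \<subseteq> cut A" "R \<subseteq> cut A" using CS cut_superset by blast+
  moreover have "\<phi> x = \<psi> x" if "x \<in> forest_verts T (cut A)" for x
  proof -
    have "x \<in> A"
      using that Q(2) pres_desc by (auto simp: forest_verts_def A_def)
    then show ?thesis
      using pres_determined[OF _ _ _ _ inj eq, of x] honest_V(1)[OF h(1)] honest_V(1)[OF h(2)]
      by (auto simp: A_def pres_def)
  qed
  ultimately show ?thesis using h Q(1) by (auto simp: aaut_equiv_def)
qed

text \<open>Makes the equivalence the kernel of \<open>bmap\<close>, so that the classes are the
  fibres of \<open>bmap\<close>.\<close>

lemma equiv_iff:
  "(x, y) \<in> aaut_equiv T \<longleftrightarrow> x \<in> honest_auts T \<and> y \<in> honest_auts T \<and> bmap x = bmap y"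
proof -
  obtain S \<phi> S' R \<psi> R' where xy: "x = (S, \<phi>, S')" "y = (R, \<psi>, R')" by (cases x; cases y) auto
  show ?thesis unfolding xy
    using bmap_cong_equiv[of S \<phi> S' R \<psi> R'] bmap_eq_equiv[of S \<phi> S' R \<psi> R']
    by (auto simp: aaut_equiv_def)
qed

end

section \<open>Local tree isomorphisms of the boundary\<close>

context branching_tree
begin

text \<open>\<open>F\<close> maps the rays through \<open>v\<close> to those through \<open>w\<close> as an isomorphism of the subtrees below
  \<open>v\<close> and \<open>w\<close> would, preserving the colours given by \<open>A\<close> strictly below \<open>v\<close>.\<close>

definition tiso :: "('a \<Rightarrow> 'c) \<Rightarrow> ((nat \<Rightarrow> 'a) \<Rightarrow> (nat \<Rightarrow> 'a)) \<Rightarrow> 'a \<Rightarrow> 'a \<Rightarrow> bool" where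
  "tiso A F v w \<longleftrightarrow> v \<in> V \<and> w \<in> V \<and> F ` thr v = thr w \<and>
     (\<forall>r\<in>thr v. \<forall>s\<in>thr v. \<forall>k. r (lev v + k) = s (lev v + k) \<longleftrightarrow> F r (lev w + k) = F s (lev w + k)) \<and>
     (\<forall>r\<in>thr v. \<forall>k. A (F r (lev w + Suc k)) = A (r (lev v + Suc k)))"

lemma tiso_V: "tiso A F v w \<Longrightarrow> v \<in> V \<and> w \<in> V"
  by (simp add: tiso_def)

lemma tiso_thr: "tiso A F v w \<Longrightarrow> r \<in> thr v \<Longrightarrow> F r \<in> thr w"
  by (auto simp: tiso_def)

lemma tiso_surj: "tiso A F v w \<Longrightarrow> s \<in> thr w \<Longrightarrow> \<exists>r\<in>thr v. s = F r"
  by (auto simp: tiso_def)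

lemma tiso_iff: "tiso A F v w \<Longrightarrow> r \<in> thr v \<Longrightarrow> s \<in> thr v \<Longrightarrow>
    F r (lev w + k) = F s (lev w + k) \<longleftrightarrow> r (lev v + k) = s (lev v + k)"
  by (simp add: tiso_def)

lemma tiso_col: "tiso A F v w \<Longrightarrow> r \<in> thr v \<Longrightarrow> A (F r (lev w + Suc k)) = A (r (lev v + Suc k))"
  by (simp add: tiso_def)

text \<open>Lets isomorphisms that are given at different depths of a ray be brought to a common
  depth.\<close>

lemma tiso_desc:
  assumes t: "tiso A F v w" and r: "r \<in> thr v"
  shows "tiso A F (r (lev v + k)) (F r (lev w + k))"
proof -
  let ?x = "r (lev v + k)" and ?y = "F r (lev w + k)"
  have rb: "r \<in> bd" "F r \<in> bd" "F r \<in> thr w" using r tiso_thr[OF t r] by (auto simp: thr_iff)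
  have lx: "lev ?x = lev v + k" "lev ?y = lev w + k" using bd_lev rb by blast+
  have sub: "thr ?x \<subseteq> thr v" "thr ?y \<subseteq> thr w" using thr_mono thr_desc r rb by blast+
  have "F ` thr ?x = thr ?y"
  proof
    show "F ` thr ?x \<subseteq> thr ?y"
    proof
      fix u assume "u \<in> F ` thr ?x"
      then obtain s where s: "s \<in> thr ?x" "u = F s" by blast
      have "s \<in> thr v" using sub s by blast
      then show "u \<in> thr ?y"
        using tiso_iff[OF t _ r, of s k] tiso_thr[OF t] s lx by (simp add: thr_iff)
    qed
    show "thr ?y \<subseteq> F ` thr ?x"
    proof
      fix u assume u: "u \<in> thr ?y"
      then obtain s where s: "s \<in> thr v" "u = F s" using tiso_surj[OF t] sub by blast
      then have "s \<in> thr ?x" using tiso_iff[OF t _ r, of s k] u lx by (simp add: thr_iff)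
      then show "u \<in> F ` thr ?x" using s by blast
    qed
  qed
  moreover have "?x \<in> V" "?y \<in> V" using bd_V rb by blast+
  moreover have "p (lev ?x + j) = q (lev ?x + j) \<longleftrightarrow> F p (lev ?y + j) = F q (lev ?y + j)"
    if "p \<in> thr ?x" "q \<in> thr ?x" for p q j
    using tiso_iff[OF t, of p q "k + j"] that sub lx by (auto simp: add.assoc)
  moreover have "A (F p (lev ?y + Suc j)) = A (p (lev ?x + Suc j))" if "p \<in> thr ?x" for p j
    using tiso_col[OF t, of p "k + j"] that sub lx by (auto simp: add.assoc)
  ultimately show ?thesis unfolding tiso_def by blast
qed

lemma tiso_comp:
  assumes t: "tiso A F v w" "tiso A G w u"
  shows "tiso A (compose bd G F) v u"
proof -
  have c: "compose bd G F r = G (F r)" if "r \<in> thr v" for r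
    using that by (simp add: compose_def thr_iff)
  have "compose bd G F ` thr v = G ` F ` thr v" using c by (force simp: image_iff)
  then have "compose bd G F ` thr v = thr u" using t by (simp add: tiso_def)
  then show ?thesis
    using t c tiso_thr[OF t(1)] tiso_iff[OF t(1)] tiso_iff[OF t(2)] tiso_col[OF t(1)] tiso_col[OF t(2)]
    unfolding tiso_def[of A "compose bd G F"] by (simp add: tiso_V[OF t(1)] tiso_V[OF t(2)])
qed

definition bd_inv :: "((nat \<Rightarrow> 'a) \<Rightarrow> (nat \<Rightarrow> 'a)) \<Rightarrow> ((nat \<Rightarrow> 'a) \<Rightarrow> (nat \<Rightarrow> 'a))" where
  "bd_inv F = restrict (inv_into bd F) bd"

lemma bd_inv:
  assumes "bij_betw F bd bd"
  shows "bij_betw (bd_inv F) bd bd" "r \<in> bd \<Longrightarrow> bd_inv F (F r) = r" "r \<in> bd \<Longrightarrow> F (bd_inv F r) = r"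
    "r \<in> bd \<Longrightarrow> bd_inv F r \<in> bd"
proof -
  have "bij_betw (inv_into bd F) bd bd" using assms by (rule bij_betw_inv_into)
  then show b: "bij_betw (bd_inv F) bd bd" unfolding bd_inv_def by (simp cong: bij_betw_cong)
  show "r \<in> bd \<Longrightarrow> bd_inv F (F r) = r" "r \<in> bd \<Longrightarrow> F (bd_inv F r) = r" "r \<in> bd \<Longrightarrow> bd_inv F r \<in> bd"
    using assms bij_betw_apply[OF assms, of r] bij_betw_apply[OF b, of r]
    by (auto simp: bd_inv_def bij_betw_inv_into_left bij_betw_inv_into_right)
qed

lemma tiso_inv:
  assumes F: "bij_betw F bd bd" and t: "tiso A F v w"
  shows "tiso A (bd_inv F) w v"
proof -
  have i: "bd_inv F (F r) = r" if "r \<in> thr v" for r using that bd_inv(2)[OF F] by (simp add: thr_iff)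
  have im: "thr w = F ` thr v" using t by (simp add: tiso_def)
  have "bd_inv F ` thr w = thr v" using i by (auto simp: im image_iff)
  then show ?thesis
    using t i unfolding tiso_def[of A "bd_inv F"] by (simp add: im tiso_V[OF t] tiso_iff[OF t] tiso_col[OF t] del: add_Suc_right)
qed

definition local_iso :: "('a \<Rightarrow> 'c) \<Rightarrow> ((nat \<Rightarrow> 'a) \<Rightarrow> (nat \<Rightarrow> 'a)) set" where
  "local_iso A = {F \<in> extensional bd. bij_betw F bd bd \<and> (\<forall>r\<in>bd. \<exists>n w. tiso A F (r n) w)}"

lemma local_iso_bij: "F \<in> local_iso A \<Longrightarrow> bij_betw F bd bd" by (simp add: local_iso_def)

lemma local_iso_comp:
  assumes "F \<in> local_iso A" "G \<in> local_iso A"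
  shows "compose bd G F \<in> local_iso A"
proof -
  have "\<exists>n w. tiso A (compose bd G F) (r n) w" if r: "r \<in> bd" for r
  proof -
    have Fr: "F r \<in> bd" using assms(1) r bij_betw_apply by (fastforce simp: local_iso_def)
    obtain n w where 1: "tiso A F (r n) w" using assms(1) r by (auto simp: local_iso_def)
    obtain m u where 2: "tiso A G (F r m) u" using assms(2) Fr by (auto simp: local_iso_def)
    \<comment> \<open>\<open>F\<close> is controlled below \<open>r n\<close> with image
      \<open>w\<close>, and \<open>G\<close> below \<open>F r m\<close>. Going down \<open>m\<close>
      levels in the first and \<open>lev w\<close> levels in the second makes both meet at
      \<open>F r (lev w + m)\<close>.\<close>
    have "tiso A F (r (n + m)) (F r (lev w + m))"
      using tiso_desc[OF 1 thr_self[OF r], of m] bd_lev[OF r] by simp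
    moreover have "tiso A G (F r (lev w + m)) (G (F r) (lev u + lev w))"
      using tiso_desc[OF 2 thr_self[OF Fr], of "lev w"] bd_lev[OF Fr] by (simp add: add.commute)
    ultimately show ?thesis using tiso_comp by blast
  qed
  moreover have "bij_betw (compose bd G F) bd bd" using assms bij_betw_compose by (auto simp: local_iso_def)
  ultimately show ?thesis by (simp add: local_iso_def compose_extensional)
qed

lemma local_iso_inv:
  assumes "F \<in> local_iso A" shows "bd_inv F \<in> local_iso A"
proof -
  note bij = local_iso_bij[OF assms]
  have "\<exists>n w. tiso A (bd_inv F) (r n) w" if r: "r \<in> bd" for r
  proof -
    obtain n w where 1: "tiso A F (bd_inv F r n) w"
      using assms bd_inv(4)[OF bij r] by (auto simp: local_iso_def)
    have "r \<in> thr w" using tiso_thr[OF 1 thr_self[OF bd_inv(4)[OF bij r]]] bd_inv(3)[OF bij r] by simp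
    then have "r (lev w) = w" by (simp add: thr_iff)
    then show ?thesis using tiso_inv[OF bij 1] by metis
  qed
  then show ?thesis using bd_inv(1)[OF bij] by (simp add: local_iso_def bd_inv_def)
qed

lemma tiso_refl: "v \<in> V \<Longrightarrow> tiso A (\<lambda>r\<in>bd. r) v v"
  by (auto simp: tiso_def thr_iff)

lemma local_iso_id: "(\<lambda>r\<in>bd. r) \<in> local_iso A"
  using tiso_refl bd_V by (fastforce simp: local_iso_def bij_betw_def inj_on_def)

lemma local_iso_mono: "F \<in> local_iso A \<Longrightarrow> F \<in> local_iso (\<lambda>_. ())"
proof -
  have "tiso A F v w \<Longrightarrow> tiso (\<lambda>_. ()) F v w" for v w by (simp add: tiso_def)
  then show "F \<in> local_iso A \<Longrightarrow> F \<in> local_iso (\<lambda>_. ())" unfolding local_iso_def by blast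
qed

section \<open>Passing between forest isomorphisms and boundary maps\<close>

lemma honest_tiso:
  assumes h: "(S, \<phi>, S') \<in> honest_auts T" and p: "pres S \<phi> x"
    and A: "\<And>y z. z \<in> desc x \<Longrightarrow> y \<in> ch z \<Longrightarrow> A (\<phi> y) = A y"
  shows "tiso A (bmap (S, \<phi>, S')) x (\<phi> x)"
proof -
  let ?F = "bmap (S, \<phi>, S')"
  have xF: "x \<in> forest_verts T S" using p by (simp add: pres_def)
  have V: "\<phi> x \<in> V" "x \<in> V" using honest_V[OF h xF] forest_V[OF xF] by auto
  have inj: "inj_on \<phi> (forest_verts T S)" using h by (simp add: honest_iff bij_betw_def)
  have dF: "y \<in> forest_verts T S" if "y \<in> desc x" for y using forest_desc[OF xF that] .
  note k = bmap_pres[OF p _ V(1), of _ S']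
  have "?F ` thr x = thr (\<phi> x)"
  proof
    show "?F ` thr x \<subseteq> thr (\<phi> x)" using k(1) by blast
    show "thr (\<phi> x) \<subseteq> ?F ` thr x"
    proof
      fix s assume s: "s \<in> thr (\<phi> x)"
      let ?s = "\<lambda>k. s (lev (\<phi> x) + k)"
      \<comment> \<open>A preimage ray of \<open>s\<close> is grown vertex by vertex, each time
        choosing a child that \<open>\<phi>\<close> maps to the next vertex of
        \<open>s\<close>.\<close>
      define c where "c = rec_nat x (\<lambda>k y. SOME z. z \<in> ch y \<and> \<phi> z = ?s (Suc k))"
      have c: "c k \<in> desc x \<and> \<phi> (c k) = ?s k \<and> c (Suc k) \<in> ch (c k)" for k
      proof -
        have st: "c (Suc k) \<in> ch (c k) \<and> \<phi> (c (Suc k)) = ?s (Suc k)"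
          if "c k \<in> desc x" "\<phi> (c k) = ?s k" for k
        proof -
          have "?s (Suc k) \<in> ch (?s k)" using bd_Suc s by (simp add: thr_iff)
          also have "ch (?s k) = \<phi> ` ch (c k)" using p that by (simp add: pres_def)
          finally have "\<exists>z. z \<in> ch (c k) \<and> \<phi> z = ?s (Suc k)" by auto
          from someI_ex[OF this] show ?thesis by (simp add: c_def)
        qed
        have "c k \<in> desc x \<and> \<phi> (c k) = ?s k"
        proof (induction k)
          case 0
          then show ?case using s desc_refl V by (simp add: c_def thr_iff)
        next
          case (Suc k)
          then show ?case using st[of k] desc_child by blast
        qed
        then show ?thesis using st by blast
      qed
      obtain r where r: "r \<in> bd" "\<forall>k. r (lev x + k) = c k"
        using bd_extend[of x c] V c by (auto simp: c_def)
      have "r (lev x) = x" using r(2)[rule_format, of 0] by (simp add: c_def)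
      then have rt: "r \<in> thr x" using r by (simp add: thr_iff)
      have "?F r (lev (\<phi> x) + k) = s (lev (\<phi> x) + k)" for k using k(2)[OF rt, of k] c[of k] r by simp
      moreover have "?F r \<in> bd" "s \<in> bd" using k(1)[OF rt] s by (simp_all add: thr_iff)
      ultimately have "?F r = s" using bd_eventually_eq by blast
      then show "s \<in> ?F ` thr x" using rt by blast
    qed
  qed
  moreover have "r (lev x + k) = s (lev x + k) \<longleftrightarrow> ?F r (lev (\<phi> x) + k) = ?F s (lev (\<phi> x) + k)"
    if "r \<in> thr x" "s \<in> thr x" for r s k
    using k(2)[OF that(1), of k] k(2)[OF that(2), of k]
      inj_on_eq_iff[OF inj dF[OF thr_desc[OF that(1)]] dF[OF thr_desc[OF that(2)]], of k k] by simp
  moreover have "A (?F r (lev (\<phi> x) + Suc k)) = A (r (lev x + Suc k))" if r: "r \<in> thr x" for r k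
    using k(2)[OF r, of "Suc k"] A[OF thr_desc[OF r, of k], of "r (lev x + Suc k)"] bd_Suc[of r "lev x + k"] r
    by (simp add: thr_iff)
  ultimately show ?thesis using V by (simp add: tiso_def)
qed

lemma honest_local_iso:
  assumes "x \<in> honest_auts T" shows "bmap x \<in> local_iso (\<lambda>_. ())"
proof -
  obtain S \<phi> S' where x: "x = (S, \<phi>, S')" by (cases x) auto
  have "\<exists>n w. tiso (\<lambda>_. ()) (bmap x) (r n) w" if r: "r \<in> bd" for r
  proof -
    obtain n where "pres S \<phi> (r n)" using honest_eventually_pres[of S \<phi> S' r] assms x r by blast
    then show ?thesis using honest_tiso[of S \<phi> S' "r n" "\<lambda>_. ()"] assms x by blast
  qed
  then show ?thesis using bmap_bij[OF assms] bmap_ext by (simp add: local_iso_def)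
qed

text \<open>The vertex \<open>k\<close> levels below a leaf \<open>v\<close> on a ray
  \<open>r\<close> is sent to the vertex \<open>k\<close> levels below \<open>g v\<close> on
  \<open>F r\<close>. The vertices \<open>g v\<close> are pairwise incomparable because
  \<open>F\<close> is injective and meet every ray because \<open>F\<close> is surjective, so they
  are the leaves of a complete subtree, which serves as \<open>S'\<close>.\<close>

lemma local_iso_realize:
  assumes F: "F \<in> local_iso A" and S: "complete_subtree T S"
    and good: "\<And>v. v \<in> leaves T S \<Longrightarrow> \<exists>w. tiso A F v w"
  obtains \<phi> S' where "(S, \<phi>, S') \<in> honest_auts T" "bmap (S, \<phi>, S') = F" "leaves T S' = \<phi> ` leaves T S"
    "\<And>x. x \<in> forest_verts T S \<Longrightarrow> \<phi> ` ch x = ch (\<phi> x)"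
    "\<And>x y. x \<in> forest_verts T S \<Longrightarrow> y \<in> ch x \<Longrightarrow> A (\<phi> y) = A y"
proof -
  let ?L = "leaves T S" and ?F = "forest_verts T S"
  note bij = local_iso_bij[OF F]
  define g where "g v = (SOME w. tiso A F v w)" for v
  have g: "tiso A F v (g v)" if "v \<in> ?L" for v
    unfolding g_def using someI_ex[OF good[OF that]] .
  define B where "B = g ` ?L"
  have disj: "v = v'" if v: "v \<in> ?L" "v' \<in> ?L" "s \<in> thr (g v)" "s \<in> thr (g v')" for v v' s
  proof -
    obtain r where r: "r \<in> thr v" "s = F r" using tiso_surj[OF g] v by blast
    obtain r' where r': "r' \<in> thr v'" "s = F r'" using tiso_surj[OF g] v by blast
    have "r = r'" using r r' bij by (auto simp: thr_iff bij_betw_def inj_on_def)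
    then have "v \<in> desc v' \<or> v' \<in> desc v" using thr_comparable r r' by blast
    then show ?thesis using leaf_unique[OF S v(1,2)] desc_refl thr_V r r' \<open>r = r'\<close> by blast
  qed
  have anti: "v = v'" if v: "v \<in> ?L" "v' \<in> ?L" "x \<in> desc (g v)" "x \<in> desc (g v')" for v v' x
  proof -
    obtain s where "s \<in> thr x" using thr_nonempty desc_V(1)[OF v(3)] by blast
    then show ?thesis using disj v thr_mono by blast
  qed
  have meets: "\<exists>n. s n \<in> B" if s: "s \<in> bd" for s
  proof -
    obtain v where v: "v \<in> ?L" "bd_inv F s \<in> thr v" using bd_meets_leaf[OF S bd_inv(4)[OF bij s]] by blast
    then have "s \<in> thr (g v)" using tiso_thr[OF g] bd_inv(3)[OF bij s] by metis
    then show ?thesis using v by (metis B_def imageI thr_iff)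
  qed
  \<comment> \<open>By \<open>anti\<close> no member of \<open>B\<close> lies below another one, so
    all of \<open>B\<close> survives as the leaves of the cut.\<close>
  define S' where "S' = cut B"
  have S': "complete_subtree T S'" "leaves T S' = B"
  proof -
    show "complete_subtree T S'" unfolding S'_def using cut_complete(1) meets by blast
    have "B \<subseteq> cut B"
      using anti tiso_V[OF g] desc_refl by (fastforce simp: B_def cut_def)
    then show "leaves T S' = B" unfolding S'_def using cut_complete(2)[of B] meets by blast
  qed
  \<comment> \<open>A vertex lies on many rays. That the ray chosen does not matter is shown in
    \<open>phi\<close>: \<open>tiso\<close> preserves coincidence of rays at each depth.\<close>
  define \<phi> where "\<phi> = (\<lambda>x\<in>?F. SOME y. \<exists>v\<in>?L. \<exists>r\<in>thr v. \<exists>k. x = r (lev v + k) \<and> y = F r (lev (g v) + k))"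
  have phi: "\<phi> (r (lev v + k)) = F r (lev (g v) + k)" if v: "v \<in> ?L" "r \<in> thr v" for v r k
  proof -
    let ?P = "\<lambda>y. \<exists>v'\<in>?L. \<exists>r'\<in>thr v'. \<exists>k'. r (lev v + k) = r' (lev v' + k') \<and> y = F r' (lev (g v') + k')"
    have "?P (F r (lev (g v) + k))" using v by blast
    then have "?P (SOME y. ?P y)" by (rule someI[of ?P])
    moreover have "r (lev v + k) \<in> ?F" using thr_forest v by blast
    ultimately have "?P (\<phi> (r (lev v + k)))" by (simp add: \<phi>_def)
    then obtain v' r' k' where *: "v' \<in> ?L" "r' \<in> thr v'" "r (lev v + k) = r' (lev v' + k')"
      "\<phi> (r (lev v + k)) = F r' (lev (g v') + k')" by blast
    have "v = v'" using leaf_unique[OF S v(1) *(1) thr_desc[OF v(2), of k]] thr_desc[OF *(2), of k'] * by simp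
    moreover have "lev v + k = lev v' + k'" using bd_lev *(2,3) v(2) by (metis thr_iff)
    ultimately have "v' = v" "k' = k" by auto
    with * show ?thesis using tiso_iff[OF g[OF v(1)], of r r' k] v by simp
  qed
  have rep: "\<exists>v\<in>?L. \<exists>r\<in>thr v. \<exists>k. r (lev v + k) = x \<and> r \<in> thr x" if xF: "x \<in> ?F" for x
  proof -
    obtain v where v: "v \<in> ?L" "x \<in> desc v" using xF by (auto simp: forest_verts_def)
    obtain r where r: "r \<in> thr x" using thr_nonempty desc_V v by blast
    have "lev v \<le> lev x" using desc_lev[OF v(2)] by auto
    then have "r (lev v + (lev x - lev v)) = x" using r by (simp add: thr_iff)
    moreover have "r \<in> thr v" using thr_mono[OF v(2)] r by blast
    ultimately show ?thesis using v r by blast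
  qed
  have lev_phi: "F r \<in> bd \<and> lev (F r (lev (g v) + k)) = lev (g v) + k \<and> F r (lev (g v) + k) \<in> desc (g v)"
    if "v \<in> ?L" "r \<in> thr v" for v r k
    using tiso_thr[OF g that(2)] that(1) bd_lev thr_desc by (simp add: thr_iff)
  have ch1: "\<phi> y \<in> ch (\<phi> x) \<and> A (\<phi> y) = A y" if x: "x \<in> ?F" "y \<in> ch x" for x y
  proof -
    obtain v where v: "v \<in> ?L" "x \<in> desc v" using x(1) by (auto simp: forest_verts_def)
    define k where "k = lev x - lev v"
    have k: "lev x = lev v + k" using desc_lev[OF v(2)] by (auto simp: k_def)
    obtain r where r: "r \<in> thr y" using thr_nonempty ch_D(2) x by blast
    have ry: "r (lev v + Suc k) = y" using r ch_D(3)[OF x(2)] k by (simp add: thr_iff)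
    have yd: "y \<in> desc x" using desc_child[OF desc_refl x(2)] ch_D(1)[OF x(2)] by blast
    have "r \<in> thr x" using thr_mono[OF yd] r by blast
    then have rx: "r (lev v + k) = x" "r \<in> thr v" using k thr_mono[OF v(2)] by (auto simp: thr_iff)
    show ?thesis
      using phi[OF v(1) rx(2), of k] phi[OF v(1) rx(2), of "Suc k"] rx ry lev_phi[OF v(1) rx(2)]
        bd_Suc[of "F r" "lev (g v) + k"] tiso_col[OF g[OF v(1)] rx(2), of k] by simp
  qed
  have lf: "\<phi> v = g v" if vL: "v \<in> ?L" for v
  proof -
    obtain r where r: "r \<in> thr v" using thr_nonempty tiso_V[OF g[OF vL]] by blast
    have "F r \<in> thr (g v)" using tiso_thr[OF g[OF vL] r] .
    then show ?thesis using phi[OF vL r, of 0] r by (simp add: thr_iff)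
  qed
  have inj: "x = y" if xy: "x \<in> ?F" "y \<in> ?F" "\<phi> x = \<phi> y" for x y
  proof -
    obtain v r k where x: "v \<in> ?L" "r \<in> thr v" "r (lev v + k) = x" using rep[OF xy(1)] by blast
    obtain u s j where y: "u \<in> ?L" "s \<in> thr u" "s (lev u + j) = y" using rep[OF xy(2)] by blast
    have px: "\<phi> x = F r (lev (g v) + k)" and py: "\<phi> y = F s (lev (g u) + j)"
      using phi x y by blast+
    have "\<phi> x \<in> desc (g v)" "\<phi> x \<in> desc (g u)"
      using lev_phi[OF x(1,2), of k] lev_phi[OF y(1,2), of j] px py xy(3) by metis+
    then have uv: "u = v" using anti[OF x(1) y(1)] by metis
    have "k = j" using lev_phi[OF x(1,2), of k] lev_phi[OF y(1,2), of j] xy(3) px py uv by simp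
    then show ?thesis using tiso_iff[OF g[OF x(1)] x(2), of s k] px py xy(3) uv x y by simp
  qed
  have surj: "z \<in> \<phi> ` ?F" if z: "v \<in> ?L" "z \<in> desc (g v)" for v z
  proof -
    obtain s where s: "s \<in> thr z" using thr_nonempty desc_V z by blast
    then have "s \<in> thr (g v)" using thr_mono z by blast
    then obtain r where r: "r \<in> thr v" "s = F r" using tiso_surj[OF g] z by blast
    define k where "k = lev z - lev (g v)"
    have "lev z = lev (g v) + k" using desc_lev[OF z(2)] by (auto simp: k_def)
    then have "z = \<phi> (r (lev v + k))" using phi[OF z(1) r(1), of k] s r by (simp add: thr_iff)
    then show ?thesis using thr_forest[OF z(1) r(1)] by blast
  qed
  have im: "\<phi> ` ?F = forest_verts T S'"
  proof
    show "\<phi> ` ?F \<subseteq> forest_verts T S'"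
    proof
      fix z assume "z \<in> \<phi> ` ?F"
      then obtain x where x: "x \<in> ?F" "z = \<phi> x" by blast
      obtain v r k where v: "v \<in> ?L" "r \<in> thr v" "r (lev v + k) = x" using rep[OF x(1)] by blast
      then have "z \<in> desc (g v)" using lev_phi[OF v(1,2), of k] phi[OF v(1,2), of k] x by simp
      then show "z \<in> forest_verts T S'" using v S' by (auto simp: forest_verts_def B_def)
    qed
    show "forest_verts T S' \<subseteq> \<phi> ` ?F"
      using surj S' by (auto simp: forest_verts_def B_def)
  qed
  have ch2: "\<phi> ` ch x = ch (\<phi> x)" if x: "x \<in> ?F" for x
  proof
    show "\<phi> ` ch x \<subseteq> ch (\<phi> x)" using ch1 x by blast
    show "ch (\<phi> x) \<subseteq> \<phi> ` ch x"
    proof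
      fix z assume z: "z \<in> ch (\<phi> x)"
      have "\<phi> x \<in> forest_verts T S'" using im x by blast
      then have "z \<in> forest_verts T S'" using z forest_child by blast
      then obtain y where y: "y \<in> ?F" "z = \<phi> y" using im by blast
      \<comment> \<open>A forest vertex in \<open>S\<close> is a leaf; its image \<open>z\<close>
        would be a leaf of \<open>S'\<close>, whereas \<open>z\<close> is a child of a forest vertex
        and so lies outside \<open>S'\<close>.\<close>
      have "y \<notin> S"
      proof
        assume "y \<in> S"
        then have "y \<in> ?L" using y forest_iff[OF S] by blast
        then have "z \<in> leaves T S'" using lf y S' by (simp add: B_def)
        moreover have "z \<notin> S'" using forest_child_notin[OF S'(1) \<open>\<phi> x \<in> _\<close> z] .
        ultimately show False using leaf_D by blast
      qed
      then have "y \<noteq> rt" using S by (auto simp: complete_subtree_iff)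
      then obtain p where p: "y \<in> ch p" using parent_ex forest_V y by blast
      have pF: "p \<in> ?F" using forest_parent[OF S y(1) \<open>y \<notin> S\<close> p] .
      have "\<phi> y \<in> ch (\<phi> p)" using ch1[OF pF p] by blast
      then have "\<phi> p = \<phi> x" using parent_unique z y by blast
      then have "p = x" using inj pF x by blast
      then show "z \<in> \<phi> ` ch x" using p y by blast
    qed
  qed
  have bijphi: "bij_betw \<phi> ?F (forest_verts T S')" using inj im by (auto simp: bij_betw_def inj_on_def)
  have "{x, y} \<in> E \<longleftrightarrow> {\<phi> x, \<phi> y} \<in> E" if xy: "x \<in> ?F" "y \<in> ?F" for x y
  proof -
    have "b \<in> ch a \<longleftrightarrow> \<phi> b \<in> ch (\<phi> a)" if ab: "a \<in> ?F" "b \<in> ?F" for a b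
    proof
      assume "\<phi> b \<in> ch (\<phi> a)"
      then obtain c where c: "c \<in> ch a" "\<phi> b = \<phi> c" using ch2[OF ab(1)] by blast
      then show "b \<in> ch a" using inj[OF ab(2), of c] forest_child ab by blast
    qed (use ch1 ab in blast)
    then show ?thesis using xy by (simp add: edge_iff)
  qed
  then have h: "(S, \<phi>, S') \<in> honest_auts T"
    using S S' bijphi by (simp add: honest_iff \<phi>_def)
  have "bmap (S, \<phi>, S') = F"
  proof (rule extensionalityI[OF bmap_ext])
    show "F \<in> extensional bd" using F by (simp add: local_iso_def)
    fix r assume r: "r \<in> bd"
    obtain v where v: "v \<in> ?L" "r \<in> thr v" using bd_meets_leaf[OF S r] by blast
    have "bd_lim S \<phi> r (F r)"
      unfolding bd_lim_def using lev_phi[OF v] phi[OF v] thr_forest[OF v]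
      by (intro conjI exI[of _ "lev v"] exI[of _ "lev (g v)"]) auto
    then show "bmap (S, \<phi>, S') r = F r" using bmap_eqI r by blast
  qed
  moreover have "leaves T S' = \<phi> ` ?L" using S' lf by (simp add: B_def)
  ultimately show ?thesis by (intro that[OF h]) (simp_all add: ch1 ch2)
qed

text \<open>If the maps are controlled \<open>n\<close> and \<open>m\<close> levels down a ray,
  level \<open>n + m\<close> serves both. A shared subtree is what makes representatives
  composable.\<close>

lemma local_iso_common:
  assumes "F \<in> local_iso A" "G \<in> local_iso A"
  shows "\<exists>S. complete_subtree T S \<and> (\<forall>v\<in>leaves T S. (\<exists>w. tiso A F v w) \<and> (\<exists>w. tiso A G v w))"
proof -
  define B where "B = {v. (\<exists>w. tiso A F v w) \<and> (\<exists>w. tiso A G v w)}"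
  have "\<exists>n. r n \<in> B" if r: "r \<in> bd" for r
  proof -
    obtain n w m u where "tiso A F (r n) w" "tiso A G (r m) u"
      using assms r unfolding local_iso_def by blast
    then have "tiso A F (r (n + m)) (F r (lev w + m))" "tiso A G (r (m + n)) (G r (lev u + n))"
      using tiso_desc[OF _ thr_self[OF r]] bd_lev[OF r] by metis+
    then have "r (n + m) \<in> B" unfolding B_def by (auto simp: add.commute)
    then show ?thesis by blast
  qed
  then have "complete_subtree T (cut B)" "leaves T (cut B) \<subseteq> B" using cut_complete[of B] by auto
  then show ?thesis by (auto simp: B_def)
qed

end

section \<open>The group of almost automorphisms\<close>

context branching_tree
begin

lemma bmap_honest_inv:
  assumes h: "x \<in> honest_auts T"
  shows "bmap (honest_inv x) = bd_inv (bmap x)"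
proof (rule extensionalityI[OF bmap_ext])
  obtain S \<phi> S' where x: "x = (S, \<phi>, S')" by (cases x) auto
  note bij = bmap_bij[OF h]
  fix r assume r: "r \<in> bd"
  have "bmap (honest_inv x) r = bmap (honest_inv x) (bmap x (bd_inv (bmap x) r))"
    using bd_inv(3)[OF bij r] by simp
  also have "\<dots> = bd_inv (bmap x) r"
    using bmap_inv[of S \<phi> S' "bd_inv (bmap x) r"] h x bd_inv(4)[OF bij r] by simp
  finally show "bmap (honest_inv x) r = bd_inv (bmap x) r" .
qed (simp add: bd_inv_def)

definition cls :: "((nat \<Rightarrow> 'a) \<Rightarrow> (nat \<Rightarrow> 'a)) \<Rightarrow> 'a honest_aut set" where
  "cls F = {x \<in> honest_auts T. bmap x = F}"

lemma cls_nonempty: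
  assumes F: "F \<in> local_iso A" shows "\<exists>x. x \<in> cls F"
proof -
  obtain S where "complete_subtree T S" "\<And>v. v \<in> leaves T S \<Longrightarrow> \<exists>w. tiso A F v w"
    using local_iso_common[OF F F] by blast
  then obtain \<phi> S' where "(S, \<phi>, S') \<in> honest_auts T" "bmap (S, \<phi>, S') = F"
    by (rule local_iso_realize[OF F])
  then show ?thesis by (auto simp: cls_def)
qed

lemma cls_inj: "inj_on cls (local_iso A)"
proof (rule inj_onI)
  fix F G assume "F \<in> local_iso A" "G \<in> local_iso A" "cls F = cls G"
  then obtain x where "x \<in> cls F" "x \<in> cls G" using cls_nonempty by blast
  then show "F = G" by (simp add: cls_def)
qed

lemma equiv_Image: "x \<in> honest_auts T \<Longrightarrow> aaut_equiv T `` {x} = cls (bmap x)"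
  by (auto simp: equiv_iff cls_def)

abbreviation "boundary_isos \<equiv> local_iso (\<lambda>_::'a. ())"

lemma carrier_AAut: "carrier (AAut T) = cls ` boundary_isos"
proof
  have "carrier (AAut T) = (\<lambda>x. aaut_equiv T `` {x}) ` honest_auts T"
    by (auto simp: AAut_def quotient_def)
  then have eq: "carrier (AAut T) = cls ` bmap ` honest_auts T"
    by (simp add: image_image equiv_Image)
  show "carrier (AAut T) \<subseteq> cls ` boundary_isos" unfolding eq using honest_local_iso by blast
  show "cls ` boundary_isos \<subseteq> carrier (AAut T)"
  proof
    fix X assume "X \<in> cls ` boundary_isos"
    then obtain F where F: "F \<in> boundary_isos" "X = cls F" by blast
    then obtain x where "x \<in> honest_auts T" "bmap x = F" using cls_nonempty[OF F(1)] by (auto simp: cls_def)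
    then show "X \<in> carrier (AAut T)" unfolding eq using F by blast
  qed
qed

text \<open>All matching pairs give the same class, so the union in the definition collapses as soon
  as one pair exists. Such a pair comes from realizing \<open>F\<close> and the inverse of
  \<open>G\<close> on the same \<open>S\<close> and inverting the second: then \<open>S\<close> is
  the domain side of the outer factor and the image side of the inner one.\<close>

lemma mult_AAut:
  assumes F: "F \<in> boundary_isos" and G: "G \<in> boundary_isos"
  shows "cls F \<otimes>\<^bsub>AAut T\<^esub> cls G = cls (compose bd F G)"
proof -
  let ?M = "{aaut_equiv T `` {(R, compose (forest_verts T R) \<phi> \<psi>, S')} | R S S' \<phi> \<psi>.
      (S, \<phi>, S') \<in> cls F \<and> (R, \<psi>, S) \<in> cls G}"
  have one: "aaut_equiv T `` {(R, compose (forest_verts T R) \<phi> \<psi>, S')} = cls (compose bd F G)"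
    if "(S, \<phi>, S') \<in> cls F" "(R, \<psi>, S) \<in> cls G" for R S S' \<phi> \<psi>
  proof -
    have h: "(S, \<phi>, S') \<in> honest_auts T" "(R, \<psi>, S) \<in> honest_auts T"
      and b: "bmap (S, \<phi>, S') = F" "bmap (R, \<psi>, S) = G"
      using that by (auto simp: cls_def)
    show ?thesis using equiv_Image[OF honest_comp[OF h]] bmap_comp[OF h] b by simp
  qed
  obtain S where S: "complete_subtree T S"
    "\<And>v. v \<in> leaves T S \<Longrightarrow> \<exists>w. tiso (\<lambda>_. ()) F v w"
    "\<And>v. v \<in> leaves T S \<Longrightarrow> \<exists>w. tiso (\<lambda>_. ()) (bd_inv G) v w"
    using local_iso_common[OF F local_iso_inv[OF G]] by blast
  obtain \<phi> S' where "(S, \<phi>, S') \<in> honest_auts T" "bmap (S, \<phi>, S') = F"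
    by (rule local_iso_realize[OF F S(1,2)])
  then have 1: "(S, \<phi>, S') \<in> cls F" by (simp add: cls_def)
  obtain \<theta> R where 2: "(S, \<theta>, R) \<in> honest_auts T" "bmap (S, \<theta>, R) = bd_inv G"
    by (rule local_iso_realize[OF local_iso_inv[OF G] S(1,3)])
  obtain \<psi> where 3: "honest_inv (S, \<theta>, R) = (R, \<psi>, S)" by (simp add: honest_inv_def)
  note bij = local_iso_bij[OF G]
  have "bd_inv (bd_inv G) = G"
  proof (rule extensionalityI)
    fix r assume r: "r \<in> bd"
    have "bd_inv (bd_inv G) (bd_inv G (G r)) = G r"
      using bd_inv(2)[OF bd_inv(1)[OF bij], of "G r"] r bij_betw_apply[OF bij r] by simp
    then show "bd_inv (bd_inv G) r = G r" using bd_inv(2)[OF bij r] by simp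
  qed (use G in \<open>auto simp: bd_inv_def local_iso_def\<close>)
  then have "bmap (R, \<psi>, S) = G" using bmap_honest_inv[OF 2(1)] 2(2) 3 by simp
  moreover have "(R, \<psi>, S) \<in> honest_auts T" using honest_inv[OF 2(1)] 3 by simp
  ultimately have "(R, \<psi>, S) \<in> cls G" by (simp add: cls_def)
  then have "?M \<noteq> {}" using 1 by blast
  moreover have "?M \<subseteq> {cls (compose bd F G)}" using one by blast
  ultimately have "?M = {cls (compose bd F G)}" by blast
  then show ?thesis by (simp add: AAut_def)
qed

lemma one_AAut: "\<one>\<^bsub>AAut T\<^esub> = cls (\<lambda>r\<in>bd. r)"
proof -
  let ?e = "({rt}, \<lambda>x\<in>forest_verts T {rt}. x, {rt})"
  have h: "?e \<in> honest_auts T"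
    by (auto simp: honest_iff complete_root bij_betw_def inj_on_def)
  have leaf: "leaves T {rt} = {rt}" using ch_D(5) by (fastforce simp: leaves_def)
  have "bmap ?e = (\<lambda>r\<in>bd. r)"
  proof (rule extensionalityI[OF bmap_ext])
    fix r assume r: "r \<in> bd"
    then have "r \<in> thr rt" by (simp add: thr_iff bd_0 lev_root)
    then have F: "r (0 + k) \<in> forest_verts T {rt}" for k
      using thr_forest[of rt "{rt}" r k] leaf lev_root by simp
    have "bd_lim {rt} (\<lambda>x\<in>forest_verts T {rt}. x) r r"
      using r F by (intro bd_limI[where n = 0 and m = 0]) simp_all
    then show "bmap ?e r = (\<lambda>r\<in>bd. r) r" using bmap_eqI r by simp
  qed simp
  then show ?thesis using equiv_Image[OF h] by (simp add: AAut_def)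
qed

lemma compose_bd_assoc: "G \<in> local_iso A \<Longrightarrow> H \<in> local_iso A \<Longrightarrow> F \<in> local_iso A \<Longrightarrow>
    compose bd (compose bd F G) H = compose bd F (compose bd G H)"
  using compose_assoc[of H bd bd F G] local_iso_bij bij_betw_imp_funcset by metis

lemma compose_bd_inv: "F \<in> local_iso A \<Longrightarrow> compose bd (bd_inv F) F = (\<lambda>r\<in>bd. r)"
  using bd_inv(2)[OF local_iso_bij] by (fastforce simp: compose_def)

lemma compose_id: "F \<in> local_iso A \<Longrightarrow> compose bd (\<lambda>r\<in>bd. r) F = F"
  using bij_betw_apply[OF local_iso_bij]
  by (intro extensionalityI[of _ bd]) (auto simp: compose_def local_iso_def)

lemma group_AAut: "group (AAut T)"
proof (rule groupI)
  fix x y assume "x \<in> carrier (AAut T)" "y \<in> carrier (AAut T)"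
  then show "x \<otimes>\<^bsub>AAut T\<^esub> y \<in> carrier (AAut T)"
    by (auto simp: carrier_AAut mult_AAut intro!: imageI local_iso_comp)
next
  show "\<one>\<^bsub>AAut T\<^esub> \<in> carrier (AAut T)"
    unfolding one_AAut carrier_AAut using local_iso_id by blast
next
  fix x y z assume "x \<in> carrier (AAut T)" "y \<in> carrier (AAut T)" "z \<in> carrier (AAut T)"
  then show "x \<otimes>\<^bsub>AAut T\<^esub> y \<otimes>\<^bsub>AAut T\<^esub> z = x \<otimes>\<^bsub>AAut T\<^esub> (y \<otimes>\<^bsub>AAut T\<^esub> z)"
    by (auto simp: carrier_AAut mult_AAut local_iso_comp compose_bd_assoc)
next
  fix x assume "x \<in> carrier (AAut T)"
  then obtain F where F: "F \<in> boundary_isos" "x = cls F" by (auto simp: carrier_AAut)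
  then show "\<one>\<^bsub>AAut T\<^esub> \<otimes>\<^bsub>AAut T\<^esub> x = x"
    by (simp add: one_AAut mult_AAut local_iso_id compose_id)
  show "\<exists>y\<in>carrier (AAut T). y \<otimes>\<^bsub>AAut T\<^esub> x = \<one>\<^bsub>AAut T\<^esub>"
    using F by (intro bexI[of _ "cls (bd_inv F)"])
      (simp_all add: one_AAut carrier_AAut mult_AAut local_iso_inv compose_bd_inv)
qed

lemma subgroup_cls: "subgroup (cls ` local_iso A) (AAut T)"
proof -
  interpret group "AAut T" by (rule group_AAut)
  have sub: "local_iso A \<subseteq> boundary_isos" using local_iso_mono by blast
  show ?thesis
  proof (rule subgroupI)
    show "cls ` local_iso A \<subseteq> carrier (AAut T)" using sub by (auto simp: carrier_AAut)
    show "cls ` local_iso A \<noteq> {}" using local_iso_id by blast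
    fix x assume x: "x \<in> cls ` local_iso A"
    then obtain F where F: "F \<in> local_iso A" "x = cls F" by blast
    have F': "bd_inv F \<in> local_iso A" using local_iso_inv F by blast
    have "cls (bd_inv F) \<otimes>\<^bsub>AAut T\<^esub> x = \<one>\<^bsub>AAut T\<^esub>"
      using F F' sub by (simp add: one_AAut mult_AAut compose_bd_inv subset_iff)
    then have "inv\<^bsub>AAut T\<^esub> x = cls (bd_inv F)"
      using F F' sub by (intro inv_equality) (auto simp: carrier_AAut)
    then show "inv\<^bsub>AAut T\<^esub> x \<in> cls ` local_iso A" using F' by simp
    fix y assume "y \<in> cls ` local_iso A"
    then show "x \<otimes>\<^bsub>AAut T\<^esub> y \<in> cls ` local_iso A"
      using F sub by (auto simp: mult_AAut subset_iff intro!: imageI local_iso_comp)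
  qed
qed

end

section \<open>Label-preserving almost automorphisms\<close>

locale labelled_tree = branching_tree T for T :: "'v rooted_graph" +
  fixes lt :: "'v \<Rightarrow> 'v rel" and D :: "'d set" and l :: "'v \<Rightarrow> 'd"
  assumes plane: "plane_order T lt"
    and labelled: "labelling T D l"
    and compat: "compatible_labelling T lt l"
    and spanning: "\<forall>d\<in>D. spanned_by T (label_class T l d)"
begin

section \<open>Ranks of siblings\<close>

definition par :: "'v \<Rightarrow> 'v" where
  "par y = (THE p. y \<in> ch p)"

lemma par_eq: "y \<in> ch p \<Longrightarrow> par y = p"
  unfolding par_def using parent_unique by blast

text \<open>The rank among the siblings, counted from 0 like the list positions in
  \<open>compatible_labelling\<close>.\<close>

definition idx :: "'v \<Rightarrow> nat" where
  "idx y = card {z. (z, y) \<in> lt (par y)}"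

lemma lt_props:
  assumes "v \<in> V"
  shows "(a, b) \<in> lt v \<Longrightarrow> a \<in> ch v \<and> b \<in> ch v" "(a, a) \<notin> lt v"
    "(a, b) \<in> lt v \<Longrightarrow> (b, c) \<in> lt v \<Longrightarrow> (a, c) \<in> lt v"
    "a \<in> ch v \<Longrightarrow> b \<in> ch v \<Longrightarrow> a \<noteq> b \<Longrightarrow> (a, b) \<in> lt v \<or> (b, a) \<in> lt v"
proof -
  have p: "lt v \<subseteq> ch v \<times> ch v" "trans (lt v)" "irrefl (lt v)" "total_on (ch v) (lt v)"
    using plane assms by (auto simp: plane_order_def strict_linear_order_on_def)
  show "(a, b) \<in> lt v \<Longrightarrow> a \<in> ch v \<and> b \<in> ch v" using p(1) by blast
  show "(a, a) \<notin> lt v" using p(3) by (simp add: irrefl_def)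
  show "(a, b) \<in> lt v \<Longrightarrow> (b, c) \<in> lt v \<Longrightarrow> (a, c) \<in> lt v" using p(2) by (rule transD)
  show "a \<in> ch v \<Longrightarrow> b \<in> ch v \<Longrightarrow> a \<noteq> b \<Longrightarrow> (a, b) \<in> lt v \<or> (b, a) \<in> lt v"
    using p(4) by (auto simp: total_on_def)
qed

lemma idx_less:
  assumes "(a, b) \<in> lt v" "v \<in> V" shows "idx a < idx b"
proof -
  note lt = lt_props[OF assms(2)]
  have ab: "a \<in> ch v" "b \<in> ch v" using lt(1) assms by auto
  have "{z. (z, a) \<in> lt v} \<subset> {z. (z, b) \<in> lt v}" using lt(2,3) assms(1) by blast
  moreover have "finite {z. (z, b) \<in> lt v}" using lt(1) finite_ch[of v] by (auto intro: finite_subset)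
  ultimately show ?thesis using ab by (simp add: idx_def par_eq psubset_card_mono)
qed

lemma idx_less_iff: "a \<in> ch v \<Longrightarrow> b \<in> ch v \<Longrightarrow> (a, b) \<in> lt v \<longleftrightarrow> idx a < idx b"
  using idx_less[of a b v] idx_less[of b a v] lt_props(4)[of v a b] ch_D(1)[of a v] by fastforce

lemma idx_inj: "a \<in> ch v \<Longrightarrow> b \<in> ch v \<Longrightarrow> idx a = idx b \<Longrightarrow> a = b"
  using idx_less_iff lt_props(4)[of v a b] ch_D(1)[of a v] by (metis less_irrefl)

lemma idx_nth:
  assumes "increasing_children T lt v vs" "v \<in> V" "i < length vs"
  shows "idx (vs ! i) = i"
proof -
  note lt = lt_props[OF assms(2)]
  have vs: "set vs = ch v" "\<And>i j. i < j \<Longrightarrow> j < length vs \<Longrightarrow> (vs ! i, vs ! j) \<in> lt v"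
    using assms by (auto simp: increasing_children_def sorted_wrt_iff_nth_less)
  have iff: "(vs ! j, vs ! i) \<in> lt v \<longleftrightarrow> j < i" if "j < length vs" for j
  proof (cases i j rule: linorder_cases)
    case less
    then show ?thesis using vs(2)[OF less that] lt(2)[of "vs ! i"] lt(3)[of "vs ! i" "vs ! j" "vs ! i"] by auto
  next
    case greater
    then show ?thesis using vs(2)[OF greater assms(3)] by simp
  qed (simp add: lt(2))
  have "{z. (z, vs ! i) \<in> lt v} = (!) vs ` {..<i}"
  proof
    show "{z. (z, vs ! i) \<in> lt v} \<subseteq> (!) vs ` {..<i}"
    proof
      fix z assume "z \<in> {z. (z, vs ! i) \<in> lt v}"
      then have z: "(z, vs ! i) \<in> lt v" by simp
      then have "z \<in> set vs" using lt(1) vs(1) by blast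
      then obtain j where "j < length vs" "z = vs ! j" by (auto simp: in_set_conv_nth)
      then show "z \<in> (!) vs ` {..<i}" using iff z by simp
    qed
  qed (use vs(2) assms(3) in auto)
  moreover have "inj_on ((!) vs) {..<i}"
  proof (rule linorder_inj_onI)
    fix j k assume "j < k" "k \<in> {..<i}"
    then show "vs ! j \<noteq> vs ! k" using vs(2)[of j k] lt(2) assms(3) by (metis lessThan_iff less_trans)
  qed auto
  ultimately have "card {z. (z, vs ! i) \<in> lt v} = i" by (simp add: card_image)
  moreover have "vs ! i \<in> ch v" using vs(1) assms(3) nth_mem by blast
  ultimately show ?thesis by (simp add: idx_def par_eq)
qed

text \<open>Compatibility freed from lists: ranks in the two increasing enumerations are list
  positions.\<close>

lemma child_matching:
  assumes "v \<in> V" "v \<noteq> rt" "w \<in> V" "w \<noteq> rt" "l v = l w" "a \<in> ch v"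
  shows "\<exists>b\<in>ch w. idx b = idx a \<and> l b = l a"
proof -
  obtain vs ws where vw: "increasing_children T lt v vs" "increasing_children T lt w ws"
    "length vs = length ws" "\<forall>i<length vs. l (vs ! i) = l (ws ! i)"
    using compat assms unfolding compatible_labelling_def by blast
  have "a \<in> set vs" using vw(1) assms(6) by (simp add: increasing_children_def)
  then obtain i where i: "i < length vs" "a = vs ! i" by (metis in_set_conv_nth)
  have "ws ! i \<in> ch w" using vw i nth_mem[of i ws] by (simp add: increasing_children_def)
  then show ?thesis using idx_nth[OF vw(1) assms(1) i(1)] idx_nth[OF vw(2) assms(3), of i] i vw by auto
qed

text \<open>An order-preserving surjection between strict linear orders is injective and reflects
  the order, so it carries the predecessors of \<open>a\<close> bijectively onto those of
  \<open>\<phi> a\<close>.\<close>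

lemma idx_order_preserving:
  assumes v: "v \<in> V" "w \<in> V" "\<phi> ` ch v = ch w"
    and ord: "\<And>a b. (a, b) \<in> lt v \<Longrightarrow> (\<phi> a, \<phi> b) \<in> lt w" and a: "a \<in> ch v"
  shows "idx (\<phi> a) = idx a"
proof -
  note ltv = lt_props[OF v(1)] and ltw = lt_props[OF v(2)]
  have inj: "inj_on \<phi> (ch v)"
    by (rule inj_onI) (metis ltv(4) ltw(2) ord)
  have "{z. (z, \<phi> a) \<in> lt w} = \<phi> ` {z. (z, a) \<in> lt v}"
  proof
    show "{z. (z, \<phi> a) \<in> lt w} \<subseteq> \<phi> ` {z. (z, a) \<in> lt v}"
    proof
      fix z assume "z \<in> {z. (z, \<phi> a) \<in> lt w}"
      then have z: "(z, \<phi> a) \<in> lt w" by simp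
      then obtain y where y: "y \<in> ch v" "z = \<phi> y" using ltw(1) v(3) by blast
      have "(a, y) \<notin> lt v" using ord[of a y] z y ltw(2,3) by blast
      moreover have "y \<noteq> a" using z y ltw(2) by blast
      ultimately show "z \<in> \<phi> ` {z. (z, a) \<in> lt v}" using ltv(4)[OF y(1) a] y by blast
    qed
  qed (use ord in blast)
  moreover have "inj_on \<phi> {z. (z, a) \<in> lt v}"
    using inj ltv(1) by (auto intro: inj_on_subset)
  moreover have "\<phi> a \<in> ch w" using a v(3) by blast
  ultimately show ?thesis using a by (simp add: idx_def par_eq card_image)
qed

text \<open>The colour of a child of the root is the vertex itself, so that a colour-preserving map can
  only match the root with the root, and then acts trivially.\<close>

definition col :: "'v \<Rightarrow> 'v + 'd \<times> nat" where
  "col y = (if par y = rt then Inl y else Inr (l (par y), idx y))"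

lemma leaf_root: "complete_subtree T S \<Longrightarrow> rt \<in> leaves T S \<Longrightarrow> S = {rt}"
proof -
  assume S: "complete_subtree T S" and r: "rt \<in> leaves T S"
  have "x = rt" if x: "x \<in> S" for x
  proof -
    have "x \<in> desc rt" using desc_root x S by (auto simp: complete_subtree_iff)
    then show ?thesis
    proof (cases rule: desc_cases)
      case (2 p)
      then have "p \<in> forest_verts T S" using r by (auto simp: forest_verts_def)
      then show ?thesis using forest_child_notin[OF S _ 2(1)] x by blast
    qed
  qed
  then show "S = {rt}" using leaf_D[OF r] by blast
qed

lemma leaves_root: "leaves T {rt} = {rt}"
  using ch_D(5) by (fastforce simp: leaves_def)

text \<open>If both removed subtrees are just the root, preservation of ranks makes
  \<open>\<phi>\<close> the identity. Otherwise the equality of labels at the leaves propagates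
  downwards by compatibility, the child to compare with being identified by its rank.\<close>

lemma label_preserving_local_iso:
  assumes h: "x \<in> honest_auts T" and lp: "label_preserving T lt l x"
  shows "bmap x \<in> local_iso col"
proof -
  obtain S \<phi> S' where x: "x = (S, \<phi>, S')" by (cases x) auto
  let ?F = "forest_verts T S"
  have S: "complete_subtree T S" using h x by (simp add: honest_iff)
  have ch: "\<phi> ` ch v = ch (\<phi> v)" if "v \<in> ?F" for v
    using lp that by (auto simp: label_preserving_def x)
  have idx: "idx (\<phi> y) = idx y" if v: "v \<in> ?F" "y \<in> ch v" for v y
    using idx_order_preserving[OF forest_V[OF v(1)] honest_V(1)[of S \<phi> S' v] ch[OF v(1)] _ v(2)] lp h v(1)
    by (auto simp: label_preserving_def x)
  have chm: "\<phi> y \<in> ch (\<phi> v)" if "v \<in> ?F" "y \<in> ch v" for v y using ch that by blast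
  have col: "col (\<phi> y) = col y" if z: "z \<in> ?F" "y \<in> ch z" for y z
  proof (cases "S = {rt} \<and> S' = {rt}")
    case True
    have Fr: "rt \<in> ?F" using True root_in by (auto simp: forest_verts_def leaves_root desc_refl)
    \<comment> \<open>If the root were moved, the preimage of the root would have a parent, whose
      image would have the root as a child.\<close>
    have p0: "\<phi> rt = rt"
    proof (rule ccontr)
      assume n: "\<phi> rt \<noteq> rt"
      have bij: "\<phi> ` ?F = forest_verts T S'" using h x by (auto simp: honest_iff bij_betw_def)
      then have "rt \<in> \<phi> ` ?F" using Fr True by simp
      then obtain u where u: "u \<in> ?F" "\<phi> u = rt" by force
      then obtain p where p: "u \<in> ch p" using parent_ex forest_V n by metis
      have "p \<in> ?F" using True desc_root ch_D(1)[OF p] by (auto simp: forest_verts_def leaves_root)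
      then show False using chm[OF _ p] u ch_D(5) by blast
    qed
    have "\<phi> u = u" if "u \<in> desc rt" for u
      using that
    proof (induction rule: desc_induct)
      case (step y u)
      have "y \<in> ?F" using True step by (auto simp: forest_verts_def leaves_root)
      then show ?case using idx_inj[of "\<phi> u" y u] chm[of y u] idx[of y u] step by auto
    qed (rule p0)
    then show ?thesis using desc_root ch_D(2)[OF z(2)] by simp
  next
    case False
    then have leaf: "\<And>v. v \<in> leaves T S \<Longrightarrow> v \<noteq> rt \<and> \<phi> v \<noteq> rt \<and> l v = l (\<phi> v)"
      using lp by (auto simp: label_preserving_def x)
    obtain v where v: "v \<in> leaves T S" "z \<in> desc v" using z(1) by (auto simp: forest_verts_def)
    from v(2) have "z \<noteq> rt \<and> \<phi> z \<noteq> rt \<and> l z = l (\<phi> z)"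
    proof (induction rule: desc_induct)
      case base
      show ?case using leaf v by blast
    next
      case (step y u)
      have yF: "y \<in> ?F" using step v by (auto simp: forest_verts_def)
      have V: "\<phi> y \<in> V" "y \<in> V" using honest_V(1)[of S \<phi> S' y] forest_V[OF yF] h x yF by auto
      obtain b where b: "b \<in> ch (\<phi> y)" "idx b = idx u" "l b = l u"
        using child_matching[of y "\<phi> y" u] step V by blast
      have "b = \<phi> u" using idx_inj[OF b(1) chm[OF yF step.hyps(2)]] idx[OF yF step.hyps(2)] b by simp
      then show ?case using b ch_D(5)[OF step.hyps(2)] ch_D(5)[OF b(1)] by simp
    qed
    then show ?thesis using par_eq[OF z(2)] par_eq[OF chm[OF z]] idx[OF z] by (simp add: col_def)
  qed
  have "\<exists>n w. tiso col (bmap x) (r n) w" if r: "r \<in> bd" for r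
  proof -
    obtain v where v: "v \<in> leaves T S" "r \<in> thr v" using bd_meets_leaf[OF S r] by blast
    have dF: "z \<in> ?F" if "z \<in> desc v" for z using that v by (auto simp: forest_verts_def)
    have "pres S \<phi> v" using dF ch desc_refl[OF thr_V[OF v(2)]] by (simp add: pres_def)
    then have "tiso col (bmap x) v (\<phi> v)"
      using honest_tiso[of S \<phi> S' v col] h x col dF by blast
    moreover have "r (lev v) = v" using v by (simp add: thr_iff)
    ultimately show ?thesis by metis
  qed
  then show ?thesis using bmap_bij[OF h] bmap_ext by (simp add: local_iso_def)
qed

lemma local_iso_label_preserving:
  assumes F: "F \<in> local_iso col"
  shows "\<exists>x\<in>cls F. label_preserving T lt l x"
proof -
  obtain S where S: "complete_subtree T S" "\<And>v. v \<in> leaves T S \<Longrightarrow> \<exists>w. tiso col F v w"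
    using local_iso_common[OF F F] by blast
  show ?thesis
  proof (rule local_iso_realize[OF F S])
    fix \<phi> S'
    assume h: "(S, \<phi>, S') \<in> honest_auts T" "bmap (S, \<phi>, S') = F" "leaves T S' = \<phi> ` leaves T S"
      and p: "\<And>x. x \<in> forest_verts T S \<Longrightarrow> \<phi> ` ch x = ch (\<phi> x)"
        "\<And>x y. x \<in> forest_verts T S \<Longrightarrow> y \<in> ch x \<Longrightarrow> col (\<phi> y) = col y"
    have S': "complete_subtree T S'" using h by (simp add: honest_iff)
    have ord: "(\<phi> a, \<phi> b) \<in> lt (\<phi> v)" if v: "v \<in> forest_verts T S" "(a, b) \<in> lt v" for v a b
    proof -
      have ab: "a \<in> ch v" "b \<in> ch v" using lt_props(1)[OF forest_V[OF v(1)] v(2)] by auto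
      then have ab': "\<phi> a \<in> ch (\<phi> v)" "\<phi> b \<in> ch (\<phi> v)" using p(1)[OF v(1)] by blast+
      have "idx (\<phi> y) = idx y" if "y \<in> ch v" for y
        using p(2)[OF v(1) that] by (auto simp: col_def split: if_splits)
      then show ?thesis using idx_less_iff ab ab' v(2) by simp
    qed
    \<comment> \<open>Colours are compared only strictly below a leaf of \<open>S\<close>. But that
      leaf has a child in \<open>T\<close>, whose colour records the label of the leaf or, if the
      leaf is the root, the child itself.\<close>
    have lab: "S = {rt} \<and> S' = {rt} \<or> (\<forall>v\<in>leaves T S. v \<noteq> rt \<and> \<phi> v \<noteq> rt \<and> l v = l (\<phi> v))"
    proof (cases "rt \<in> leaves T S")
      case True
      have rF: "rt \<in> forest_verts T S" using True root_in desc_refl by (auto simp: forest_verts_def)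
      obtain y where y: "y \<in> ch rt" using ch_nonempty root_in by blast
      have "\<phi> y = y" using p(2)[OF rF y] par_eq[OF y] by (auto simp: col_def split: if_splits)
      moreover have "\<phi> y \<in> ch (\<phi> rt)" using p(1)[OF rF] y by blast
      ultimately have "\<phi> rt = rt" using parent_unique y by metis
      then have "rt \<in> leaves T S'" using h(3) True by force
      then show ?thesis using leaf_root S(1) S' True by blast
    next
      case False
      have "v \<noteq> rt \<and> \<phi> v \<noteq> rt \<and> l v = l (\<phi> v)" if v: "v \<in> leaves T S" for v
      proof -
        have vV: "v \<in> V" using leaf_D[OF v] S(1) by (auto simp: complete_subtree_iff)
        have vF: "v \<in> forest_verts T S" using v vV desc_refl by (auto simp: forest_verts_def)
        obtain y where y: "y \<in> ch v" using ch_nonempty vV by blast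
        have y': "\<phi> y \<in> ch (\<phi> v)" using p(1)[OF vF] y by blast
        have "v \<noteq> rt" using False v by blast
        then show ?thesis using p(2)[OF vF y] par_eq[OF y] par_eq[OF y']
          by (auto simp: col_def split: if_splits)
      qed
      then show ?thesis by blast
    qed
    have "label_preserving T lt l (S, \<phi>, S')"
      using p(1) ord lab by (simp add: label_preserving_def)
    then show ?thesis using h by (auto simp: cls_def)
  qed
qed

lemma V_label_eq: "V_label T lt l = cls ` local_iso col"
proof
  show "V_label T lt l \<subseteq> cls ` local_iso col"
  proof
    fix X assume "X \<in> V_label T lt l"
    then obtain x F where x: "x \<in> X" "label_preserving T lt l x" "X = cls F"
      by (auto simp: V_label_def carrier_AAut)
    then show "X \<in> cls ` local_iso col"
      using label_preserving_local_iso[of x] by (auto simp: cls_def)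
  qed
  show "cls ` local_iso col \<subseteq> V_label T lt l"
    using local_iso_label_preserving local_iso_mono by (auto simp: V_label_def carrier_AAut)
qed

end

section \<open>The full group of a reduced shift groupoid\<close>

definition agree :: "nat \<Rightarrow> (nat \<Rightarrow> 'e) \<Rightarrow> (nat \<Rightarrow> 'e) \<Rightarrow> bool" where
  "agree n x y \<longleftrightarrow> (\<forall>i<n. x i = y i)"

lemma agree_mono: "agree n x y \<Longrightarrow> m \<le> n \<Longrightarrow> agree m x y" by (simp add: agree_def)
lemma agree_sym: "agree n x y \<longleftrightarrow> agree n y x" by (auto simp: agree_def)
lemma agree_trans: "agree n x y \<Longrightarrow> agree n y z \<Longrightarrow> agree n x z" by (simp add: agree_def)
lemma agree_refl: "agree n x x" by (simp add: agree_def)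
lemma agreeD: "agree n x y \<Longrightarrow> i < n \<Longrightarrow> x i = y i" by (simp add: agree_def)

lemma agree_tails_eq:
  assumes "agree n x y" "\<And>k. x (n + k) = y (n + k)" shows "x = y"
proof
  fix i show "x i = y i"
    using assms(2)[of "i - n"] agreeD[OF assms(1), of i] by (cases "i < n") simp_all
qed

lemma funpow_shift: "(shift ^^ n) x = (\<lambda>k. x (n + k))"
  by (induction n) (auto simp: shift_def)

lemma funpow_shift_eq_iff: "(shift ^^ n) x = (shift ^^ m) y \<longleftrightarrow> (\<forall>k. x (n + k) = y (m + k))"
  by (simp add: funpow_shift fun_eq_iff)

text \<open>The homeomorphisms of \<open>Y\<close> that locally replace a prefix of length \<open>m\<close> by one of length
  \<open>n\<close>.\<close>

definition prefix_replacing :: "(nat \<Rightarrow> 'e) set \<Rightarrow> ((nat \<Rightarrow> 'e) \<Rightarrow> (nat \<Rightarrow> 'e)) \<Rightarrow> bool" where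
  "prefix_replacing Y f \<longleftrightarrow> f \<in> extensional Y \<and> bij_betw f Y Y \<and>
     (\<forall>y\<in>Y. \<exists>N n m. \<forall>z\<in>Y. agree N y z \<longrightarrow> agree n (f y) (f z) \<and> (\<forall>k. f z (n + k) = z (m + k)))"

locale shift_graph =
  fixes g :: "('a, 'e) pre_digraph"
begin

abbreviation "X \<equiv> path_space g"

text \<open>A basic open set of the product restricts finitely many coordinates, so it contains a
  cylinder around each of its paths.\<close>

lemma openin_path:
  "openin (path_topology g) W \<longleftrightarrow> W \<subseteq> X \<and> (\<forall>x\<in>W. \<exists>n. \<forall>y\<in>X. agree n x y \<longrightarrow> y \<in> W)"
proof
  assume "openin (path_topology g) W"
  then obtain U where U: "openin (product_topology (\<lambda>_. discrete_topology (arcs g)) UNIV) U" "W = U \<inter> X"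
    by (auto simp: path_topology_def openin_subtopology)
  have "\<exists>n. \<forall>y\<in>X. agree n x y \<longrightarrow> y \<in> W" if x: "x \<in> W" for x
  proof -
    obtain B where B: "finite {i. B i \<noteq> arcs g}" "x \<in> Pi\<^sub>E UNIV B" "Pi\<^sub>E UNIV B \<subseteq> U"
      using U x unfolding openin_product_topology_alt by fastforce
    obtain n where n: "\<And>i. B i \<noteq> arcs g \<Longrightarrow> i < n"
      using B(1) by (metis (mono_tags) finite_nat_set_iff_bounded mem_Collect_eq)
    have "y \<in> W" if y: "y \<in> X" "agree n x y" for y
    proof -
      have "y i \<in> B i" for i
      proof (cases "B i = arcs g")
        case True
        then show ?thesis using y(1) by (simp add: path_space_def)
      next
        case False
        then have "x i = y i" using n agreeD[OF y(2)] by blast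
        moreover have "x i \<in> B i" using B(2) by (auto simp: PiE_iff)
        ultimately show ?thesis by simp
      qed
      then show ?thesis using B(3) U(2) y by blast
    qed
    then show ?thesis by blast
  qed
  then show "W \<subseteq> X \<and> (\<forall>x\<in>W. \<exists>n. \<forall>y\<in>X. agree n x y \<longrightarrow> y \<in> W)" using U by blast
next
  assume W: "W \<subseteq> X \<and> (\<forall>x\<in>W. \<exists>n. \<forall>y\<in>X. agree n x y \<longrightarrow> y \<in> W)"
  \<comment> \<open>An open set of the full product with trace \<open>W\<close>: the sequences,
    paths or not, in some cylinder around a point of \<open>W\<close> whose paths all belong to
    \<open>W\<close>.\<close>
  define U where "U = {y. (\<forall>i. y i \<in> arcs g) \<and>
    (\<exists>x\<in>W. \<exists>n. agree n x y \<and> (\<forall>z\<in>X. agree n x z \<longrightarrow> z \<in> W))}"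
  have "W = U \<inter> X"
  proof
    show "W \<subseteq> U \<inter> X"
    proof
      fix x assume x: "x \<in> W"
      then obtain n where "\<forall>z\<in>X. agree n x z \<longrightarrow> z \<in> W" using W by blast
      then show "x \<in> U \<inter> X" using W x agree_refl unfolding U_def path_space_def by blast
    qed
  qed (auto simp: U_def)
  moreover have "openin (product_topology (\<lambda>_. discrete_topology (arcs g)) UNIV) U"
    unfolding openin_product_topology_alt
  proof
    fix y assume y: "y \<in> U"
    then obtain x n where x: "x \<in> W" "agree n x y" "\<forall>z\<in>X. agree n x z \<longrightarrow> z \<in> W"
      by (auto simp: U_def)
    let ?B = "\<lambda>i. if i < n then {y i} else arcs g"
    have "Pi\<^sub>E UNIV ?B \<subseteq> U"
    proof
      fix z assume z: "z \<in> Pi\<^sub>E UNIV ?B"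
      have zi: "z i \<in> ?B i" for i using z by (auto simp: PiE_iff)
      have "z i \<in> arcs g" for i using zi[of i] y by (cases "i < n") (auto simp: U_def)
      moreover have "z i = y i" if "i < n" for i using zi[of i] that by simp
      then have "agree n x z" using x(2) by (simp add: agree_def)
      ultimately show "z \<in> U" using x by (auto simp: U_def)
    qed
    moreover have "finite {i \<in> UNIV. ?B i \<noteq> topspace (discrete_topology (arcs g))}"
      by (rule finite_subset[of _ "{..<n}"]) auto
    moreover have "\<forall>i\<in>UNIV. openin (discrete_topology (arcs g)) (?B i)" "y \<in> Pi\<^sub>E UNIV ?B"
      using y by (auto simp: U_def)
    ultimately show "\<exists>B. finite {i \<in> UNIV. B i \<noteq> topspace (discrete_topology (arcs g))} \<and>
        (\<forall>i\<in>UNIV. openin (discrete_topology (arcs g)) (B i)) \<and> y \<in> Pi\<^sub>E UNIV B \<and> Pi\<^sub>E UNIV B \<subseteq> U"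
      by (intro exI[of _ ?B]) simp
  qed
  ultimately show "openin (path_topology g) W"
    unfolding path_topology_def openin_subtopology by blast
qed

lemma topspace_path: "topspace (path_topology g) = X"
  using openin_path[of X] openin_path[of "topspace (path_topology g)"] openin_subset
  by (metis openin_topspace order_refl subset_antisym)

lemma clopenin_path:
  "clopenin (path_topology g) W \<longleftrightarrow> W \<subseteq> X \<and> (\<forall>x\<in>X. \<exists>n. \<forall>y\<in>X. agree n x y \<longrightarrow> (y \<in> W \<longleftrightarrow> x \<in> W))"
  unfolding clopenin_def closedin_def topspace_path openin_path by (auto; blast)

lemma clopenin_cylinder: "clopenin (path_topology g) {y \<in> X. agree n x y}"
  unfolding clopenin_path using agree_trans agree_sym by (auto intro!: exI[of _ n]) blast+

section \<open>Neighbourhoods in the morphism space\<close>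

definition mor_set :: "((nat \<Rightarrow> 'e) \<times> int \<times> (nat \<Rightarrow> 'e)) set" where
  "mor_set = {(x, int n - int m, y) | x n m y. x \<in> X \<and> y \<in> X \<and> (\<forall>k. x (n + k) = y (m + k))}"

text \<open>\<open>U\<close> contains a basic neighbourhood of \<open>(x, k, y)\<close> relative to
  \<open>Y\<close>. The offsets are recorded separately because \<open>k\<close> fixes only their
  difference, and smaller offsets impose a stronger condition on the tails.\<close>

definition mor_nbhd ::
  "(nat \<Rightarrow> 'e) set \<Rightarrow> ((nat \<Rightarrow> 'e) \<times> int \<times> (nat \<Rightarrow> 'e)) set \<Rightarrow> (nat \<Rightarrow> 'e) \<Rightarrow> int \<Rightarrow> (nat \<Rightarrow> 'e) \<Rightarrow> nat \<Rightarrow> nat \<Rightarrow> nat \<Rightarrow> bool" where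
  "mor_nbhd Y U x k y n m N \<longleftrightarrow> k = int n - int m \<and> (\<forall>j. x (n + j) = y (m + j)) \<and>
     (\<forall>x'\<in>Y. \<forall>y'\<in>Y. agree N x x' \<longrightarrow> agree N y y' \<longrightarrow> (\<forall>j. x' (n + j) = y' (m + j)) \<longrightarrow> (x', k, y') \<in> U)"

lemma mor_nbhd_mono:
  assumes "mor_nbhd Y U x k y n m N" "N \<le> N'" "Y' \<subseteq> Y" "U \<subseteq> U'"
  shows "mor_nbhd Y' U' x k y n m N'"
  using assms agree_mono[OF _ assms(2)] unfolding mor_nbhd_def by blast

text \<open>Both pairs of offsets have difference \<open>k\<close>, so tails that match at the
  smaller pair also match at the larger one; the smaller pair works for the intersection.\<close>

lemma mor_nbhd_Int:
  assumes "mor_nbhd Y U x k y n m N" "mor_nbhd Y U' x k y n' m' N'"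
  shows "\<exists>n m N. mor_nbhd Y (U \<inter> U') x k y n m N"
proof -
  have *: "mor_nbhd Y (U \<inter> U') x k y n m (max N N')"
    if 1: "mor_nbhd Y U x k y n m N" and 2: "mor_nbhd Y U' x k y n' m' N'" and le: "n \<le> n'"
    for n m N n' m' N' U U'
  proof -
    define d where "d = n' - n"
    have "int n - int m = int n' - int m'" using 1 2 by (simp add: mor_nbhd_def)
    then have d: "n' = n + d" "m' = m + d" using le by (auto simp: d_def)
    have "(x', k, y') \<in> U'"
      if "x' \<in> Y" "y' \<in> Y" "agree (max N N') x x'" "agree (max N N') y y'" "\<forall>j. x' (n + j) = y' (m + j)" for x' y'
    proof -
      have "\<forall>j. x' (n' + j) = y' (m' + j)" using that(5) unfolding d by (simp add: add.assoc)
      moreover have "agree N' x x'" "agree N' y y'" using that agree_mono by force+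
      ultimately show ?thesis using 2 that(1,2) unfolding mor_nbhd_def by blast
    qed
    moreover have "mor_nbhd Y U x k y n m (max N N')" using mor_nbhd_mono[OF 1] by simp
    ultimately show ?thesis unfolding mor_nbhd_def by blast
  qed
  show ?thesis
    using *[OF assms] *[OF assms(2,1)] by (metis Int_commute nat_le_linear)
qed

text \<open>The generators are only a subbasis, and \<open>mor_nbhd_Int\<close> handles their
  intersections. Conversely the neighbourhood described by \<open>mor_nbhd\<close> is itself a
  generator, built from two cylinders.\<close>

lemma openin_mors:
  "openin (mors (shift_groupoid g)) U \<longleftrightarrow>
     U \<subseteq> mor_set \<and> (\<forall>x k y. (x, k, y) \<in> U \<longrightarrow> (\<exists>n m N. mor_nbhd X U x k y n m N))"
proof -
  let ?B = "{shift_basic_set U n m V | U n m V.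
      clopenin (path_topology g) U \<and> clopenin (path_topology g) V}"
  have mors: "openin (mors (shift_groupoid g)) U = generate_topology_on ?B U" for U
    by (simp add: shift_groupoid_def openin_topology_generated_by_iff)
  have 1: "U \<subseteq> mor_set \<and> (\<forall>x k y. (x, k, y) \<in> U \<longrightarrow> (\<exists>n m N. mor_nbhd X U x k y n m N))"
    if "generate_topology_on ?B U" for U
    using that
  proof (induction rule: generate_topology_on.induct)
    case Empty
    then show ?case by simp
  next
    case (Int a b)
    then show ?case by (meson IntE inf.coboundedI1 mor_nbhd_Int)
  next
    case (UN K)
    have "\<exists>n m N. mor_nbhd X (\<Union>K) x k y n m N" if xky: "(x, k, y) \<in> \<Union>K" for x k y
    proof -
      obtain a where a: "a \<in> K" "(x, k, y) \<in> a" using xky by blast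
      then obtain n m N where "mor_nbhd X a x k y n m N" using UN by blast
      then have "mor_nbhd X (\<Union>K) x k y n m N" using mor_nbhd_mono a by blast
      then show ?thesis by blast
    qed
    then show ?case using UN by blast
  next
    case (Basis s)
    then obtain U n m V where s: "s = shift_basic_set U n m V"
      and c: "clopenin (path_topology g) U" "clopenin (path_topology g) V" by blast
    have UV: "U \<subseteq> X" "V \<subseteq> X" using c by (auto simp: clopenin_path)
    have "s \<subseteq> mor_set"
      using UV unfolding s shift_basic_set_def mor_set_def funpow_shift_eq_iff by blast
    moreover have "\<exists>n m N. mor_nbhd X s x k y n m N" if "(x, k, y) \<in> s" for x k y
    proof -
      have xy: "x \<in> U" "y \<in> V" "k = int n - int m" "\<forall>j. x (n + j) = y (m + j)"
        using that unfolding s shift_basic_set_def funpow_shift_eq_iff by auto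
      obtain N where N: "\<forall>z\<in>X. agree N x z \<longrightarrow> z \<in> U"
        using c(1) xy(1) unfolding clopenin_def openin_path by blast
      obtain M where M: "\<forall>z\<in>X. agree M y z \<longrightarrow> z \<in> V"
        using c(2) xy(2) unfolding clopenin_def openin_path by blast
      have "mor_nbhd X s x k y n m (max N M)"
        unfolding mor_nbhd_def
      proof (intro conjI ballI impI)
        fix x' y' assume h: "x' \<in> X" "y' \<in> X" "agree (max N M) x x'" "agree (max N M) y y'"
          "\<forall>j. x' (n + j) = y' (m + j)"
        have "x' \<in> U" "y' \<in> V" using N M h agree_mono[OF h(3), of N] agree_mono[OF h(4), of M] by auto
        then show "(x', k, y') \<in> s" using h xy unfolding s shift_basic_set_def funpow_shift_eq_iff by blast
      qed (use xy in auto)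
      then show ?thesis by blast
    qed
    ultimately show ?case by blast
  qed
  have 2: "openin (mors (shift_groupoid g)) U"
    if U: "U \<subseteq> mor_set" "\<And>x k y. (x, k, y) \<in> U \<Longrightarrow> \<exists>n m N. mor_nbhd X U x k y n m N"
  proof (subst openin_subopen, intro ballI)
    fix u assume u: "u \<in> U"
    obtain x k y where xky: "u = (x, k, y)" by (cases u) auto
    obtain n m N where N: "mor_nbhd X U x k y n m N" using U u xky by blast
    have xy: "x \<in> X" "y \<in> X" using U u xky by (auto simp: mor_set_def)
    let ?b = "shift_basic_set {z \<in> X. agree N x z} n m {z \<in> X. agree N y z}"
    have "openin (mors (shift_groupoid g)) ?b"
      unfolding mors using clopenin_cylinder by (intro generate_topology_on.Basis) blast
    moreover have "u \<in> ?b"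
      using N xy agree_refl unfolding xky mor_nbhd_def shift_basic_set_def funpow_shift_eq_iff by blast
    moreover have "?b \<subseteq> U"
      using N unfolding mor_nbhd_def shift_basic_set_def funpow_shift_eq_iff by blast
    ultimately show "\<exists>b. openin (mors (shift_groupoid g)) b \<and> u \<in> b \<and> b \<subseteq> U" by blast
  qed
  show ?thesis using 1 2 mors by blast
qed

end

locale shift_reduction = shift_graph +
  fixes Y :: "(nat \<Rightarrow> 'b) set"
  assumes Y: "clopenin (path_topology g) Y"
begin

lemma Y_nbhd:
  assumes "y \<in> Y" shows "\<exists>n. \<forall>z\<in>X. agree n y z \<longrightarrow> z \<in> Y"
proof -
  have "y \<in> X" using Y assms by (auto simp: clopenin_path)
  then obtain n where "\<forall>z\<in>X. agree n y z \<longrightarrow> (z \<in> Y \<longleftrightarrow> y \<in> Y)"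
    using Y unfolding clopenin_path by meson
  then show ?thesis using assms by auto
qed

abbreviation "G \<equiv> reduction (shift_groupoid g) Y"

lemma YX: "Y \<subseteq> X" using Y by (simp add: clopenin_path)

lemma openin_objs: "openin (objs G) W \<longleftrightarrow> W \<subseteq> Y \<and> (\<forall>x\<in>W. \<exists>n. \<forall>y\<in>Y. agree n x y \<longrightarrow> y \<in> W)"
proof -
  have "openin (objs G) W \<longleftrightarrow> W \<subseteq> Y \<and> openin (path_topology g) W"
    using Y by (auto simp: reduction_def shift_groupoid_def clopenin_def openin_open_subtopology)
  moreover have "openin (path_topology g) W \<longleftrightarrow> (\<forall>x\<in>W. \<exists>n. \<forall>y\<in>Y. agree n x y \<longrightarrow> y \<in> W)" if WY: "W \<subseteq> Y"
  proof
    assume "openin (path_topology g) W"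
    then show "\<forall>x\<in>W. \<exists>n. \<forall>y\<in>Y. agree n x y \<longrightarrow> y \<in> W" using YX unfolding openin_path by blast
  next
    assume h: "\<forall>x\<in>W. \<exists>n. \<forall>y\<in>Y. agree n x y \<longrightarrow> y \<in> W"
    have "\<exists>n. \<forall>y\<in>X. agree n x y \<longrightarrow> y \<in> W" if x: "x \<in> W" for x
    proof -
      obtain n where n: "\<forall>y\<in>Y. agree n x y \<longrightarrow> y \<in> W" using h x by blast
      obtain m where m: "\<forall>y\<in>X. agree m x y \<longrightarrow> y \<in> Y" using Y_nbhd x WY by blast
      have "\<forall>y\<in>X. agree (max n m) x y \<longrightarrow> y \<in> W"
        using n m agree_mono max.cobounded1 max.cobounded2 by metis
      then show ?thesis by blast
    qed
    then show "openin (path_topology g) W" using WY YX unfolding openin_path by blast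
  qed
  ultimately show ?thesis by blast
qed

lemma topspace_objs: "topspace (objs G) = Y"
  using YX by (auto simp: reduction_def shift_groupoid_def topspace_path)

lemma src_G: "src G (x, k, y) = y" and rng_G: "rng G (x, k, y) = x"
  by (simp_all add: reduction_def shift_groupoid_def)

lemma src_image: "(x, k, y) \<in> B \<Longrightarrow> y \<in> src G ` B"
  by (rule image_eqI[where x = "(x, k, y)"]) (simp_all add: src_G)

definition "morY = {(x, k, y) \<in> mor_set. x \<in> Y \<and> y \<in> Y}"

text \<open>Since \<open>Y\<close> is open, a neighbourhood relative to \<open>Y\<close> becomes one
  among all paths after lengthening the cylinders.\<close>

lemma openin_morsY:
  "openin (mors G) U \<longleftrightarrow>
     U \<subseteq> morY \<and> (\<forall>x k y. (x, k, y) \<in> U \<longrightarrow> (\<exists>n m N. mor_nbhd Y U x k y n m N))"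
proof -
  let ?R = "{u. src (shift_groupoid g) u \<in> Y \<and> rng (shift_groupoid g) u \<in> Y}"
  have M: "mors G = subtopology (mors (shift_groupoid g)) ?R"
    by (simp add: reduction_def)
  have R: "(x, k, y) \<in> ?R \<longleftrightarrow> x \<in> Y \<and> y \<in> Y" for x k y by (auto simp: shift_groupoid_def)
  show ?thesis
  proof
    assume "openin (mors G) U"
    then obtain U0 where U0: "openin (mors (shift_groupoid g)) U0" "U = U0 \<inter> ?R"
      by (auto simp: M openin_subtopology)
    have sub: "U \<subseteq> morY"
    proof
      fix u assume u: "u \<in> U"
      obtain x k y where e: "u = (x, k, y)" by (cases u) auto
      have "u \<in> mor_set" "u \<in> ?R" using u U0 unfolding openin_mors by auto
      then show "u \<in> morY" using R unfolding e morY_def by blast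
    qed
    have "\<exists>n m N. mor_nbhd Y U x k y n m N" if xky: "(x, k, y) \<in> U" for x k y
    proof -
      obtain n m N where N: "mor_nbhd X U0 x k y n m N" using U0 xky unfolding openin_mors by blast
      have "mor_nbhd Y U x k y n m N" using N YX R unfolding mor_nbhd_def U0(2) by blast
      then show ?thesis by blast
    qed
    then show "U \<subseteq> morY \<and> (\<forall>x k y. (x, k, y) \<in> U \<longrightarrow> (\<exists>n m N. mor_nbhd Y U x k y n m N))" using sub by blast
  next
    assume h: "U \<subseteq> morY \<and> (\<forall>x k y. (x, k, y) \<in> U \<longrightarrow> (\<exists>n m N. mor_nbhd Y U x k y n m N))"
    have "\<exists>n m N. mor_nbhd X U x k y n m N" if xky: "(x, k, y) \<in> U" for x k y
    proof -
      obtain n m N where N: "mor_nbhd Y U x k y n m N" using h xky by blast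
      have xy: "x \<in> Y" "y \<in> Y" using h xky by (auto simp: morY_def)
      obtain a where a: "\<forall>z\<in>X. agree a x z \<longrightarrow> z \<in> Y" using Y_nbhd[OF xy(1)] by blast
      obtain b where b: "\<forall>z\<in>X. agree b y z \<longrightarrow> z \<in> Y" using Y_nbhd[OF xy(2)] by blast
      let ?N = "max N (max a b)"
      have "mor_nbhd X U x k y n m ?N"
        unfolding mor_nbhd_def
      proof (intro conjI ballI impI)
        fix x' y' assume g: "x' \<in> X" "y' \<in> X" "agree ?N x x'" "agree ?N y y'" "\<forall>j. x' (n + j) = y' (m + j)"
        have "agree N x x'" "agree N y y'" "agree a x x'" "agree b y y'"
          using agree_mono[OF g(3)] agree_mono[OF g(4)] by auto
        then show "(x', k, y') \<in> U" using N a b g unfolding mor_nbhd_def by blast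
      qed (use N in \<open>simp_all add: mor_nbhd_def\<close>)
      then show ?thesis by blast
    qed
    then have "openin (mors (shift_groupoid g)) U" using h unfolding openin_mors morY_def by blast
    moreover have "U \<subseteq> ?R"
    proof
      fix u assume u: "u \<in> U"
      obtain x k y where e: "u = (x, k, y)" by (cases u) auto
      show "u \<in> ?R" using h u unfolding e R morY_def by blast
    qed
    ultimately show "openin (mors G) U" unfolding M openin_subtopology by blast
  qed
qed

lemma topspace_morsY: "topspace (mors G) = morY"
proof -
  have "\<exists>n m N. mor_nbhd Y morY x k y n m N" if "(x, k, y) \<in> morY" for x k y
  proof -
    obtain n m where nm: "k = int n - int m" "\<forall>j. x (n + j) = y (m + j)"
      using \<open>(x, k, y) \<in> morY\<close> by (auto simp: morY_def mor_set_def)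
    have "mor_nbhd Y morY x k y n m 0"
      using nm YX unfolding mor_nbhd_def morY_def mor_set_def by blast
    then show ?thesis by blast
  qed
  then have "openin (mors G) morY" unfolding openin_morsY by blast
  moreover have "topspace (mors G) \<subseteq> morY" using openin_morsY[of "topspace (mors G)"] by blast
  ultimately show ?thesis using openin_subset by blast
qed

text \<open>A bisection consists of triples \<open>(f y, k, y)\<close>, one for each
  \<open>y\<close>. Around such a triple a set \<open>B\<close> with fixed offsets is open in
  \<open>U\<close>; as the source map is open on \<open>U\<close>, the sources of \<open>B\<close>
  contain a cylinder, and on it \<open>f\<close> replaces prefixes with these offsets.\<close>

lemma bisection_prefix_replacing:
  assumes "bisection G U"
  shows "prefix_replacing Y (\<lambda>y\<in>Y. rng G (inv_into U (src G) y))"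
proof -
  let ?s = "src G" and ?r = "rng G"
  have U: "openin (mors G) U" "U \<subseteq> morY"
    using assms openin_subset topspace_morsY by (auto simp: bisection_def clopenin_def)
  have topU: "topspace (subtopology (mors G) U) = U" using U topspace_morsY by auto
  have hs: "homeomorphic_map (subtopology (mors G) U) (objs G) ?s"
    and hr: "homeomorphic_map (subtopology (mors G) U) (objs G) ?r"
    using assms by (auto simp: bisection_def)
  have bs: "bij_betw ?s U Y" and br: "bij_betw ?r U Y"
    using hs hr unfolding homeomorphic_eq_everything_map topU topspace_objs by (auto simp: bij_betw_def)
  have os: "open_map (subtopology (mors G) U) (objs G) ?s"
    using hs unfolding homeomorphic_eq_everything_map by blast
  let ?i = "inv_into U ?s"
  define f where "f = (\<lambda>y\<in>Y. ?r (?i y))"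
  have i: "?i y \<in> U" "?s (?i y) = y" if "y \<in> Y" for y
    using bs that by (auto simp: bij_betw_def inv_into_into f_inv_into_f)
  have iu: "?i (?s u) = u" if "u \<in> U" for u using bs that by (simp add: bij_betw_inv_into_left)
  have "bij_betw (?r \<circ> ?i) Y Y" using bij_betw_trans[OF bij_betw_inv_into[OF bs] br] .
  then have bf: "bij_betw f Y Y" by (simp add: f_def cong: bij_betw_cong)
  have fy: "\<exists>k. ?i y = (f y, k, y)" if y: "y \<in> Y" for y
  proof -
    obtain a k b where e: "?i y = (a, k, b)" by (cases "?i y") auto
    then have "b = y" using i(2)[OF y] src_G[of a k b] by simp
    moreover have "a = f y" using y e rng_G[of a k b] by (simp add: f_def)
    ultimately show ?thesis using e by blast
  qed
  have "\<exists>N n m. \<forall>z\<in>Y. agree N y z \<longrightarrow> agree n (f y) (f z) \<and> (\<forall>k. f z (n + k) = z (m + k))" if y: "y \<in> Y" for y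
  proof -
    obtain k where k: "?i y = (f y, k, y)" using fy[OF y] by blast
    then have kU: "(f y, k, y) \<in> U" using i(1)[OF y] by simp
    then obtain n m N0 where N0: "mor_nbhd Y U (f y) k y n m N0" using U(1) unfolding openin_morsY by blast
    \<comment> \<open>At least \<open>n\<close>, so that agreement up to \<open>N\<close> covers the
      whole new prefix.\<close>
    define N where "N = max N0 n"
    have N: "mor_nbhd Y U (f y) k y n m N" using mor_nbhd_mono[OF N0] by (simp add: N_def)
    define B where "B = {(x', k', y') \<in> U. k' = k \<and> agree N (f y) x' \<and> agree N y y' \<and> (\<forall>j. x' (n + j) = y' (m + j))}"
    have BU: "B \<subseteq> U" by (auto simp: B_def)
    have "\<exists>n' m' N'. mor_nbhd Y B x' k' y' n' m' N'" if "(x', k', y') \<in> B" for x' k' y'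
    proof -
      have h: "(x', k', y') \<in> U" "k' = k" "agree N (f y) x'" "agree N y y'" "\<forall>j. x' (n + j) = y' (m + j)"
        using that by (auto simp: B_def)
      have "mor_nbhd Y B x' k y' n m N"
        unfolding mor_nbhd_def
      proof (intro conjI ballI impI)
        fix p q assume pq: "p \<in> Y" "q \<in> Y" "agree N x' p" "agree N y' q" "\<forall>j. p (n + j) = q (m + j)"
        have "agree N (f y) p" "agree N y q" using agree_trans h pq by blast+
        then show "(p, k, q) \<in> B" using N pq unfolding mor_nbhd_def B_def by blast
      qed (use N h in \<open>auto simp: mor_nbhd_def\<close>)
      then show ?thesis using h(2) by blast
    qed
    then have "openin (mors G) B" using BU U(2) unfolding openin_morsY by blast
    then have "openin (subtopology (mors G) U) B" using BU U(1) by (simp add: openin_open_subtopology)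
    then have "openin (objs G) (?s ` B)" using os by (simp add: open_map_def)
    moreover have "(f y, k, y) \<in> B" using kU N agree_refl unfolding B_def mor_nbhd_def by blast
    then have "y \<in> ?s ` B" by (rule src_image)
    ultimately obtain M where M: "\<forall>z\<in>Y. agree M y z \<longrightarrow> z \<in> ?s ` B" unfolding openin_objs by blast
    have "agree n (f y) (f z) \<and> (\<forall>j. f z (n + j) = z (m + j))" if z: "z \<in> Y" "agree M y z" for z
    proof -
      obtain u where u: "u \<in> B" "?s u = z" using M z by blast
      obtain a k' b where e: "u = (a, k', b)" by (cases u) auto
      have "?i z = u" using iu u BU by blast
      then have "a = f z" using fy[OF z(1)] e by auto
      moreover have "b = z" using u(2) src_G e by simp
      ultimately have "agree N (f y) (f z)" "\<forall>j. f z (n + j) = z (m + j)" using u(1) unfolding e B_def by auto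
      then show ?thesis using agree_mono[of N _ _ n] by (simp add: N_def)
    qed
    then show ?thesis by blast
  qed
  then show ?thesis using bf unfolding prefix_replacing_def f_def[symmetric] by (simp add: f_def)
qed

text \<open>Coordinate \<open>n + k\<close> of the image is coordinate \<open>m + k\<close> of the
  argument, so inside the cylinder of validity \<open>m + M\<close> coordinates determine the first
  \<open>M\<close> of the image.\<close>

lemma prefix_replacing_continuous:
  assumes "prefix_replacing Y f" "y \<in> Y"
  shows "\<exists>N. \<forall>z\<in>Y. agree N y z \<longrightarrow> agree M (f y) (f z)"
proof -
  obtain N n m where N: "\<And>z. z \<in> Y \<Longrightarrow> agree N y z \<Longrightarrow> agree n (f y) (f z) \<and> (\<forall>k. f z (n + k) = z (m + k))"
    using assms unfolding prefix_replacing_def by meson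
  have "agree M (f y) (f z)" if z: "z \<in> Y" "agree (max N (m + M)) y z" for z
    unfolding agree_def
  proof (intro allI impI)
    fix i assume i: "i < M"
    have h: "agree n (f y) (f z)" "\<And>k. f z (n + k) = z (m + k)" "\<And>k. f y (n + k) = y (m + k)"
      using N[OF z(1) agree_mono[OF z(2)]] N[OF assms(2) agree_refl] by auto
    show "f y i = f z i"
    proof (cases "i < n")
      case False
      then have "f y i = y (m + (i - n))" "f z i = z (m + (i - n))" using h(2,3)[of "i - n"] by auto
      moreover have "m + (i - n) < max N (m + M)" using i by linarith
      ultimately show ?thesis using agreeD[OF z(2)] by simp
    qed (use agreeD[OF h(1)] in simp)
  qed
  then show ?thesis by blast
qed

text \<open>The preimage of \<open>z'\<close> near \<open>z = f y\<close> is obtained by putting the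
  first \<open>m\<close> edges of \<open>y\<close> before the tail of \<open>z'\<close>. This is a
  path close to \<open>y\<close>, hence in \<open>Y\<close>, and \<open>f\<close> maps it to
  \<open>z'\<close>.\<close>

lemma prefix_replacing_inv:
  assumes f: "prefix_replacing Y f"
  shows "prefix_replacing Y (restrict (inv_into Y f) Y)"
proof -
  let ?h = "restrict (inv_into Y f) Y"
  have bij: "bij_betw f Y Y" using f by (simp add: prefix_replacing_def)
  have hf: "?h (f y) = y" if "y \<in> Y" for y
    using that bij bij_betw_apply[OF bij that] by (simp add: bij_betw_inv_into_left)
  have fh: "f (?h z) = z" "?h z \<in> Y" if "z \<in> Y" for z
    using that bij bij_betw_apply[OF bij_betw_inv_into[OF bij] that] by (simp_all add: bij_betw_inv_into_right)
  have "bij_betw (inv_into Y f) Y Y" using bij by (rule bij_betw_inv_into)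
  then have "bij_betw ?h Y Y" by (simp cong: bij_betw_cong)
  moreover have "\<exists>N n m. \<forall>z'\<in>Y. agree N z z' \<longrightarrow> agree n (?h z) (?h z') \<and> (\<forall>k. ?h z' (n + k) = z' (m + k))"
    if z: "z \<in> Y" for z
  proof -
    define y where "y = ?h z"
    have y: "y \<in> Y" "f y = z" using fh[OF z] by (auto simp: y_def)
    obtain N n m where N: "\<And>w. w \<in> Y \<Longrightarrow> agree N y w \<Longrightarrow> agree n (f y) (f w) \<and> (\<forall>k. f w (n + k) = w (m + k))"
      using f y(1) unfolding prefix_replacing_def by meson
    obtain M where M: "\<forall>w\<in>X. agree M y w \<longrightarrow> w \<in> Y" using Y_nbhd[OF y(1)] by blast
    \<comment> \<open>After the prefix of length \<open>n\<close>, the further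
      \<open>N + M + 1\<close> coordinates make \<open>w\<close> agree with \<open>y\<close> beyond
      positions \<open>N\<close> and \<open>M\<close>. The extra one makes them agree at position
      \<open>m\<close> too, so the two pieces of \<open>w\<close> fit together.\<close>
    let ?N = "n + N + M + 1"
    have zy: "z (n + k) = y (m + k)" for k using N[OF y(1) agree_refl] y(2) by blast
    have "agree m y (?h z') \<and> (\<forall>k. ?h z' (m + k) = z' (n + k))" if z': "z' \<in> Y" "agree ?N z z'" for z'
    proof -
      define w where "w = (\<lambda>i. if i < m then y i else z' (n + (i - m)))"
      have wt: "w (m + k) = z' (n + k)" for k by (simp add: w_def)
      have agw: "w i = y i" if "i < m + Suc (N + M)" for i
      proof (cases "i < m")
        case False
        then show ?thesis using agreeD[OF z'(2), of "n + (i - m)"] zy[of "i - m"] that by (simp add: w_def)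
      qed (simp add: w_def)
      have "w \<in> X"
        unfolding path_space_def
      proof (intro CollectI allI)
        fix i
        have yX: "y \<in> X" and zX: "z' \<in> X" using y z' YX by auto
        show "w i \<in> arcs g \<and> head g (w i) = tail g (w (Suc i))"
        proof (cases "i < m")
          case True
          then show ?thesis using agw[of i] agw[of "Suc i"] yX by (simp add: path_space_def)
        next
          case False
          then show ?thesis using zX by (simp add: path_space_def w_def Suc_diff_le)
        qed
      qed
      moreover have "agree M y w" "agree N y w" using agw by (auto simp: agree_def)
      ultimately have wY: "w \<in> Y" using M by blast
      have "agree n (f y) (f w)" and fw: "\<And>k. f w (n + k) = z' (n + k)"
        using N[OF wY \<open>agree N y w\<close>] wt by auto
      moreover have "agree n (f y) z'" using agree_mono[OF z'(2), of n] y(2) by simp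
      ultimately have "f w = z'" using agree_tails_eq[of n] agree_trans agree_sym by metis
      then have "?h z' = w" using hf[OF wY] by simp
      then show ?thesis using wt by (simp add: agree_def w_def)
    qed
    then show ?thesis unfolding y_def by blast
  qed
  ultimately show ?thesis by (simp add: prefix_replacing_def)
qed

lemma prefix_replacing_homeomorphic:
  assumes f: "prefix_replacing Y f"
  shows "homeomorphic_map (objs G) (objs G) f"
proof -
  have cont: "continuous_map (objs G) (objs G) f" if f: "prefix_replacing Y f" for f
  proof -
    have fY: "f y \<in> Y" if "y \<in> Y" for y using f that bij_betw_apply by (fastforce simp: prefix_replacing_def)
    have "openin (objs G) {x \<in> Y. f x \<in> W}" if W: "openin (objs G) W" for W
      unfolding openin_objs
    proof (intro conjI ballI)
      fix y assume y: "y \<in> {x \<in> Y. f x \<in> W}"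
      then obtain M where M: "\<forall>z\<in>Y. agree M (f y) z \<longrightarrow> z \<in> W" using W unfolding openin_objs by blast
      obtain N where "\<forall>z\<in>Y. agree N y z \<longrightarrow> agree M (f y) (f z)" using prefix_replacing_continuous f y by blast
      then show "\<exists>n. \<forall>z\<in>Y. agree n y z \<longrightarrow> z \<in> {x \<in> Y. f x \<in> W}" using M fY by blast
    qed auto
    then show ?thesis using fY by (simp add: continuous_map_def topspace_objs Pi_iff)
  qed
  let ?h = "restrict (inv_into Y f) Y"
  have bij: "bij_betw f Y Y" using f by (simp add: prefix_replacing_def)
  have "homeomorphic_maps (objs G) (objs G) f ?h"
    unfolding homeomorphic_maps_def topspace_objs
    using cont[OF f] cont[OF prefix_replacing_inv[OF f]] bij bij_betw_apply[OF bij]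
    by (simp add: bij_betw_inv_into_left bij_betw_inv_into_right)
  then show ?thesis using homeomorphic_map_maps by blast
qed

text \<open>The degree of the germ at \<open>y\<close> is read off from the least cylinder around \<open>y\<close> on which
  \<open>f\<close> is a prefix replacement, so it is locally constant.\<close>

lemma prefix_replacing_degree:
  assumes f: "prefix_replacing Y f"
  shows "\<exists>N n m. \<forall>y\<in>Y. \<forall>z\<in>Y. agree (N y) y z \<longrightarrow>
    n z = n y \<and> m z = m y \<and> agree (n y) (f y) (f z) \<and> (\<forall>k. f z (n y + k) = z (m y + k))"
proof -
  define P where "P = (\<lambda>y N n m. \<forall>z\<in>Y. agree N y z \<longrightarrow> agree n (f y) (f z) \<and> (\<forall>k. f z (n + k) = z (m + k)))"
  define N where "N = (\<lambda>y. LEAST N. \<exists>n m. P y N n m)"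
  have N_eq: "N y = (LEAST N. \<exists>n m. P y N n m)" for y by (simp add: N_def)
  define n where "n = (\<lambda>y. SOME n. \<exists>m. P y (N y) n m)"
  define m where "m = (\<lambda>y. SOME m. P y (N y) (n y) m)"
  have Pnm: "P y (N y) (n y) (m y)" if "y \<in> Y" for y
  proof -
    have "\<exists>N n m. P y N n m" using f that unfolding prefix_replacing_def P_def by blast
    then have "\<exists>n m. P y (N y) n m" unfolding N_def by (rule LeastI_ex)
    then have "\<exists>m. P y (N y) (n y) m" unfolding n_def by (rule someI_ex)
    then show ?thesis unfolding m_def by (rule someI_ex)
  qed
  \<comment> \<open>Every point of a cylinder is a centre of it. Up to size \<open>N y\<close> the
    predicates for \<open>y\<close> and \<open>z\<close> therefore coincide, and so do the least
    size and the values picked by \<open>SOME\<close>.\<close>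
  have PP: "P z N' a b" if "y \<in> Y" "z \<in> Y" "agree N' y z" "P y N' a b" for y z N' a b
    unfolding P_def
  proof (intro ballI impI)
    fix w assume w: "w \<in> Y" "agree N' z w"
    have "agree N' y w" using agree_trans that(3) w(2) by blast
    then have "agree a (f y) (f w)" "\<forall>k. f w (a + k) = w (b + k)" "agree a (f y) (f z)"
      using that w unfolding P_def by blast+
    then show "agree a (f z) (f w) \<and> (\<forall>k. f w (a + k) = w (b + k))"
      using agree_trans agree_sym by blast
  qed
  have "n z = n y \<and> m z = m y" if yz: "y \<in> Y" "z \<in> Y" "agree (N y) y z" for y z
  proof -
    have eq: "P z N' = P y N'" if "N' \<le> N y" for N'
      using PP[OF yz(1,2)] PP[OF yz(2,1)] agree_mono[OF yz(3) that] agree_sym by blast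
    have "N z = N y"
      unfolding N_eq[of z]
    proof (rule Least_equality)
      show "\<exists>n m. P z (N y) n m" using eq[of "N y"] Pnm[OF yz(1)] by auto
      fix N' assume "\<exists>n m. P z N' n m"
      then show "N y \<le> N'" using eq[of N'] unfolding N_eq[of y]
        by (metis (mono_tags, lifting) Least_le nat_le_linear)
    qed
    then show ?thesis using eq[of "N y"] by (simp add: n_def m_def)
  qed
  then show ?thesis using Pnm unfolding P_def by blast
qed

text \<open>The bisection is the graph of \<open>f\<close> with the locally constant degree
  \<open>d\<close> inserted. On it the source map is a homeomorphism, and the range map is
  \<open>f\<close> after the source map.\<close>

lemma prefix_replacing_bisection:
  assumes f: "prefix_replacing Y f"
  shows "\<exists>U. bisection G U \<and> f = (\<lambda>y\<in>Y. rng G (inv_into U (src G) y))"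
proof -
  obtain N n m where L: "\<And>y z. y \<in> Y \<Longrightarrow> z \<in> Y \<Longrightarrow> agree (N y) y z \<Longrightarrow>
    n z = n y \<and> m z = m y \<and> agree (n y) (f y) (f z) \<and> (\<forall>k. f z (n y + k) = z (m y + k))"
    using prefix_replacing_degree[OF f] by blast
  define d where "d = (\<lambda>y. int (n y) - int (m y))"
  define U where "U = (\<lambda>y. (f y, d y, y)) ` Y"
  have bij: "bij_betw f Y Y" using f by (simp add: prefix_replacing_def)
  have fY: "f y \<in> Y" if "y \<in> Y" for y using bij_betw_apply[OF bij that] .
  have tail: "f y (n y + k) = y (m y + k)" if "y \<in> Y" for y k using L[OF that that agree_refl] by blast
  have U_iff: "(x, k, y) \<in> U \<longleftrightarrow> y \<in> Y \<and> x = f y \<and> k = d y" for x k y by (auto simp: U_def)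
  have Um: "U \<subseteq> morY"
  proof
    fix u assume "u \<in> U"
    then obtain y where y: "y \<in> Y" "u = (f y, int (n y) - int (m y), y)" by (auto simp: U_def d_def)
    then show "u \<in> morY" using fY[OF y(1)] tail[OF y(1)] YX unfolding morY_def mor_set_def by blast
  qed
  have opU: "openin (mors G) U"
    unfolding openin_morsY
  proof (intro conjI allI impI Um)
    fix x k y assume "(x, k, y) \<in> U"
    then have y: "y \<in> Y" "x = f y" "k = d y" by (auto simp: U_iff)
    \<comment> \<open>\<open>N y\<close> keeps the degree and the replacement rule fixed, and
      \<open>n y\<close> fixes the prefix of \<open>x'\<close>; with matching tails this forces
      \<open>x' = f y'\<close>.\<close>
    have "mor_nbhd Y U x k y (n y) (m y) (max (N y) (n y))"
      unfolding mor_nbhd_def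
    proof (intro conjI ballI impI allI)
      show "k = int (n y) - int (m y)" "x (n y + j) = y (m y + j)" for j
        using y tail by (auto simp: d_def)
      fix x' y' assume h: "x' \<in> Y" "y' \<in> Y" "agree (max (N y) (n y)) x x'" "agree (max (N y) (n y)) y y'"
        "\<forall>j. x' (n y + j) = y' (m y + j)"
      note L' = L[OF y(1) h(2) agree_mono[OF h(4)], simplified]
      have "agree (n y) (f y) x'" using agree_mono[OF h(3)] y(2) by simp
      then have "agree (n y) x' (f y')" using L' agree_trans agree_sym by blast
      then have "x' = f y'" using agree_tails_eq[of "n y" x' "f y'"] h(5) L' by simp
      moreover have "k = d y'" using y(3) L' by (simp add: d_def)
      ultimately show "(x', k, y') \<in> U" using h(2) by (simp add: U_iff)
    qed
    then show "\<exists>n m N. mor_nbhd Y U x k y n m N" by blast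
  qed
  have "openin (mors G) (morY - U)"
    unfolding openin_morsY
  proof (intro conjI allI impI)
    fix x k y assume u: "(x, k, y) \<in> morY - U"
    then have xy: "x \<in> Y" "y \<in> Y" "x \<noteq> f y \<or> k \<noteq> d y" by (auto simp: morY_def U_iff)
    obtain a b where ab: "k = int a - int b" "\<forall>j. x (a + j) = y (b + j)"
      using u by (auto simp: morY_def mor_set_def)
    \<comment> \<open>Off the graph either the degree is wrong, which persists because
      \<open>d\<close> is locally constant, or \<open>x\<close> and \<open>f y\<close> differ at
      some coordinate \<open>i\<close>, which persists by continuity.\<close>
    obtain M where M: "\<And>x' y'. x' \<in> Y \<Longrightarrow> y' \<in> Y \<Longrightarrow> agree M x x' \<Longrightarrow> agree M y y' \<Longrightarrow> x' \<noteq> f y' \<or> k \<noteq> d y'"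
    proof (cases "x = f y")
      case True
      then have "k \<noteq> d y" using xy by simp
      then show ?thesis using L[OF xy(2)] that[of "N y"] by (simp add: d_def)
    next
      case False
      then obtain i where i: "x i \<noteq> f y i" by blast
      obtain N' where N': "\<forall>z\<in>Y. agree N' y z \<longrightarrow> agree (Suc i) (f y) (f z)"
        using prefix_replacing_continuous[OF f xy(2)] by blast
      have "x' \<noteq> f y'" if h: "x' \<in> Y" "y' \<in> Y" "agree (max N' (Suc i)) x x'" "agree (max N' (Suc i)) y y'" for x' y'
      proof -
        have "agree (Suc i) (f y) (f y')" using N' h(2) agree_mono[OF h(4)] by simp
        then have "f y i = f y' i" using agreeD by (metis lessI)
        moreover have "x i = x' i" using agreeD[OF h(3), of i] by simp
        ultimately show ?thesis using i by auto
      qed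
      then show ?thesis using that[of "max N' (Suc i)"] by blast
    qed
    have "mor_nbhd Y (morY - U) x k y a b M"
      unfolding mor_nbhd_def
    proof (intro conjI ballI impI)
      fix x' y' assume h: "x' \<in> Y" "y' \<in> Y" "agree M x x'" "agree M y y'" "\<forall>j. x' (a + j) = y' (b + j)"
      have "(x', k, y') \<in> morY" using h ab YX unfolding morY_def mor_set_def by blast
      then show "(x', k, y') \<in> morY - U" using M[OF h(1-4)] by (auto simp: U_iff)
    qed (use ab in auto)
    then show "\<exists>n m N. mor_nbhd Y (morY - U) x k y n m N" by blast
  qed auto
  then have clU: "clopenin (mors G) U" using opU Um by (simp add: clopenin_def closedin_def topspace_morsY)
  have topU: "topspace (subtopology (mors G) U) = U" using Um topspace_morsY by auto
  have "openin (objs G) (src G ` B)" if B: "openin (subtopology (mors G) U) B" for B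
  proof -
    have B': "openin (mors G) B" "B \<subseteq> U" using B opU by (auto simp: openin_open_subtopology)
    show ?thesis
      unfolding openin_objs
    proof (intro conjI ballI)
      show "src G ` B \<subseteq> Y" using B'(2) by (auto simp: U_def src_G)
      fix y assume "y \<in> src G ` B"
      then obtain x k where "(x, k, y) \<in> B" by (auto simp: src_G)
      moreover from this have "y \<in> Y" "x = f y" "k = d y" using B'(2) U_iff by blast+
      ultimately have yB: "y \<in> Y" "(f y, d y, y) \<in> B" by simp_all
      then obtain a b M where M: "mor_nbhd Y B (f y) (d y) y a b M" using B'(1) unfolding openin_morsY by blast
      obtain N' where N': "\<forall>z\<in>Y. agree N' y z \<longrightarrow> agree (max M (n y)) (f y) (f z)"
        using prefix_replacing_continuous[OF f yB(1)] by blast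
      have "z \<in> src G ` B" if z: "z \<in> Y" "agree (max (max (N y) (m y)) (max M N')) y z" for z
      proof -
        have ag: "agree (N y) y z" "agree (m y) y z" "agree M y z" "agree N' y z"
          using agree_mono[OF z(2)] by auto
        then have fz: "agree M (f y) (f z)" "agree (n y) (f y) (f z)"
          using N' z(1) agree_mono by (meson max.cobounded1 max.cobounded2)+
        have ab: "int a - int b = int (n y) - int (m y)" "\<And>j. f y (a + j) = y (b + j)"
          using M by (auto simp: mor_nbhd_def d_def)
        note L' = L[OF yB(1) z(1) ag(1)]
        \<comment> \<open>The offsets \<open>a\<close>, \<open>b\<close> come from the topology and
          need not be \<open>n y\<close>, \<open>m y\<close>, but they have the same difference.
          Before \<open>n y\<close> the equation is inherited from \<open>y\<close> by agreement;
          from there on it is the replacement rule.\<close>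
        have "f z (a + j) = z (b + j)" for j
        proof (cases "a + j < n y")
          case True
          then have "b + j < m y" using ab(1) by linarith
          then show ?thesis using agreeD[OF fz(2) True] agreeD[OF ag(2)] ab(2)[of j] by simp
        next
          case False
          then obtain i where i: "a + j = n y + i" by (metis le_iff_add not_less)
          then have "b + j = m y + i" using ab(1) by linarith
          then show ?thesis using L' i by simp
        qed
        then have "(f z, d y, z) \<in> B" using M z(1) fY[OF z(1)] fz(1) ag(3) unfolding mor_nbhd_def by blast
        then show ?thesis by (rule src_image)
      qed
      then show "\<exists>n. \<forall>z\<in>Y. agree n y z \<longrightarrow> z \<in> src G ` B" by blast
    qed
  qed
  then have os: "open_map (subtopology (mors G) U) (objs G) (src G)" by (simp add: open_map_def)
  have "openin (subtopology (mors G) U) {u \<in> U. src G u \<in> W}" if W: "openin (objs G) W" for W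
  proof -
    have "\<exists>a b M. mor_nbhd Y {u \<in> U. src G u \<in> W} x k y a b M" if "(x, k, y) \<in> {u \<in> U. src G u \<in> W}" for x k y
    proof -
      have xky: "(x, k, y) \<in> U" "y \<in> W" using that by (auto simp: src_G)
      obtain a b M where M: "mor_nbhd Y U x k y a b M" using opU xky unfolding openin_morsY by blast
      obtain M' where M': "\<forall>z\<in>Y. agree M' y z \<longrightarrow> z \<in> W" using W xky unfolding openin_objs by blast
      have "mor_nbhd Y {u \<in> U. src G u \<in> W} x k y a b (max M M')"
        unfolding mor_nbhd_def
      proof (intro conjI ballI impI)
        fix x' y' assume h: "x' \<in> Y" "y' \<in> Y" "agree (max M M') x x'" "agree (max M M') y y'"
          "\<forall>j. x' (a + j) = y' (b + j)"
        have "agree M x x'" "agree M y y'" "agree M' y y'"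
          using agree_mono[OF h(3)] agree_mono[OF h(4)] by auto
        then have "(x', k, y') \<in> U" "y' \<in> W" using M M' h unfolding mor_nbhd_def by blast+
        then show "(x', k, y') \<in> {u \<in> U. src G u \<in> W}" by (simp add: src_G)
      qed (use M in \<open>auto simp: mor_nbhd_def\<close>)
      then show ?thesis by blast
    qed
    then have "openin (mors G) {u \<in> U. src G u \<in> W}" using Um unfolding openin_morsY by blast
    then show ?thesis using opU by (simp add: openin_open_subtopology)
  qed
  then have cs: "continuous_map (subtopology (mors G) U) (objs G) (src G)"
    unfolding continuous_map_def topU topspace_objs by (auto simp: U_def src_G)
  have inj: "inj_on (src G) U" and im: "src G ` U = Y"
    by (auto simp: inj_on_def U_def src_G image_image)
  have hs: "homeomorphic_map (subtopology (mors G) U) (objs G) (src G)"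
    using bijective_open_imp_homeomorphic_map[OF cs os] inj im unfolding topU topspace_objs by blast
  have "homeomorphic_map (subtopology (mors G) U) (objs G) (f \<circ> src G)"
    by (rule homeomorphic_map_compose[OF hs prefix_replacing_homeomorphic[OF f]])
  then have hr: "homeomorphic_map (subtopology (mors G) U) (objs G) (rng G)"
    by (rule homeomorphic_map_eq) (unfold topU, auto simp: U_def src_G rng_G)
  have "bisection G U" using clU hs hr by (simp add: bisection_def)
  moreover have "f = (\<lambda>y\<in>Y. rng G (inv_into U (src G) y))"
  proof (rule extensionalityI)
    show "f \<in> extensional Y" using f by (simp add: prefix_replacing_def)
    fix y assume y: "y \<in> Y"
    have "inv_into U (src G) (src G (f y, d y, y)) = (f y, d y, y)"
      using inj y by (intro inv_into_f_f) (auto simp: U_iff)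
    then show "f y = (\<lambda>y\<in>Y. rng G (inv_into U (src G) y)) y" using y by (simp add: src_G rng_G)
  qed simp
  ultimately show ?thesis by blast
qed

lemma carrier_topological_full_group:
  "carrier (topological_full_group G) = {f. prefix_replacing Y f}"
proof -
  let ?f = "\<lambda>U. \<lambda>y\<in>Y. rng G (inv_into U (src G) y)"
  have "carrier (topological_full_group G) = {?f U | U. bisection G U}"
    by (simp add: topological_full_group_def topspace_objs)
  also have "\<dots> = {f. prefix_replacing Y f}"
  proof (intro equalityI subsetI)
    fix f assume "f \<in> {?f U | U. bisection G U}"
    then obtain U where "bisection G U" "f = ?f U" by blast
    then show "f \<in> {f. prefix_replacing Y f}" using bisection_prefix_replacing by simp
  next
    fix f assume "f \<in> {f. prefix_replacing Y f}"
    then have "\<exists>U. bisection G U \<and> f = ?f U" using prefix_replacing_bisection by simp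
    then show "f \<in> {?f U | U. bisection G U}" by blast
  qed
  finally show ?thesis .
qed

lemma mult_topological_full_group:
  assumes "prefix_replacing Y f" "prefix_replacing Y h"
  shows "f \<otimes>\<^bsub>topological_full_group G\<^esub> h = compose Y f h"
  using assms by (simp add: topological_full_group_def homeo_group_def BijGroup_def topspace_objs
      Bij_def prefix_replacing_def)

end

section \<open>The graph of labels\<close>

context labelled_tree
begin

abbreviation "W \<equiv> V - {rt}"

lemma label_in: "v \<in> W \<Longrightarrow> l v \<in> D"
  using labelled by (auto simp: labelling_def)

lemma finite_D: "finite D"
  using labelled by (simp add: labelling_def)

lemma desc_nonroot: "x \<in> desc v \<Longrightarrow> v \<noteq> rt \<Longrightarrow> x \<noteq> rt"
  using desc_lev[of x v] lev_root desc_V(2)[of x v] lev_0_iff[of v] by auto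

text \<open>Otherwise removing \<open>desc v\<close> would leave a proper subtree that still
  contains all vertices labelled \<open>d\<close>, against spanning.\<close>

lemma label_below:
  assumes v: "v \<in> W" and d: "d \<in> D"
  shows "\<exists>x\<in>desc v. l x = d"
proof (rule ccontr)
  assume n: "\<not> ?thesis"
  have "subtree T (V - desc v)"
  proof (rule parent_closed_subtree)
    have "rt \<notin> desc v" using desc_nonroot v by blast
    then show "rt \<in> V - desc v" using root_in by blast
    fix p x assume "x \<in> V - desc v" "x \<in> ch p"
    then show "p \<in> V - desc v" using desc_child ch_D(1) by blast
  qed blast
  moreover have "label_class T l d \<subseteq> V - desc v" using n by (auto simp: label_class_def)
  ultimately have "V \<subseteq> V - desc v" using spanning d by (auto simp: spanned_by_def)
  then show False using v desc_refl by blast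
qed

text \<open>Below \<open>v\<close> two siblings \<open>a\<close>, \<open>a'\<close> branch off. A
  vertex with the label of \<open>r\<close> is found below \<open>a\<close>, and the rest of
  \<open>R\<close> is placed below \<open>a'\<close> by induction.\<close>

lemma incomparable:
  assumes "finite R" "R \<subseteq> W" "v \<in> W"
  shows "\<exists>w. \<forall>r\<in>R. w r \<in> desc v \<and> w r \<noteq> v \<and> l (w r) = l r \<and> (\<forall>r'\<in>R. w r' \<in> desc (w r) \<longrightarrow> r' = r)"
  using assms
proof (induction R arbitrary: v rule: finite_induct)
  case empty
  then show ?case by simp
next
  case (insert r R)
  obtain b a a' where b: "b \<in> desc v" "a \<in> ch b" "a' \<in> ch b" "a \<noteq> a'" using branch insert.prems by blast
  have a: "a \<in> desc v" "a' \<in> desc v" using desc_child b by blast+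
  have aW: "a \<in> W" "a' \<in> W" using ch_D(2,5) b by blast+
  have lv: "lev v < lev a" "lev v < lev a'"
    using desc_lev[OF b(1)] ch_D(3)[OF b(2)] ch_D(3)[OF b(3)] by auto
  obtain w where w: "\<And>s. s \<in> R \<Longrightarrow> w s \<in> desc a' \<and> w s \<noteq> a' \<and> l (w s) = l s \<and> (\<forall>r'\<in>R. w r' \<in> desc (w s) \<longrightarrow> r' = s)"
    using insert.IH[OF _ aW(2)] insert.prems by (auto; blast)
  obtain x where x: "x \<in> desc a" "l x = l r" using label_below[OF aW(1)] label_in insert.prems by blast
  have disj: "z \<notin> desc a'" if "z \<in> desc a" for z
  proof
    assume "z \<in> desc a'"
    then have "a \<in> desc a' \<or> a' \<in> desc a" using desc_comparable that by blast
    then show False using desc_lev[of a a'] desc_lev[of a' a] ch_D(3)[OF b(2)] ch_D(3)[OF b(3)] b(4) by auto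
  qed
  have nv: "z \<noteq> v" if "z \<in> desc a \<or> z \<in> desc a'" for z
    using that lv desc_lev[of z a] desc_lev[of z a'] by auto
  let ?w = "w(r := x)"
  have "?w s \<in> desc v \<and> ?w s \<noteq> v \<and> l (?w s) = l s \<and> (\<forall>r'\<in>insert r R. ?w r' \<in> desc (?w s) \<longrightarrow> r' = s)"
    if s: "s \<in> insert r R" for s
  proof (cases "s = r")
    case True
    have "w r' \<notin> desc x" if "r' \<in> R" for r'
      using w[OF that] disj[of "w r'"] desc_trans[OF x(1)] by blast
    then show ?thesis using True x nv[of x] desc_trans[OF a(1) x(1)] by auto
  next
    case False
    then have sR: "s \<in> R" using s by simp
    have "x \<notin> desc (w s)" using w[OF sR] disj[OF x(1)] desc_trans by blast
    then show ?thesis using False w[OF sR] nv[of "w s"] desc_trans[OF a(2)] by auto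
  qed
  then show ?case by blast
qed

text \<open>The theorem asks for a graph on natural numbers, so the labels are numbered.\<close>

definition enc :: "'d \<Rightarrow> nat" where "enc = to_nat_on D"

lemma enc_inj: "c \<in> D \<Longrightarrow> d \<in> D \<Longrightarrow> enc c = enc d \<longleftrightarrow> c = d"
  unfolding enc_def using finite_D by (simp add: countable_finite)

definition arc :: "'v \<Rightarrow> nat" where "arc y = prod_encode (enc (l (par y)), idx y)"

text \<open>The vertices of \<open>graph\<close> are the labels and its edges out of \<open>d\<close> correspond to the children
  of any vertex labelled \<open>d\<close>.\<close>

definition graph :: "(nat, nat) pre_digraph" where
  "graph = \<lparr>verts = enc ` D, arcs = arc ` {y. \<exists>p\<in>W. y \<in> ch p},
     tail = (\<lambda>e. fst (prod_decode e)),
     head = (\<lambda>e. enc (l (SOME y. (\<exists>p\<in>W. y \<in> ch p) \<and> arc y = e)))\<rparr>"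

lemma arc_eq_iff:
  assumes "y \<in> ch p" "p \<in> W" "y' \<in> ch p'" "p' \<in> W"
  shows "arc y = arc y' \<longleftrightarrow> l p = l p' \<and> idx y = idx y'"
  using assms enc_inj label_in by (auto simp: arc_def par_eq)

text \<open>Equal arcs come from parents with the same label and children of the same rank, which
  compatibility labels alike. Hence the choice in \<open>head\<close> is harmless.\<close>

lemma arc_eq_label:
  assumes "y \<in> ch p" "p \<in> W" "y' \<in> ch p'" "p' \<in> W" "arc y = arc y'"
  shows "l y = l y'"
proof -
  have e: "l p = l p'" "idx y = idx y'" using arc_eq_iff assms by auto
  obtain b where "b \<in> ch p'" "idx b = idx y" "l b = l y" using child_matching[of p p' y] assms e by blast
  then show ?thesis using idx_inj[of b p' y'] assms(3) e by simp
qed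

lemma arc_in: "y \<in> ch p \<Longrightarrow> p \<in> W \<Longrightarrow> arc y \<in> arcs graph"
  by (auto simp: graph_def)

lemma arc_tail: "y \<in> ch p \<Longrightarrow> tail graph (arc y) = enc (l p)"
  by (simp add: graph_def arc_def par_eq)

lemma arc_head:
  assumes "y \<in> ch p" "p \<in> W" shows "head graph (arc y) = enc (l y)"
proof -
  let ?P = "\<lambda>z. (\<exists>p\<in>W. z \<in> ch p) \<and> arc z = arc y"
  have P: "?P (SOME z. ?P z)" using assms by (intro someI_ex[of ?P]) blast
  then obtain q where q: "q \<in> W" "(SOME z. ?P z) \<in> ch q" by blast
  have "l (SOME z. ?P z) = l y" using arc_eq_label[OF q(2,1) assms] P by blast
  then show ?thesis by (simp add: graph_def)
qed

lemma arcs_E: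
  assumes "e \<in> arcs graph" "tail graph e = enc (l v)" "v \<in> W"
  obtains y where "y \<in> ch v" "arc y = e"
proof -
  obtain z p where z: "p \<in> W" "z \<in> ch p" "e = arc z" using assms(1) by (auto simp: graph_def)
  have lp: "l p = l v" using arc_tail[OF z(2)] assms z enc_inj label_in by simp
  obtain y where y: "y \<in> ch v" "idx y = idx z" using child_matching[of p v z] z lp assms(3) by blast
  then have "arc y = e" using arc_eq_iff[OF y(1) assms(3) z(2,1)] lp z(3) by simp
  with y(1) show ?thesis by (rule that)
qed

lemma child_W: "y \<in> ch p \<Longrightarrow> y \<in> W"
  using ch_D(2,5) by blast

lemma label_ex: "d \<in> D \<Longrightarrow> \<exists>v\<in>W. l v = d"
  using ch_nonempty[OF root_in] child_W label_below desc_V(1) desc_nonroot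
  by (metis DiffD2 DiffI empty_iff insert_iff)

lemma fin_digraph_graph: "fin_digraph graph"
proof
  show "finite (verts graph)" using finite_D by (simp add: graph_def)
  \<comment> \<open>One vertex per label suffices: every edge out of that label is the arc of one of
    its children.\<close>
  have "arcs graph \<subseteq> (\<Union>d\<in>D. arc ` ch (SOME v. v \<in> W \<and> l v = d))"
  proof
    fix e assume e: "e \<in> arcs graph"
    then obtain z p where z: "p \<in> W" "z \<in> ch p" "e = arc z" by (auto simp: graph_def)
    define v where "v = (SOME v. v \<in> W \<and> l v = l p)"
    have v: "v \<in> W \<and> l v = l p" unfolding v_def using z(1) by (rule someI_ex[OF exI[of _ p], OF conjI]) simp
    then obtain y where "y \<in> ch v" "arc y = e" using arcs_E[OF e, of v] arc_tail[OF z(2)] z(3) by metis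
    then show "e \<in> (\<Union>d\<in>D. arc ` ch (SOME v. v \<in> W \<and> l v = d))"
      using label_in[OF z(1)] unfolding v_def by blast
  qed
  then show "finite (arcs graph)" using finite_D finite_ch by (meson finite_UN_I finite_imageI finite_subset)
  fix e assume "e \<in> arcs graph"
  then obtain z p where z: "p \<in> W" "z \<in> ch p" "e = arc z" by (auto simp: graph_def)
  show "tail graph e \<in> verts graph"
    using arc_tail[OF z(2)] label_in[OF z(1)] z(3) by (simp add: graph_def)
  have "enc (l z) \<in> verts graph" using label_in[OF child_W[OF z(2)]] by (simp add: graph_def)
  then show "head graph e \<in> verts graph" using arc_head[OF z(2,1)] z(3) by simp
qed

lemma finite_adj: "finite {e \<in> arcs graph. tail graph e = a \<and> head graph e = b}"
  using fin_digraph.finite_arcs[OF fin_digraph_graph] by simp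

text \<open>Every label occurs below every labelled vertex, and a descending chain of vertices is a
  path of labels; this gives irreducibility. A permutation matrix would leave a single edge out of
  each label, but two children of a branching vertex give two edges.\<close>

lemma diconnected: "diconnected_noncircular graph"
proof -
  let ?V = "verts graph" and ?M = "adj_matrix graph"
  have verts: "?V = enc ` D" by (simp add: graph_def)
  have finV: "finite ?V" using finite_D verts by simp
  have reach: "\<exists>n. matrix_pow ?V ?M n (enc (l v)) (enc (l x)) \<noteq> 0" if "x \<in> desc v" "v \<in> W" for v x
  proof -
    have "(v, x) \<in> childrel\<^sup>*" using that(1) by (simp add: desc_iff)
    then have "v \<in> W \<longrightarrow> (\<exists>n. matrix_pow ?V ?M n (enc (l v)) (enc (l x)) \<noteq> 0)"
    proof (induction rule: converse_rtrancl_induct)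
      case base
      have "matrix_pow ?V ?M 0 (enc (l x)) (enc (l x)) \<noteq> 0" by simp
      then show ?case by blast
    next
      case (step v u)
      show ?case
      proof
        assume v: "v \<in> W"
        have u: "u \<in> ch v" using step by (simp add: childrel_def)
        obtain n where n: "matrix_pow ?V ?M n (enc (l u)) (enc (l x)) \<noteq> 0"
          using step child_W[OF u] by blast
        have "arc u \<in> {e \<in> arcs graph. tail graph e = enc (l v) \<and> head graph e = enc (l u)}"
          using arc_in arc_tail arc_head u v by simp
        then have "?M (enc (l v)) (enc (l u)) \<noteq> 0"
          using finite_adj by (auto simp: adj_matrix_def simp del: mem_Collect_eq)
        moreover have "enc (l u) \<in> ?V" using label_in[OF child_W[OF u]] verts by blast
        ultimately have "matrix_pow ?V ?M (Suc n) (enc (l v)) (enc (l x)) \<noteq> 0"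
          using n finV by auto
        then show "\<exists>n. matrix_pow ?V ?M n (enc (l v)) (enc (l x)) \<noteq> 0" by blast
      qed
    qed
    then show ?thesis using that by blast
  qed
  have "irreducible_matrix ?V ?M"
    unfolding irreducible_matrix_def
  proof (intro ballI)
    fix a b assume "a \<in> ?V" "b \<in> ?V"
    then obtain c d where cd: "c \<in> D" "a = enc c" "d \<in> D" "b = enc d" using verts by auto
    obtain v where v: "v \<in> W" "l v = c" using label_ex cd by blast
    obtain x where "x \<in> desc v" "l x = d" using label_below v cd by blast
    then show "\<exists>n. matrix_pow ?V ?M n a b \<noteq> 0" using reach v cd by blast
  qed
  moreover have "\<not> permutation_matrix ?V ?M"
  proof
    assume "permutation_matrix ?V ?M"
    then obtain \<pi> where p: "\<And>v w. v \<in> ?V \<Longrightarrow> w \<in> ?V \<Longrightarrow> ?M v w = (if w = \<pi> v then 1 else 0)"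
      by (auto simp: permutation_matrix_def)
    obtain c where c: "c \<in> ch rt" using ch_nonempty root_in by blast
    \<comment> \<open>Searching below a child of the root guarantees that the branching vertex
      carries a label.\<close>
    obtain b a a' where b: "b \<in> desc c" "a \<in> ch b" "a' \<in> ch b" "a \<noteq> a'" using branch ch_D(2)[OF c] by blast
    have bW: "b \<in> W" using desc_nonroot[OF b(1)] desc_V(1)[OF b(1)] ch_D(5)[OF c] by blast
    let ?S = "\<lambda>w. {e \<in> arcs graph. tail graph e = enc (l b) \<and> head graph e = w}"
    have in1: "arc z \<in> ?S (enc (l z))" if "z \<in> ch b" for z
      using arc_in arc_tail arc_head that bW by simp
    have V: "enc (l b) \<in> ?V" using label_in[OF bW] verts by blast
    have Vz: "enc (l z) \<in> ?V" if "z \<in> ch b" for z using label_in[OF child_W[OF that]] verts by blast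
    have pi: "enc (l z) = \<pi> (enc (l b))" if z: "z \<in> ch b" for z
    proof -
      have "card (?S (enc (l z))) \<noteq> 0" using in1[OF z] finite_adj by (auto simp del: mem_Collect_eq)
      then show ?thesis using p[OF V Vz[OF z]] by (auto simp: adj_matrix_def split: if_splits)
    qed
    have "card (?S (enc (l a))) = 1" using p[OF V Vz[OF b(2)]] pi[OF b(2)] by (simp add: adj_matrix_def)
    moreover have "arc a \<in> ?S (enc (l a))" "arc a' \<in> ?S (enc (l a))"
      using in1[OF b(2)] in1[OF b(3)] pi[OF b(2)] pi[OF b(3)] by simp_all
    ultimately have "arc a = arc a'" by (metis (no_types, lifting) card_1_singletonE singletonD)
    then show False using arc_eq_iff[OF b(2) bW b(3) bW] idx_inj b by blast
  qed
  ultimately show ?thesis by (simp add: diconnected_noncircular_def)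
qed

section \<open>Rays below a labelled vertex as edge sequences\<close>

lemma follow_path:
  assumes v: "v \<in> W" and x: "\<And>k. x k \<in> arcs graph \<and> head graph (x k) = tail graph (x (Suc k))"
    and x0: "tail graph (x 0) = enc (l v)"
  shows "\<exists>r\<in>thr v. \<forall>k. arc (r (lev v + Suc k)) = x k"
proof -
  define c where "c = rec_nat v (\<lambda>k y. SOME z. z \<in> ch y \<and> arc z = x k)"
  have c0: "c 0 = v" by (simp add: c_def)
  have step: "c (Suc k) \<in> ch (c k) \<and> arc (c (Suc k)) = x k" if ck: "c k \<in> W" "tail graph (x k) = enc (l (c k))" for k
  proof -
    obtain y where "y \<in> ch (c k)" "arc y = x k" using arcs_E[OF _ ck(2,1)] x by blast
    then have "\<exists>z. z \<in> ch (c k) \<and> arc z = x k" by blast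
    from someI_ex[OF this] show ?thesis by (simp add: c_def)
  qed
  have inv: "c k \<in> W \<and> tail graph (x k) = enc (l (c k))" for k
  proof (induction k)
    case 0
    then show ?case using v x0 by (simp add: c0)
  next
    case (Suc k)
    note s = step[of k]
    have "c (Suc k) \<in> W" using s Suc child_W by blast
    moreover have "tail graph (x (Suc k)) = enc (l (c (Suc k)))"
      using x[of k] s Suc arc_head[of "c (Suc k)" "c k"] by simp
    ultimately show ?case by simp
  qed
  then obtain r where r: "r \<in> bd" "\<forall>k. r (lev v + k) = c k"
    using bd_extend[of v c] v c0 step by blast
  have "r (lev v) = v" using r(2)[rule_format, of 0] c0 by simp
  then show ?thesis using r step inv by (intro bexI[of _ r]) (auto simp: thr_iff simp del: add_Suc_right)
qed

lemma bd_W: "r \<in> bd \<Longrightarrow> r (Suc n) \<in> W"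
  using bd_Suc child_W by blast

text \<open>An arc contains the rank of the child, so from a common vertex equal arcs lead to the
  same child.\<close>

lemma thr_agree_iff:
  assumes v: "v \<in> W" and r: "r \<in> thr v" "s \<in> thr v"
  shows "r (lev v + k) = s (lev v + k) \<longleftrightarrow> (\<forall>j<k. arc (r (lev v + Suc j)) = arc (s (lev v + Suc j)))"
proof
  assume e: "r (lev v + k) = s (lev v + k)"
  then show "\<forall>j<k. arc (r (lev v + Suc j)) = arc (s (lev v + Suc j))"
    using bd_agree_le[of r s "lev v + k"] r by (auto simp: thr_iff simp del: add_Suc_right)
next
  assume "\<forall>j<k. arc (r (lev v + Suc j)) = arc (s (lev v + Suc j))"
  then show "r (lev v + k) = s (lev v + k)"
  proof (induction k)
    case 0
    then show ?case using r by (simp add: thr_iff)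
  next
    case (Suc k)
    let ?p = "r (lev v + k)"
    have e: "?p = s (lev v + k)" using Suc by simp
    have pW: "?p \<in> W" using thr_desc[OF r(1), of k] desc_nonroot desc_V(1) v by blast
    have c: "r (lev v + Suc k) \<in> ch ?p" "s (lev v + Suc k) \<in> ch ?p"
      using bd_Suc[of r "lev v + k"] bd_Suc[of s "lev v + k"] r e by (simp_all add: thr_iff)
    have "arc (r (lev v + Suc k)) = arc (s (lev v + Suc k))" using Suc.prems by blast
    then show ?case using arc_eq_iff[OF c(1) pW c(2) pW] idx_inj c by blast
  qed
qed

lemma thr_eqI:
  assumes v: "v \<in> W" and r: "r \<in> thr v" "s \<in> thr v"
    and "\<And>k. arc (r (lev v + Suc k)) = arc (s (lev v + Suc k))"
  shows "r = s"
  using bd_eventually_eq[of r s "lev v" "lev v"] thr_agree_iff[OF v r] assms(4) r by (simp add: thr_iff)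

text \<open>Off the root, the arc and the colour of a child carry the same data. For surjectivity,
  the edge sequence of a ray below \<open>u\<close> starts at the common label and can therefore be
  followed below \<open>v\<close>.\<close>

lemma tisoI:
  assumes v: "v \<in> W" "u \<in> W" "l v = l u"
    and F: "\<And>r. r \<in> thr v \<Longrightarrow> F r \<in> thr u \<and> (\<forall>k. arc (F r (lev u + Suc k)) = arc (r (lev v + Suc k)))"
  shows "tiso col F v u"
proof -
  have "F ` thr v = thr u"
  proof
    show "F ` thr v \<subseteq> thr u" using F by blast
    show "thr u \<subseteq> F ` thr v"
    proof
      fix s assume s: "s \<in> thr u"
      let ?x = "\<lambda>k. arc (s (lev u + Suc k))"
      have sW: "s (lev u + k) \<in> W" for k
        using thr_desc[OF s, of k] desc_nonroot desc_V(1) v(2) by blast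
      have sc: "s (lev u + Suc k) \<in> ch (s (lev u + k))" for k
        using bd_Suc[of s "lev u + k"] s by (simp add: thr_iff)
      have "?x k \<in> arcs graph \<and> head graph (?x k) = tail graph (?x (Suc k))" for k
        using arc_in[OF sc sW] arc_head[OF sc sW] arc_tail[OF sc[of "Suc k"]] by simp
      moreover have "tail graph (?x 0) = enc (l v)"
        using arc_tail[OF sc[of 0]] s v(3) by (simp add: thr_iff)
      ultimately obtain r where r: "r \<in> thr v" "\<forall>k. arc (r (lev v + Suc k)) = ?x k"
        using follow_path[OF v(1), of ?x] by blast
      have "F r = s" using thr_eqI[OF v(2), of "F r" s] F[OF r(1)] r(2) s by simp
      then show "s \<in> F ` thr v" using r(1) by blast
    qed
  qed
  moreover have "r (lev v + k) = s (lev v + k) \<longleftrightarrow> F r (lev u + k) = F s (lev u + k)"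
    if "r \<in> thr v" "s \<in> thr v" for r s k
    using thr_agree_iff[OF v(1) that] thr_agree_iff[OF v(2), of "F r" "F s"] F that by simp
  moreover have "col (F r (lev u + Suc k)) = col (r (lev v + Suc k))" if r: "r \<in> thr v" for r k
  proof -
    have Fr: "F r \<in> thr u" using F r by blast
    have W: "r (lev v + k) \<in> W" "F r (lev u + k) \<in> W"
      using thr_desc[OF r, of k] thr_desc[OF Fr, of k] desc_nonroot desc_V(1) v by blast+
    have c: "r (lev v + Suc k) \<in> ch (r (lev v + k))" "F r (lev u + Suc k) \<in> ch (F r (lev u + k))"
      using bd_Suc[of r "lev v + k"] bd_Suc[of "F r" "lev u + k"] r Fr by (simp_all add: thr_iff)
    have "arc (F r (lev u + Suc k)) = arc (r (lev v + Suc k))" using F[OF r] by blast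
    then show ?thesis
      using arc_eq_iff[OF c(2) W(2) c(1) W(1)] W par_eq[OF c(1)] par_eq[OF c(2)]
      by (simp add: col_def del: add_Suc_right)
  qed
  ultimately show ?thesis using v by (simp add: tiso_def)
qed

lemma tiso_arc:
  assumes t: "tiso col F v u" and v: "v \<in> W" "u \<in> W" and r: "r \<in> thr v"
  shows "arc (F r (lev u + Suc k)) = arc (r (lev v + Suc k))"
proof -
  have Fr: "F r \<in> thr u" using tiso_thr[OF t r] .
  have W: "r (lev v + k) \<in> W" "F r (lev u + k) \<in> W"
    using thr_desc[OF r, of k] thr_desc[OF Fr, of k] desc_nonroot desc_V(1) v by blast+
  have c: "r (lev v + Suc k) \<in> ch (r (lev v + k))" "F r (lev u + Suc k) \<in> ch (F r (lev u + k))"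
    using bd_Suc[of r "lev v + k"] bd_Suc[of "F r" "lev u + k"] r Fr by (simp_all add: thr_iff)
  show ?thesis
    using tiso_col[OF t r, of k] arc_eq_iff[OF c(2) W(2) c(1) W(1)] W par_eq[OF c(1)] par_eq[OF c(2)]
    by (simp add: col_def del: add_Suc_right split: if_splits)
qed

end

section \<open>Coding rays by edge paths\<close>

context labelled_tree
begin

text \<open>The word attached to a child \<open>c\<close> of the root labels the path from \<open>v0\<close> to a vertex
  \<open>w c\<close> with the same label as \<open>c\<close>; these words are pairwise incomparable, so replacing the
  first step of a ray by its word embeds the boundary into the path space.\<close>

definition branch_code :: "'v \<Rightarrow> ('v \<Rightarrow> 'v) \<Rightarrow> ('v \<Rightarrow> nat \<Rightarrow> 'v) \<Rightarrow> bool" where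
  "branch_code v0 w \<rho> \<longleftrightarrow> v0 \<in> ch rt \<and> (\<forall>c\<in>ch rt. w c \<in> desc v0 \<and> w c \<noteq> v0 \<and> l (w c) = l c \<and>
     \<rho> c \<in> thr (w c) \<and> (\<forall>c'\<in>ch rt. w c' \<in> desc (w c) \<longrightarrow> c' = c))"

lemma branch_code_ex: "\<exists>v0 w \<rho>. branch_code v0 w \<rho>"
proof -
  obtain v0 where v0: "v0 \<in> ch rt" using ch_nonempty root_in by blast
  have "ch rt \<subseteq> W" "v0 \<in> W" using child_W v0 by blast+
  then obtain w where w: "\<forall>c\<in>ch rt. w c \<in> desc v0 \<and> w c \<noteq> v0 \<and> l (w c) = l c \<and>
      (\<forall>c'\<in>ch rt. w c' \<in> desc (w c) \<longrightarrow> c' = c)"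
    using incomparable[OF finite_ch] by blast
  define \<rho> where "\<rho> = (\<lambda>c. SOME r. r \<in> thr (w c))"
  have "\<rho> c \<in> thr (w c)" if "c \<in> ch rt" for c
    unfolding \<rho>_def using someI_ex[OF thr_nonempty] desc_V(1) w that by metis
  then have "branch_code v0 w \<rho>" using w v0 unfolding branch_code_def by blast
  then show ?thesis by blast
qed

definition "base = (SOME v0. \<exists>w \<rho>. branch_code v0 w \<rho>)"
definition "wend = (SOME w. \<exists>\<rho>. branch_code base w \<rho>)"
definition "wray = (SOME \<rho>. branch_code base wend \<rho>)"

lemma branch_code: "branch_code base wend wray"
proof -
  have "\<exists>w \<rho>. branch_code base w \<rho>" unfolding base_def using branch_code_ex by (rule someI_ex)
  then have "\<exists>\<rho>. branch_code base wend \<rho>" unfolding wend_def by (rule someI_ex)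
  then show ?thesis unfolding wray_def by (rule someI_ex)
qed

lemma wend:
  assumes "c \<in> ch rt"
  shows "wend c \<in> desc base" "wend c \<noteq> base" "l (wend c) = l c" "wray c \<in> thr (wend c)"
    "c' \<in> ch rt \<Longrightarrow> wend c' \<in> desc (wend c) \<Longrightarrow> c' = c"
  using branch_code assms by (auto simp: branch_code_def)

lemma base: "base \<in> ch rt" "base \<in> W" "lev base = 1"
proof -
  show "base \<in> ch rt" using branch_code by (simp add: branch_code_def)
  then show "base \<in> W" "lev base = 1" using child_W ch_D(3)[of base rt] lev_root by auto
qed

text \<open>The word of \<open>c\<close> consists of the edges from \<open>base\<close>, which has
  level 1, down to \<open>wend c\<close>.\<close>

definition "wlen c = lev (wend c) - 1"

lemma wlen: "c \<in> ch rt \<Longrightarrow> lev (wend c) = Suc (wlen c)" "c \<in> ch rt \<Longrightarrow> 0 < wlen c"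
  using desc_lev[OF wend(1)] wend(2) base(3) by (fastforce simp: wlen_def)+

lemma wray: "c \<in> ch rt \<Longrightarrow> wray c \<in> thr base" "c \<in> ch rt \<Longrightarrow> wray c \<in> bd"
    "c \<in> ch rt \<Longrightarrow> wray c (Suc (wlen c)) = wend c"
proof -
  assume c: "c \<in> ch rt"
  show "wray c \<in> thr base" using wend(4)[OF c] thr_mono[OF wend(1)[OF c]] by blast
  show "wray c \<in> bd" "wray c (Suc (wlen c)) = wend c" using wend(4)[OF c] wlen(1)[OF c] by (auto simp: thr_iff)
qed

text \<open>\<open>wray (r 1)\<close> passes through \<open>base\<close> at level 1, so the first
  edge of the word leads to level 2. Likewise the step into \<open>r 1\<close> leaves the unlabelled
  root and is dropped, so the tail starts with the arc of \<open>r 2\<close>.\<close>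

definition code :: "(nat \<Rightarrow> 'v) \<Rightarrow> nat \<Rightarrow> nat" where
  "code r = (\<lambda>k. if k < wlen (r 1) then arc (wray (r 1) (Suc (Suc k)))
     else arc (r (Suc (Suc (k - wlen (r 1))))))"

lemma bd_1: "r \<in> bd \<Longrightarrow> r 1 \<in> ch rt"
  using bd_Suc[of r 0] bd_0 by simp

lemma code_tail: "code r (wlen (r 1) + k) = arc (r (Suc (Suc k)))"
  by (simp add: code_def)

lemma code_word: "k < wlen (r 1) \<Longrightarrow> code r k = arc (wray (r 1) (Suc (Suc k)))"
  by (simp add: code_def)

lemma ray_arc:
  assumes "r \<in> bd"
  shows "arc (r (Suc (Suc k))) \<in> arcs graph" "tail graph (arc (r (Suc (Suc k)))) = enc (l (r (Suc k)))"
    "head graph (arc (r (Suc (Suc k)))) = enc (l (r (Suc (Suc k))))"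
  using arc_in[OF bd_Suc[OF assms] bd_W[OF assms]] arc_tail[OF bd_Suc[OF assms]]
    arc_head[OF bd_Suc[OF assms] bd_W[OF assms]] by auto

lemma code_path: "r \<in> bd \<Longrightarrow> code r \<in> path_space graph"
  unfolding path_space_def
proof (intro CollectI allI)
  fix k assume r: "r \<in> bd"
  let ?c = "r 1" and ?L = "wlen (r 1)"
  note c = bd_1[OF r]
  note a = ray_arc[OF wray(2)[OF c]] and a' = ray_arc[OF r]
  show "code r k \<in> arcs graph \<and> head graph (code r k) = tail graph (code r (Suc k))"
  proof (cases "Suc k < ?L")
    case True
    then show ?thesis using a[of k] a[of "Suc k"] by (simp add: code_word)
  next
    case False
    show ?thesis
    proof (cases "k < ?L")
      case True
      \<comment> \<open>At the junction the word ends at the label of \<open>wend ?c\<close>, which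
        is the label of \<open>?c\<close>, where the tail starts.\<close>
      then have k: "Suc k = ?L" using False by simp
      have "code r (Suc k) = arc (r (Suc (Suc 0)))" using code_tail[of r 0] k by simp
      moreover have "l (wray ?c (Suc (Suc k))) = l ?c" using wray(3)[OF c] wend(3)[OF c] k by simp
      ultimately show ?thesis using a[of k] a'[of 0] True by (simp add: code_word)
    next
      case False
      then obtain j where j: "k = ?L + j" using le_Suc_ex not_less by blast
      then have "code r k = arc (r (Suc (Suc j)))" "code r (Suc k) = arc (r (Suc (Suc (Suc j))))"
        using code_tail[of r j] code_tail[of r "Suc j"] by simp_all
      then show ?thesis using a'[of j] a'[of "Suc j"] by simp
    qed
  qed
qed

text \<open>If the shorter word were a prefix of the longer one, \<open>wend c'\<close> would lie
  below \<open>wend c\<close>; incomparability then gives equality.\<close>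

lemma agree_wray:
  assumes c: "c \<in> ch rt" "c' \<in> ch rt" and le: "wlen c \<le> wlen c'"
    and ag: "\<And>k. k < wlen c \<Longrightarrow> arc (wray c (Suc (Suc k))) = arc (wray c' (Suc (Suc k)))"
  shows "c = c'"
proof -
  have "wray c (lev base + wlen c) = wray c' (lev base + wlen c)"
    using thr_agree_iff[OF base(2) wray(1)[OF c(1)] wray(1)[OF c(2)], of "wlen c"] ag base(3) by simp
  then have "wray c' (Suc (wlen c)) = wend c" using wray(3)[OF c(1)] base(3) by simp
  then have "wend c' \<in> desc (wend c)"
    using bd_desc_le[OF wray(2)[OF c(2)], of "Suc (wlen c)" "Suc (wlen c')"] wray(3)[OF c(2)] le by simp
  then show ?thesis using wend(5)[OF c(1,2)] by simp
qed

lemma code_agree_first: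
  assumes r: "r \<in> bd" "s \<in> bd" and ag: "agree (wlen (r 1)) (code r) (code s)"
  shows "r 1 = s 1"
proof (cases "wlen (r 1) \<le> wlen (s 1)")
  case True
  then show ?thesis
    using agree_wray[OF bd_1[OF r(1)] bd_1[OF r(2)] True] agreeD[OF ag] code_word[of _ r] code_word[of _ s] by simp
next
  case False
  then have le: "wlen (s 1) \<le> wlen (r 1)" by simp
  have "s 1 = r 1"
    using agree_wray[OF bd_1[OF r(2)] bd_1[OF r(1)] le] agreeD[OF ag] code_word[of _ r] code_word[of _ s] le by simp
  then show ?thesis by simp
qed

text \<open>The dictionary between cylinders of codes and subtrees of rays. Agreement on the word
  already reveals \<open>r 1\<close>, and each further edge reveals one more vertex.\<close>

lemma code_agree_iff:
  assumes r: "r \<in> bd" "s \<in> bd"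
  shows "agree (wlen (r 1) + k) (code r) (code s) \<longleftrightarrow> r (Suc k) = s (Suc k)"
proof -
  let ?L = "wlen (r 1)"
  have iff: "r (Suc k) = s (Suc k) \<longleftrightarrow> (\<forall>j<k. arc (r (Suc (Suc j))) = arc (s (Suc (Suc j))))"
    if e: "r 1 = s 1" for k
  proof -
    have lv: "lev (r 1) = 1" using bd_lev[OF r(1)] .
    have "r \<in> thr (r 1)" "s \<in> thr (r 1)" using thr_self r e by metis+
    then show ?thesis using thr_agree_iff[OF bd_W[OF r(1), of 0], of r s k] lv by simp
  qed
  show ?thesis
  proof
    assume ag: "agree (?L + k) (code r) (code s)"
    then have e: "r 1 = s 1" using code_agree_first[OF r] agree_mono by (metis le_add1)
    have "arc (r (Suc (Suc j))) = arc (s (Suc (Suc j)))" if "j < k" for j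
      using agreeD[OF ag, of "?L + j"] code_tail[of r j] code_tail[of s j] e that by simp
    then show "r (Suc k) = s (Suc k)" using iff[OF e] by blast
  next
    assume eq: "r (Suc k) = s (Suc k)"
    then have e: "r 1 = s 1" using bd_agree_le[OF r eq, of 1] by simp
    have a: "arc (r (Suc (Suc j))) = arc (s (Suc (Suc j)))" if "j < k" for j
      using iff[OF e] eq that by blast
    show "agree (?L + k) (code r) (code s)"
      unfolding agree_def
    proof (intro allI impI)
      fix i assume i: "i < ?L + k"
      show "code r i = code s i"
      proof (cases "i < ?L")
        case True
        then show ?thesis using code_word[of i r] code_word[of i s] e by simp
      next
        case False
        then obtain j where "i = ?L + j" using le_Suc_ex not_less by blast
        then show ?thesis using a[of j] i code_tail[of r j] code_tail[of s j] e by simp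
      qed
    qed
  qed
qed

definition "codes = code ` bd"

lemma code_inj: "inj_on code bd"
proof (rule inj_onI)
  fix r s assume r: "r \<in> bd" "s \<in> bd" and e: "code r = code s"
  have "r (1 + k) = s (1 + k)" for k
    using code_agree_iff[OF r, of k] e by (simp add: agree_refl)
  then show "r = s" using bd_eventually_eq[OF r] by blast
qed

text \<open>A path beginning with the word of a child \<open>c\<close> of the root goes on from the
  label of \<open>c\<close>, so its remainder can be followed as a ray below
  \<open>c\<close>.\<close>

lemma codesI:
  assumes x: "x \<in> path_space graph" and r: "r \<in> bd" and ag: "agree (wlen (r 1)) (code r) x"
  shows "x \<in> codes"
proof -
  let ?c = "r 1" and ?L = "wlen (r 1)"
  note c = bd_1[OF r]
  \<comment> \<open>The word is nonempty, so its last edge determines the vertex of the graph where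
    the rest of \<open>x\<close> starts.\<close>
  obtain L' where L': "?L = Suc L'" using wlen(2)[OF c] gr0_implies_Suc by blast
  have "head graph (x L') = head graph (arc (wray ?c (Suc (Suc L'))))"
    using agreeD[OF ag, of L'] code_word[of L' r] L' by simp
  also have "\<dots> = enc (l ?c)"
    using ray_arc(3)[OF wray(2)[OF c], of L'] wray(3)[OF c] wend(3)[OF c] L' by simp
  finally have x0: "tail graph (x (?L + 0)) = enc (l ?c)" using x L' by (simp add: path_space_def)
  have "\<And>k. x (?L + k) \<in> arcs graph \<and> head graph (x (?L + k)) = tail graph (x (?L + Suc k))"
    using x by (simp add: path_space_def)
  then obtain s where s: "s \<in> thr ?c" "\<forall>k. arc (s (lev ?c + Suc k)) = x (?L + k)"
    using follow_path[OF child_W[OF c], of "\<lambda>k. x (?L + k)"] x0 by blast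
  have lc: "lev ?c = 1" using bd_lev[OF r] .
  then have s1: "s \<in> bd" "s 1 = ?c" using s(1) by (auto simp: thr_iff)
  have "code s = x"
  proof (rule agree_tails_eq)
    show "agree ?L (code s) x"
      using ag s1 code_word[of _ s] code_word[of _ r] by (simp add: agree_def)
    show "code s (?L + k) = x (?L + k)" for k
      using code_tail[of s k] s(2) s1 lc by simp
  qed
  then show ?thesis using s1 by (auto simp: codes_def)
qed

lemma clopen_codes: "clopenin (path_topology graph) codes"
  unfolding shift_graph.clopenin_path
proof (intro conjI ballI)
  show "codes \<subseteq> path_space graph" using code_path by (auto simp: codes_def)
  fix x assume x: "x \<in> path_space graph"
  \<comment> \<open>The root has finitely many children, so the longest word bounds the prefix that
    decides membership.\<close>
  define n where "n = Max (wlen ` ch rt)"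
  have n: "wlen (r 1) \<le> n" if "r \<in> bd" for r
    unfolding n_def using finite_ch bd_1[OF that] by simp
  have imp: "y \<in> codes" if y: "y \<in> path_space graph" "agree n z y" "z \<in> codes" for z y
  proof -
    obtain r where r: "r \<in> bd" "z = code r" using y(3) by (auto simp: codes_def)
    then show ?thesis using codesI[OF y(1) r(1)] agree_mono[OF y(2) n[OF r(1)]] by simp
  qed
  show "\<exists>n. \<forall>y\<in>path_space graph. agree n x y \<longrightarrow> (y \<in> codes) = (x \<in> codes)"
  proof (intro exI ballI impI)
    fix y assume y: "y \<in> path_space graph" "agree n x y"
    then have "agree n y x" by (simp add: agree_sym)
    then show "(y \<in> codes) = (x \<in> codes)" using imp[OF y] imp[OF x] by blast
  qed
qed

definition decode :: "(nat \<Rightarrow> nat) \<Rightarrow> (nat \<Rightarrow> 'v)" where "decode = inv_into bd code"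

lemma code_bij: "bij_betw code bd codes"
  using code_inj by (simp add: bij_betw_def codes_def)

lemma decode_bij: "bij_betw decode codes bd"
  unfolding decode_def using code_bij by (rule bij_betw_inv_into)

lemma decode: "r \<in> bd \<Longrightarrow> decode (code r) = r" "x \<in> codes \<Longrightarrow> code (decode x) = x"
    "x \<in> codes \<Longrightarrow> decode x \<in> bd" "r \<in> bd \<Longrightarrow> code r \<in> codes"
  unfolding decode_def codes_def using code_inj by (auto simp: f_inv_into_f inv_into_into)

section \<open>Transporting boundary maps to codes\<close>

definition transport :: "((nat \<Rightarrow> 'v) \<Rightarrow> (nat \<Rightarrow> 'v)) \<Rightarrow> (nat \<Rightarrow> nat) \<Rightarrow> (nat \<Rightarrow> nat)" where
  "transport F = (\<lambda>x\<in>codes. code (F (decode x)))"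

lemma transport_prefix_replacing:
  assumes F: "F \<in> local_iso col"
  shows "prefix_replacing codes (transport F)"
proof -
  have bij: "bij_betw F bd bd" using local_iso_bij[OF F] .
  have Fb: "F r \<in> bd" if "r \<in> bd" for r using bij_betw_apply[OF bij that] .
  have "bij_betw (code \<circ> (F \<circ> decode)) codes codes"
    by (rule bij_betw_trans[OF bij_betw_trans[OF decode_bij bij] code_bij])
  then have bt: "bij_betw (transport F) codes codes"
    unfolding transport_def by (simp add: comp_def cong: bij_betw_cong)
  have "\<exists>N n m. \<forall>z\<in>codes. agree N y z \<longrightarrow>
      agree n (transport F y) (transport F z) \<and> (\<forall>k. transport F z (n + k) = z (m + k))" if y: "y \<in> codes" for y
  proof -
    obtain r where r: "r \<in> bd" "y = code r" using y by (auto simp: codes_def)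
    obtain p w where t0: "tiso col F (r p) w" using F r(1) by (auto simp: local_iso_def)
    define q where "q = lev w"
    \<comment> \<open>One level below \<open>r p\<close> and \<open>w\<close> both vertices are off
      the root and so carry labels.\<close>
    let ?v = "r (Suc p)" and ?u = "F r (Suc q)"
    have t: "tiso col F ?v ?u"
      using tiso_desc[OF t0 thr_self[OF r(1)], of 1] bd_lev[OF r(1)] by (simp add: q_def)
    have lv: "lev ?v = Suc p" "lev ?u = Suc q" using bd_lev r(1) Fb by blast+
    have W: "?v \<in> W" "?u \<in> W" using bd_W r(1) Fb by blast+
    \<comment> \<open>The lengths of the codes down to \<open>?v\<close> and \<open>?u\<close>: the
      word and then one edge for each level beyond 1.\<close>
    let ?N = "wlen (r 1) + p" and ?n = "wlen (F r 1) + q"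
    have "agree ?n (transport F y) (transport F z) \<and> (\<forall>k. transport F z (?n + k) = z (?N + k))"
      if z: "z \<in> codes" "agree ?N y z" for z
    proof -
      obtain s where s: "s \<in> bd" "z = code s" using z(1) by (auto simp: codes_def)
      have e: "r (Suc p) = s (Suc p)" using code_agree_iff[OF r(1) s(1), of p] z(2) r s by simp
      have sv: "s \<in> thr ?v" "r \<in> thr ?v" using e s r lv by (auto simp: thr_iff)
      have "F s \<in> thr ?u" using tiso_thr[OF t] sv by blast
      then have Fe: "F r (Suc q) = F s (Suc q)" using lv by (simp add: thr_iff)
      have e1: "r 1 = s 1" "F r 1 = F s 1"
        using bd_agree_le[OF r(1) s(1) e, of 1] bd_agree_le[OF Fb[OF r(1)] Fb[OF s(1)] Fe, of 1] by auto
      have tr: "transport F y = code (F r)" "transport F z = code (F s)"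
        using r s y z decode(1) by (simp_all add: transport_def)
      have "transport F z (?n + k) = z (?N + k)" for k
        using tiso_arc[OF t W sv(1), of k] code_tail[of "F s" "q + k"] code_tail[of s "p + k"] lv e1 tr s
        by (simp add: add.assoc)
      then show ?thesis using code_agree_iff[OF Fb[OF r(1)] Fb[OF s(1)], of q] Fe tr by simp
    qed
    then show ?thesis by blast
  qed
  then show ?thesis using bt by (simp add: prefix_replacing_def transport_def)
qed

lemma transport_surj:
  assumes f: "prefix_replacing codes f"
  shows "\<exists>F\<in>local_iso col. transport F = f"
proof -
  define F where "F = (\<lambda>r\<in>bd. decode (f (code r)))"
  have bf: "bij_betw f codes codes" using f by (simp add: prefix_replacing_def)
  have fc: "f (code r) \<in> codes" if "r \<in> bd" for r using bij_betw_apply[OF bf decode(4)[OF that]] .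
  have cF: "code (F r) = f (code r)" if "r \<in> bd" for r using fc[OF that] decode(2) that by (simp add: F_def)
  have Fb: "F r \<in> bd" if "r \<in> bd" for r using fc[OF that] decode(3) that by (simp add: F_def)
  have "bij_betw (decode \<circ> (f \<circ> code)) bd bd"
    by (rule bij_betw_trans[OF bij_betw_trans[OF code_bij bf] decode_bij])
  then have bF: "bij_betw F bd bd"
    unfolding F_def by (simp add: comp_def cong: bij_betw_cong)
  have "\<exists>n w. tiso col F (r n) w" if r: "r \<in> bd" for r
  proof -
    let ?y = "code r" and ?a = "wlen (r 1)" and ?b = "wlen (F r 1)"
    obtain N n m where L: "\<And>z. z \<in> codes \<Longrightarrow> agree N ?y z \<Longrightarrow> agree n (f ?y) (f z) \<and> (\<forall>k. f z (n + k) = z (m + k))"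
      using f decode(4)[OF r] unfolding prefix_replacing_def by meson
    have Ly: "f ?y (n + k) = ?y (m + k)" for k using L[OF decode(4)[OF r] agree_refl] by blast
    \<comment> \<open>At positions \<open>m + K\<close> and \<open>n + K\<close> both codes are past
      their words, and the first position is at least \<open>N\<close>; \<open>p\<close> and
      \<open>q\<close> convert these positions into levels.\<close>
    define K where "K = ?a + ?b + N"
    define p where "p = m + K - ?a"
    define q where "q = n + K - ?b"
    have K: "m + Suc K = ?a + Suc p" "n + Suc K = ?b + Suc q" "N \<le> ?a + Suc p"
      by (auto simp: K_def p_def q_def)
    let ?v = "r (Suc (Suc p))" and ?u = "F r (Suc (Suc q))"
    note Fr = Fb[OF r]
    have lv: "lev ?v = Suc (Suc p)" "lev ?u = Suc (Suc q)" using bd_lev r Fr by blast+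
    have W: "?v \<in> W" "?u \<in> W" using bd_W r Fr by blast+
    \<comment> \<open>Position \<open>n + K\<close> of \<open>code (F r)\<close> repeats position
      \<open>m + K\<close> of \<open>code r\<close>, so \<open>?v\<close> and \<open>?u\<close> are
      entered by the same edge and have the same label.\<close>
    have "arc ?v = arc ?u"
      using Ly[of K] cF[OF r] code_tail[of r p] code_tail[of "F r" q] K by simp
    then have lab: "l ?v = l ?u" using arc_eq_label[OF bd_Suc[OF r] bd_W[OF r] bd_Suc[OF Fr] bd_W[OF Fr]] by blast
    have "tiso col F ?v ?u"
    proof (rule tisoI[OF W lab])
      fix s assume s': "s \<in> thr ?v"
      then have s: "s \<in> bd" "r (Suc (Suc p)) = s (Suc (Suc p))" using lv by (auto simp: thr_iff)
      note Fs = Fb[OF s(1)]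
      have ag: "agree (m + Suc K) ?y (code s)" using code_agree_iff[OF r s(1), of "Suc p"] s(2) K by simp
      then have "agree N ?y (code s)" using agree_mono K by metis
      then have Ls: "agree n (f ?y) (f (code s))" "\<And>k. f (code s) (n + k) = code s (m + k)"
        using L[OF decode(4)[OF s(1)]] by auto
      have "agree (n + Suc K) (f ?y) (f (code s))"
        unfolding agree_def
      proof (intro allI impI)
        fix i assume i: "i < n + Suc K"
        show "f ?y i = f (code s) i"
        proof (cases "i < n")
          case True
          then show ?thesis using agreeD[OF Ls(1)] by simp
        next
          case False
          then obtain j where j: "i = n + j" using le_Suc_ex not_less by blast
          then show ?thesis using Ly[of j] Ls(2)[of j] agreeD[OF ag, of "m + j"] i by simp
        qed
      qed
      then have Fe: "F r (Suc (Suc q)) = F s (Suc (Suc q))"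
        using code_agree_iff[OF Fr Fs, of "Suc q"] cF[OF r] cF[OF s(1)] K by simp
      have e1: "r 1 = s 1" "F r 1 = F s 1"
        using bd_agree_le[OF r s, of 1] bd_agree_le[OF Fr Fs Fe, of 1] by auto
      have "arc (F s (lev ?u + Suc k)) = arc (s (lev ?v + Suc k))" for k
      proof -
        have "f (code s) (?b + (Suc q + k)) = code s (?a + (Suc p + k))"
          using Ls(2)[of "Suc K + k"] K by (metis add.assoc)
        then show ?thesis
          using code_tail[of "F s" "Suc q + k"] code_tail[of s "Suc p + k"] e1 cF[OF s(1)] lv by simp
      qed
      then show "F s \<in> thr ?u \<and> (\<forall>k. arc (F s (lev ?u + Suc k)) = arc (s (lev ?v + Suc k)))"
        using Fs Fe lv by (simp add: thr_iff)
    qed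
    then show ?thesis by blast
  qed
  then have "F \<in> local_iso col" using bF by (simp add: local_iso_def F_def)
  moreover have "transport F = f"
  proof (rule extensionalityI)
    show "f \<in> extensional codes" using f by (simp add: prefix_replacing_def)
    fix x assume x: "x \<in> codes"
    then show "transport F x = f x" using cF[OF decode(3)[OF x]] decode(2)[OF x] by (simp add: transport_def)
  qed (simp add: transport_def)
  ultimately show ?thesis by blast
qed

lemma transport_inj: "inj_on transport (local_iso col)"
proof (rule inj_onI)
  fix F G assume F: "F \<in> local_iso col" "G \<in> local_iso col" and e: "transport F = transport G"
  show "F = G"
  proof (rule extensionalityI)
    show "F \<in> extensional bd" "G \<in> extensional bd" using F by (auto simp: local_iso_def)
    fix r assume r: "r \<in> bd"
    have "F r \<in> bd" "G r \<in> bd" using bij_betw_apply[OF local_iso_bij r] F by blast+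
    moreover have "transport F (code r) = transport G (code r)" using e by simp
    then have "code (F r) = code (G r)" using decode(1,4)[OF r] by (simp add: transport_def)
    ultimately show "F r = G r" using code_inj by (simp add: inj_on_def)
  qed
qed

lemma transport_compose:
  assumes "G \<in> local_iso col"
  shows "transport (compose bd F G) = compose codes (transport F) (transport G)"
proof (rule extensionalityI)
  fix x assume x: "x \<in> codes"
  have "G (decode x) \<in> bd" using bij_betw_apply[OF local_iso_bij[OF assms] decode(3)[OF x]] .
  then show "transport (compose bd F G) x = compose codes (transport F) (transport G) x"
    using x decode by (simp add: transport_def compose_def)
qed (simp_all add: transport_def compose_def)

lemma V_label_iso:
  "(AAut T)\<lparr>carrier := V_label T lt l\<rparr> \<cong> topological_full_group (reduction (shift_groupoid graph) codes)"
proof -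
  interpret R: shift_reduction graph codes by unfold_locales (rule clopen_codes)
  \<comment> \<open>Each class in \<open>V_label T lt l\<close> is the fibre of exactly one map in
    \<open>local_iso col\<close>, which \<open>inv_into\<close> recovers.\<close>
  let ?\<Phi> = "\<lambda>X. transport (inv_into (local_iso col) cls X)"
  have \<Phi>: "?\<Phi> (cls F) = transport F" if "F \<in> local_iso col" for F
    using inv_into_f_f[OF cls_inj that] by simp
  have cod: "{f. prefix_replacing codes f} = transport ` local_iso col"
    using transport_prefix_replacing transport_surj by blast
  have bij: "bij_betw ?\<Phi> (V_label T lt l) {f. prefix_replacing codes f}"
    unfolding V_label_eq cod
    using bij_betw_trans[OF bij_betw_inv_into[OF inj_on_imp_bij_betw[OF cls_inj]] inj_on_imp_bij_betw[OF transport_inj]]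
    by (simp add: comp_def)
  have "?\<Phi> (X \<otimes>\<^bsub>AAut T\<^esub> Z) = compose codes (?\<Phi> X) (?\<Phi> Z)"
    if XZ: "X \<in> V_label T lt l" "Z \<in> V_label T lt l" for X Z
  proof -
    obtain F G where F: "F \<in> local_iso col" "X = cls F" "G \<in> local_iso col" "Z = cls G"
      using XZ by (auto simp: V_label_eq)
    have "X \<otimes>\<^bsub>AAut T\<^esub> Z = cls (compose bd F G)"
      using mult_AAut[OF local_iso_mono local_iso_mono, OF F(1,3)] F by simp
    then show ?thesis
      using \<Phi>[OF local_iso_comp[OF F(3,1)]] \<Phi>[OF F(1)] \<Phi>[OF F(3)] transport_compose[OF F(3)] F by simp
  qed
  moreover have "?\<Phi> X \<in> {f. prefix_replacing codes f}" if "X \<in> V_label T lt l" for X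
    using bij_betw_apply[OF bij that] .
  ultimately have "?\<Phi> \<in> iso ((AAut T)\<lparr>carrier := V_label T lt l\<rparr>)
      (topological_full_group (reduction (shift_groupoid graph) codes))"
    using bij by (simp add: iso_def hom_def Pi_iff R.carrier_topological_full_group R.mult_topological_full_group)
  then show ?thesis by (rule is_isoI)
qed

end

theorem theorem3p9:
  fixes T :: "'v rooted_graph"
    and lt :: "'v \<Rightarrow> 'v rel"
    and D :: "'d set"
    and l :: "'v \<Rightarrow> 'd"
  assumes "rooted_tree T"
    and "locally_finite T"
    and "leaves T (rverts T) = {}"
    and "no_isolated_points (boundary_topology T)"
    and "plane_order T lt"
    and "labelling T D l"
    and "compatible_labelling T lt l"
    and "\<forall>d\<in>D. spanned_by T (label_class T l d)"
  shows "group (AAut T) \<and> subgroup (V_label T lt l) (AAut T) \<and>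
    (\<exists>(g :: (nat, nat) pre_digraph) Y.
       fin_digraph g \<and> diconnected_noncircular g \<and>
       clopenin (objs (shift_groupoid g)) Y \<and>
       (AAut T)\<lparr>carrier := V_label T lt l\<rparr> \<cong>
         topological_full_group (reduction (shift_groupoid g) Y))"
proof -
  interpret labelled_tree T lt D l
    using assms by unfold_locales
  have "clopenin (objs (shift_groupoid graph)) codes"
    using clopen_codes by (simp add: shift_groupoid_def)
  then show ?thesis
    using group_AAut subgroup_cls[of col] fin_digraph_graph diconnected V_label_iso
    unfolding V_label_eq by blast
qed

end
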